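(* Let $\mathcal{F}(y_1,\dots,y_n)=\eta(q)\,\sigma(y_1)\cdots\sigma(y_n)V(\tau_1,\tau_2,\dots)\big|_{\tau_2=\tau_3=\dots=0}$ (with $q=q_1$) be the Bloch--Okounkov $n$-point function and let $$G(t_1,\dots,t_n)=\eta(q)\,\mathrm{tr}|_{\mathcal{F}_0}\,o(X(\psi,t_1x_1)X(\psi^*,x_1))\cdots o(X(\psi,t_nx_n)X(\psi^*,x_n))\,q^{\bar L(0)}.$$ Suppose that the latter series converges, in some domain, to a multivalued function $G(t_1,\dots,t_n)$. Then, as complex functions, $$\mathcal{F}(y_1,\dots,y_n)=G(t_1,\dots,t_n)\big|_{t_i^{n/2}=e^{ny_i/2}}$$ for every $y=(y_1,\dots,y_n)$, provided that the right-hand side is convergent.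
   Context: Charged free fermions: the Lie superalgebra with odd generators $\psi(n),\psi^*(n)$, $n\in\mathbb{Z}+\frac12$, and central $1$, with $[\psi(n),\psi^*(m)]=\delta_{m+n,0}$, $[\psi(n),\psi(m)]=[\psi^*(n),\psi^*(m)]=0$ (anticommutators). $\mathcal{F}$ is the Fock space generated from $\mathbf 1$ with $\psi(n)\mathbf 1=\psi^*(n)\mathbf 1=0$ for $n>0$, a vertex operator superalgebra of central charge $1$ with conformal vector $\omega=\frac12\psi^*(-3/2)\psi(-1/2)\mathbf 1+\frac12\psi(-3/2)\psi^*(-1/2)\mathbf 1$; $\mathcal{F}=\bigoplus_m\mathcal{F}_m$ is the charge decomposition ($\psi(n),\psi^*(n)$ have charges $1,-1$). With $\psi=\psi(-1/2)\mathbf 1$, $\psi^*=\psi^*(-1/2)\mathbf 1$: $X(\psi,x)=\sum_{n\in\mathbb{Z}+1/2}\psi(n)x^{-n}$, $X(\psi^*,x)=\sum_{n\in\mathbb{Z}+1/2}\psi^*(n)x^{-n}$, $X(\psi,tx)=\sum_n\psi(n)t^{-n}x^{-n}$, and $o(X(\psi,tx)X(\psi^*,x))$ is the coefficient of $x^0$ in $X(\psi,tx)X(\psi^*,x)$. Normal ordering: $:X(\psi,e^yx)X(\psi^*,x):\ =\sum_{n<0}\psi(n)(e^yx)^{-n}X(\psi^*,x)-X(\psi^*,x)\sum_{n>0}\psi(n)(e^yx)^{-n}$. For $r\ge0$, $\bar L^{(r)}(0)$ is the coefficient of $x^0\frac{y^r}{r!}$ in $:X(\psi,e^yx)X(\psi^*,x):+\frac{e^{y/2}}{e^y-1}$;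 $q_i=e^{2\pi i\tau_i}$ with $\tau_1$ in the upper half-plane, $\tau_i$ ($i\ge2$) formal; $V(\tau_1,\tau_2,\dots)=\mathrm{tr}|_{\mathcal{F}_0}\prod_{i\ge1}q_i^{\bar L^{(i)}(0)}$; $\sigma(y)=\frac1y+\frac1{2\pi i}\sum_{r\ge1}\frac{y^r}{r!}\frac{\partial}{\partial\tau_r}$. $\bar L(0)=L(0)-\frac1{24}$, $\eta(q)=q^{1/24}\prod_{n\ge1}(1-q^n)$. $G$ involves half-integral powers of the $t_i$, hence is multivalued; the subscript $t_i^{n/2}=e^{ny_i/2}$ means that $t_i=e^{y_i}$ with every half-integral power $t_i^{n/2}$ ($n\in\mathbb{Z}$) evaluated by the branch $e^{ny_i/2}$. *)

theory Defs
  imports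
    "HOL-Analysis.Analysis"
    "HOL-Computational_Algebra.Formal_Laurent_Series"
    "HOL-Library.Groups_Big_Fun"
    "HOL-Library.Multiset"
begin

section \<open>The Fock space of charged free fermions\<close>

text \<open>
  Modes with index in \<open>\<int> + 1/2\<close> are indexed by integers: \<open>k\<close> stands for \<open>k + 1/2\<close>, so the
  negative of the index of \<open>k\<close> belongs to \<open>- k - 1\<close>.

  The creation modes are \<open>\<psi>(k + 1/2)\<close> for \<open>k < 0\<close>, labelled by \<open>k\<close> itself, and
  \<open>\<psi>\<^sup>*(k + 1/2)\<close> for \<open>k < 0\<close>, labelled by \<open>- k - 1 \<ge> 0\<close>. Hence \<open>\<psi>(k + 1/2)\<close> and
  \<open>\<psi>\<^sup>*(- k - 1/2)\<close>, which are dual to each other, are the creation and annihilation operator of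
  the same label \<open>k\<close>. The Fock space is the exterior algebra on the labels: the finite set
  \<open>s\<close> of labels is the monomial in the creation modes of \<open>s\<close>, in increasing order, applied to
  the vacuum (lemma \<open>bvec_eq_monomial\<close>), and a vector is its coordinate function with respect
  to these monomials.
\<close>

type_synonym fvec = "int set \<Rightarrow> complex"

definition fock :: "fvec set" where
  "fock = {v. finite {s. v s \<noteq> 0} \<and> (\<forall>s. v s \<noteq> 0 \<longrightarrow> finite s)}"

definition bvec :: "int set \<Rightarrow> fvec" where
  "bvec s = (\<lambda>u. if u = s then 1 else 0)"

definition koszul :: "int \<Rightarrow> int set \<Rightarrow> complex" where
  "koszul c s = (- 1) ^ card {d \<in> s. d < c}"

definition create :: "int \<Rightarrow> fvec \<Rightarrow> fvec" where
  "create c v = (\<lambda>s. if c \<in> s then koszul c s * v (s - {c}) else 0)"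

definition annih :: "int \<Rightarrow> fvec \<Rightarrow> fvec" where
  "annih c v = (\<lambda>s. if c \<in> s then 0 else koszul c s * v (insert c s))"

definition psi :: "int \<Rightarrow> fvec \<Rightarrow> fvec" where
  "psi k = (if k < 0 then create k else annih k)"

definition psis :: "int \<Rightarrow> fvec \<Rightarrow> fvec" where
  "psis k = (if k < 0 then create (- k - 1) else annih (- k - 1))"

definition charge :: "int set \<Rightarrow> int" where
  "charge s = int (card {c \<in> s. c < 0}) - int (card {c \<in> s. 0 \<le> c})"

definition tr0 :: "(fvec \<Rightarrow> fvec) \<Rightarrow> complex" where
  "tr0 A = (\<Sum>\<^sub>\<infinity>s\<in>{s. finite s \<and> charge s = 0}. A (bvec s) s)"

text \<open>The relations of the charged free fermions and the generation from the vacuum.\<close>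

lemma koszul_insert:
  assumes "finite s" "c \<notin> s"
  shows "koszul d (insert c s) = (if c < d then - koszul d s else koszul d s)"
proof (cases "c < d")
  case True
  then have "{e \<in> insert c s. e < d} = insert c {e \<in> s. e < d}" by auto
  then show ?thesis using assms True by (simp add: koszul_def)
next
  case False
  then have "{e \<in> insert c s. e < d} = {e \<in> s. e < d}" by auto
  then show ?thesis using False by (simp add: koszul_def)
qed

lemma koszul_remove:
  assumes "finite s" "c \<in> s"
  shows "koszul d (s - {c}) = (if c < d then - koszul d s else koszul d s)"
  using koszul_insert[of "s - {c}" c d] assms by (auto simp: insert_absorb)

lemma koszul_square: "koszul c s * koszul c s = 1"
  by (simp add: koszul_def flip: power_add mult_2)

lemma create_create:
  assumes "finite s"
  shows "create c (create d v) s + create d (create c v) s = 0"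
proof (cases "c = d")
  case True
  then show ?thesis by (simp add: create_def)
next
  case False
  then show ?thesis using assms
    by (auto simp: create_def koszul_remove insert_commute Diff_insert2[symmetric])
qed

lemma annih_annih:
  assumes "finite s"
  shows "annih c (annih d v) s + annih d (annih c v) s = 0"
proof (cases "c = d")
  case True
  then show ?thesis by (simp add: annih_def)
next
  case False
  then show ?thesis using assms
    by (auto simp: annih_def koszul_insert insert_commute)
qed

lemma annih_create:
  assumes "finite s"
  shows "annih c (create d v) s + create d (annih c v) s = (if c = d then v s else 0)"
proof (cases "c = d")
  case True
  then show ?thesis using assms koszul_square[of d s]
    by (auto simp: create_def annih_def koszul_insert koszul_remove insert_absorb
        simp flip: mult.assoc)
next
  case False
  then show ?thesis using assms
    by (auto simp: create_def annih_def koszul_insert koszul_remove insert_Diff_if)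
qed

lemma psi_psis_anticommutator:
  "finite s \<Longrightarrow> psi k (psis l v) s + psis l (psi k v) s = (if k + l = - 1 then v s else 0)"
  using annih_create[of s k "- l - 1" v] annih_create[of s "- l - 1" k v]
    create_create[of s k "- l - 1" v] annih_annih[of s k "- l - 1" v]
  by (auto simp: psi_def psis_def add.commute)

lemma psi_psi_anticommutator:
  "finite s \<Longrightarrow> psi k (psi l v) s + psi l (psi k v) s = 0"
  using annih_create[of s k l v] annih_create[of s l k v]
    create_create[of s k l v] annih_annih[of s k l v]
  by (auto simp: psi_def add.commute)

lemma psis_psis_anticommutator:
  "finite s \<Longrightarrow> psis k (psis l v) s + psis l (psis k v) s = 0"
  using annih_create[of s "- k - 1" "- l - 1" v] annih_create[of s "- l - 1" "- k - 1" v]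
    create_create[of s "- k - 1" "- l - 1" v] annih_annih[of s "- k - 1" "- l - 1" v]
  by (auto simp: psis_def add.commute)

lemma annih_vacuum: "annih c (bvec {}) = (\<lambda>s. 0)"
  by (auto simp: annih_def bvec_def)

lemma psi_vacuum: "0 \<le> k \<Longrightarrow> psi k (bvec {}) = (\<lambda>s. 0)"
  and psis_vacuum: "0 \<le> k \<Longrightarrow> psis k (bvec {}) = (\<lambda>s. 0)"
  by (simp_all add: psi_def psis_def annih_vacuum)

lemma create_bvec:
  assumes "\<And>d. d \<in> s \<Longrightarrow> c < d"
  shows "create c (bvec s) = bvec (insert c s)"
proof -
  have "c \<notin> s" using assms by blast
  moreover have "{d \<in> insert c s. d < c} = {}" using assms by fastforce
  then have "koszul c (insert c s) = 1" by (simp only: koszul_def) simp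
  ultimately show ?thesis
    by (auto simp: create_def bvec_def fun_eq_iff insert_absorb)
qed

lemma bvec_eq_monomial:
  assumes "finite s"
  shows "bvec s = foldr (\<lambda>c. if c < 0 then psi c else psis (- c - 1)) (sorted_list_of_set s) (bvec {})"
proof -
  have *: "foldr (\<lambda>c. if c < 0 then psi c else psis (- c - 1)) xs (bvec {}) = bvec (set xs)"
    if "sorted_wrt (<) xs" for xs :: "int list"
    using that by (induction xs) (auto simp: psi_def psis_def create_bvec)
  show ?thesis using *[of "sorted_list_of_set s"] assms by simp
qed

section \<open>Normal ordering and the zero modes\<close>

text \<open>
  All sums over modes below are locally finite, so they are taken coordinatewise by \<open>Sum_any\<close>.
\<close>

definition nord :: "(int \<Rightarrow> fvec \<Rightarrow> fvec) \<Rightarrow> (int \<Rightarrow> fvec \<Rightarrow> fvec) \<Rightarrow> int \<Rightarrow> int \<Rightarrow> fvec \<Rightarrow> fvec" where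
  "nord a b k l v = (if k < 0 then a k (b l v) else (\<lambda>s. - b l (a k v) s))"

text \<open>
  \<open>L(0)\<close> is the coefficient of \<open>x\<^sup>-\<^sup>2\<close> in
  \<open>Y(\<omega>, x) = 1/2 (:(d/dx \<psi>\<^sup>*(x)) \<psi>(x): + :(d/dx \<psi>(x)) \<psi>\<^sup>*(x):)\<close>, where
  \<open>\<psi>(x) = \<Sum>\<^sub>n \<psi>(n) x\<^sup>-\<^sup>n\<^sup>-\<^sup>1\<^sup>/\<^sup>2\<close> and likewise for \<open>\<psi>\<^sup>*\<close>; the two summands contribute
  \<open>(n - 1/2) :\<psi>\<^sup>*(-n) \<psi>(n):\<close> and \<open>(- n - 1/2) :\<psi>(n) \<psi>\<^sup>*(-n):\<close> with \<open>n = k + 1/2\<close>.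
\<close>

definition L0 :: "fvec \<Rightarrow> fvec" where
  "L0 v = (\<lambda>s. Sum_any (\<lambda>k. 1/2 * (of_int k * nord psis psi (- k - 1) k v s
                                  + of_int (- k - 1) * nord psi psis k (- k - 1) v s)))"

definition L0_bar :: "fvec \<Rightarrow> fvec" where
  "L0_bar v = (\<lambda>s. L0 v s - v s / 24)"

text \<open>
  The coefficient of \<open>x\<^sup>0\<close> in \<open>:X(\<psi>, e\<^sup>yx) X(\<psi>\<^sup>*, x):\<close> is the sum of
  \<open>e\<^sup>-\<^sup>n\<^sup>y :\<psi>(n) \<psi>\<^sup>*(-n):\<close> over \<open>n = k + 1/2\<close>, and the coefficient of \<open>y\<^sup>r/r!\<close> in \<open>e\<^sup>-\<^sup>n\<^sup>y\<close> is
  \<open>(-n)\<^sup>r\<close>. The scalar \<open>e\<^sup>y\<^sup>/\<^sup>2/(e\<^sup>y - 1)\<close> is expanded as a formal Laurent series.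
\<close>

definition L_bar :: "nat \<Rightarrow> fvec \<Rightarrow> fvec" where
  "L_bar r v = (\<lambda>s. Sum_any (\<lambda>k. (- (of_int k + 1/2)) ^ r * nord psi psis k (- k - 1) v s)
     + fact r * fls_nth (fps_to_fls (fps_exp (1/2)) / (fps_to_fls (fps_exp 1) - 1)) (int r) * v s)"

definition op_exp :: "(fvec \<Rightarrow> fvec) \<Rightarrow> fvec \<Rightarrow> fvec" where
  "op_exp A v = (\<lambda>s. suminf (\<lambda>j. (A ^^ j) v s / fact j))"

text \<open>The operator \<open>q\<^sup>A\<close> for \<open>q = e\<^sup>2\<^sup>\<pi>\<^sup>i\<^sup>\<tau>\<close>.\<close>

definition qpow :: "complex \<Rightarrow> (fvec \<Rightarrow> fvec) \<Rightarrow> fvec \<Rightarrow> fvec" where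
  "qpow \<tau> A = op_exp (\<lambda>v s. 2 * of_real pi * \<i> * \<tau> * A v s)"

definition dedekind_eta :: "complex \<Rightarrow> complex" where
  "dedekind_eta \<tau> = exp (2 * of_real pi * \<i> * \<tau> / 24)
     * prodinf (\<lambda>n. 1 - exp (2 * of_real pi * \<i> * \<tau>) ^ (n + 1))"

section \<open>The Bloch-Okounkov $n$-point function as a formal Laurent series\<close>

text \<open>
  A formal power series in \<open>\<tau>\<^sub>2, \<tau>\<^sub>3, \<dots>\<close> whose coefficients are functions of \<open>\<tau>\<^sub>1\<close>; a multiset
  \<open>\<kappa>\<close> with all elements \<open>\<ge> 2\<close> stands for the monomial with factors \<open>\<tau>\<^sub>i\<close>, \<open>i \<in># \<kappa>\<close>.
\<close>

type_synonym tau_series = "nat multiset \<Rightarrow> complex \<Rightarrow> complex"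

definition V_series :: tau_series where
  "V_series \<kappa> \<tau> = (2 * of_real pi * \<i>) ^ size \<kappa> / (\<Prod>i\<in>set_mset \<kappa>. fact (count \<kappa> i))
     * tr0 (qpow \<tau> (L_bar 1) \<circ> foldr (\<lambda>i B. L_bar i \<circ> B) (sorted_list_of_multiset \<kappa>) id)"

definition d_tau :: "nat \<Rightarrow> tau_series \<Rightarrow> tau_series" where
  "d_tau r f = (\<lambda>\<kappa>. if r = 1 then deriv (f \<kappa>)
                    else (\<lambda>\<tau>. of_nat (count \<kappa> r + 1) * f (add_mset r \<kappa>) \<tau>))"

text \<open>The coefficient of \<open>y\<^sup>r\<close> in the operator \<open>\<sigma>(y)\<close>.\<close>

definition sigma_coeff :: "int \<Rightarrow> tau_series \<Rightarrow> tau_series" where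
  "sigma_coeff r f = (\<lambda>\<kappa> \<tau>.
     if r = - 1 then f \<kappa> \<tau>
     else if 1 \<le> r then d_tau (nat r) f \<kappa> \<tau> / (2 * of_real pi * \<i> * fact (nat r))
     else 0)"

text \<open>
  The variables \<open>y\<^sub>1, \<dots>, y\<^sub>n\<close> are the coordinates of a vector indexed by a finite linearly ordered
  type; products of operators are taken in increasing order of the index. The following is the
  coefficient of \<open>\<Prod>\<^sub>i y\<^sub>i ^ r\<^sub>i\<close> in \<open>\<F>(y\<^sub>1, \<dots>, y\<^sub>n)\<close>; evaluation at the empty multiset is the
  specialization \<open>\<tau>\<^sub>2 = \<tau>\<^sub>3 = \<dots> = 0\<close>.
\<close>

definition npoint_coeff :: "complex \<Rightarrow> int ^ 'n::{finite,linorder} \<Rightarrow> complex" where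
  "npoint_coeff \<tau> r = dedekind_eta \<tau>
     * foldr (\<lambda>i. sigma_coeff (r $ i)) (sorted_list_of_set UNIV) V_series {#} \<tau>"

definition npoint_term :: "complex \<Rightarrow> complex ^ 'n::{finite,linorder} \<Rightarrow> int ^ 'n::{finite,linorder} \<Rightarrow> complex" where
  "npoint_term \<tau> y r = npoint_coeff \<tau> r * (\<Prod>i\<in>UNIV. (y $ i) powi (r $ i))"

definition npoint_converges :: "complex \<Rightarrow> complex ^ 'n::{finite,linorder} \<Rightarrow> bool" where
  "npoint_converges \<tau> y \<longleftrightarrow> (\<forall>i. y $ i \<noteq> 0) \<and> npoint_term \<tau> y summable_on UNIV"

definition npoint_sum :: "complex \<Rightarrow> complex ^ 'n::{finite,linorder} \<Rightarrow> complex" where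
  "npoint_sum \<tau> y = (\<Sum>\<^sub>\<infinity>r\<in>UNIV. npoint_term \<tau> y r)"

definition complex_differentiable_on :: "(complex ^ 'n \<Rightarrow> complex) \<Rightarrow> (complex ^ 'n) set \<Rightarrow> bool" where
  "complex_differentiable_on f D \<longleftrightarrow>
     (\<forall>y\<in>D. \<exists>f'. (f has_derivative f') (at y) \<and> (\<forall>c v. f' (c *s v) = c * f' v))"

text \<open>
  \<open>f\<close> is the complex function given by the formal Laurent series \<open>\<F>(y\<^sub>1, \<dots>, y\<^sub>n)\<close> on the domain
  \<open>D\<close>: its sum where the series converges, and its analytic continuation elsewhere. (The series,
  being an expansion at the origin, only converges for small \<open>y\<close>.)
\<close>

definition is_npoint_function_on ::
  "complex \<Rightarrow> (complex ^ 'n::{finite,linorder}) set \<Rightarrow> (complex ^ 'n::{finite,linorder} \<Rightarrow> complex) \<Rightarrow> bool" where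
  "is_npoint_function_on \<tau> D f \<longleftrightarrow>
     open D \<and> connected D \<and> complex_differentiable_on f D \<and>
     (\<exists>U. open U \<and> U \<noteq> {} \<and> U \<subseteq> D \<and> (\<forall>y\<in>U. npoint_converges \<tau> y)) \<and>
     (\<forall>y\<in>D. npoint_converges \<tau> y \<longrightarrow> f y = npoint_sum \<tau> y)"

section \<open>The function $G$\<close>

text \<open>
  The coefficient of \<open>t\<^sup>-\<^sup>n\<close>, \<open>n = k + 1/2\<close>, in \<open>o(X(\<psi>, tx) X(\<psi>\<^sup>*, x))\<close>.
\<close>

definition o_coeff :: "int \<Rightarrow> fvec \<Rightarrow> fvec" where
  "o_coeff k = psi k \<circ> psis (- k - 1)"

definition G_coeff :: "complex \<Rightarrow> int ^ 'n::{finite,linorder} \<Rightarrow> complex" where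
  "G_coeff \<tau> k = tr0 (foldr (\<lambda>i B. o_coeff (k $ i) \<circ> B) (sorted_list_of_set UNIV) (qpow \<tau> L0_bar))"

text \<open>
  The power \<open>t\<^sub>i\<^sup>-\<^sup>n = t\<^sub>i\<^sup>-\<^sup>(\<^sup>2\<^sup>k\<^sup>+\<^sup>1\<^sup>)\<^sup>/\<^sup>2\<close> is evaluated by the branch \<open>e\<^sup>-\<^sup>(\<^sup>2\<^sup>k\<^sup>+\<^sup>1\<^sup>)\<^sup>y\<^sup>/\<^sup>2\<close>, \<open>y = y\<^sub>i\<close>. Convergence
  of the multiple series is unconditional, i.e. absolute, hence does not depend on the branch.
\<close>

definition G_term :: "complex \<Rightarrow> complex ^ 'n::{finite,linorder} \<Rightarrow> int ^ 'n::{finite,linorder} \<Rightarrow> complex" where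
  "G_term \<tau> y k = G_coeff \<tau> k * (\<Prod>i\<in>UNIV. exp (of_int (- (2 * (k $ i) + 1)) * (y $ i) / 2))"

definition G_converges :: "complex \<Rightarrow> complex ^ 'n::{finite,linorder} \<Rightarrow> bool" where
  "G_converges \<tau> y \<longleftrightarrow> G_term \<tau> y summable_on UNIV"

definition G_exp :: "complex \<Rightarrow> complex ^ 'n::{finite,linorder} \<Rightarrow> complex" where
  "G_exp \<tau> y = dedekind_eta \<tau> * (\<Sum>\<^sub>\<infinity>k\<in>UNIV. G_term \<tau> y k)"

end

theory Submission
  imports Defs "HOL-Complex_Analysis.Complex_Analysis" "HOL-Real_Asymp.Real_Asymp"
begin

text \<open>
  All operators in sight are diagonal on the monomials \<open>bvec s\<close>, so both sides are sums over
  finite sets \<open>s\<close> of charge \<open>0\<close>, the neutral states, weighted with \<open>q\<close> to the power energy minus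
  \<open>1/24\<close>. The zero mode \<open>\<psi>(n) \<psi>\<^sup>*(-n)\<close> with \<open>n = k + 1/2\<close> tests whether \<open>k\<close> is occupied: \<open>k \<in> s\<close> for a
  creation mode \<open>\<psi>(n)\<close>, and \<open>k \<notin> s\<close> for an annihilation mode. A factor of \<open>G\<close> therefore contributes
  \<open>\<Sum> e\<^sup>-\<^sup>n\<^sup>y\<close> over the occupied \<open>k\<close>. All but finitely many \<open>k \<ge> 0\<close> are occupied, so for \<open>Re y > 0\<close> this
  is a geometric series, with sum \<open>e\<^sup>y\<^sup>/\<^sup>2/(e\<^sup>y - 1)\<close>, plus a finite sum. Call the total the character
  of \<open>s\<close> (\<open>state_char\<close>, lemma \<open>has_sum_occupied\<close>).

  On the other side, \<open>\<sigma>(y)\<close> inserts \<open>1/y + \<Sum>\<^sub>r y\<^sup>r/r! L\<^sup>(\<^sup>r\<^sup>)(0)\<close>, \<open>r \<ge> 1\<close>, under the trace. Normal ordering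
  replaces the divergent sum over occupied modes by the same finite sum, and the scalar
  \<open>e\<^sup>y\<^sup>/\<^sup>2/(e\<^sup>y - 1)\<close> restores the geometric series. The eigenvalue is thus the Laurent expansion of the
  same character at \<open>y = 0\<close>: its pole is \<open>1/y\<close> and its constant term is the charge, which
  vanishes (lemma \<open>char_coeff_has_sum\<close>). Energies suppress a state exponentially, and its
  characters grow, up to a factor linear in the energy, at most like \<open>e\<close> to the power \<open>|y|\<close> times
  the energy. So for small \<open>y\<close> with positive real parts all sums may be interchanged and both
  series have the same sum (lemma \<open>npoint_sum_eq_near_0\<close>).

  It remains to continue analytically. The series \<open>G\<close> converges exactly where all \<open>Re y\<^sub>i\<close> are
  positive and their sum is less than \<open>2\<pi> Im \<tau>\<close> (lemma \<open>G_converges_iff\<close>). That these conditions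
  are necessary rests on lower bounds for two families of coefficients, which are asymptotic to
  explicit multiples of the sum of \<open>q\<close> to the power energy over the states of charge \<open>0\<close> and \<open>-1\<close>,
  respectively. These sums do not vanish (lemma \<open>sector_sum_nonzero\<close>): shifting all modes by one
  relates the sums of consecutive charges, and the sum over all charges is the product
  \<open>\<Prod> (1 + q\<^sup>n\<^sup>+\<^sup>1\<^sup>/\<^sup>2)\<^sup>2\<close>, \<open>n \<ge> 0\<close>. The domain is open, convex, and contains \<open>t y\<close> together with \<open>y\<close> for \<open>0 < t \<le> 1\<close>. So functions on it can be compared on
  the complex lines \<open>z \<mapsto> z y\<close>, on which they agree near \<open>z = 0\<close>; the identity theorem in one
  variable carries the equality to \<open>z = 1\<close>. If the Laurent series converges at \<open>y\<close>, it is, up to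
  a power of \<open>z\<close>, an absolutely convergent power series in \<open>z\<close> on the closed unit disc, so by
  continuity its value at \<open>y\<close> is the value of \<open>G\<close>.
\<close>

no_notation fps_nth (infixl "$" 75)


section \<open>Multiple series and exponential series\<close>

lemma has_sum_diff:
  fixes f g :: "'a \<Rightarrow> 'b::real_normed_vector"
  assumes "(f has_sum a) A" "(g has_sum b) A"
  shows "((\<lambda>x. f x - g x) has_sum (a - b)) A"
proof -
  have "((\<lambda>x. - g x) has_sum (- b)) A"
    by (rule iffD2[OF has_sum_uminus]) (use assms(2) in simp)
  from has_sum_add[OF assms(1) this] show ?thesis by simp
qed

lemma has_sum_prod_vec:
  fixes f :: "'n::finite \<Rightarrow> 'b \<Rightarrow> 'c::{banach, real_normed_field}"
  assumes f: "\<And>i. (\<lambda>k. norm (f i k)) summable_on UNIV"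
  shows "(\<lambda>k::'b^'n. norm (\<Prod>i\<in>UNIV. f i (k $ i))) summable_on UNIV"
    and "((\<lambda>k::'b^'n. \<Prod>i\<in>UNIV. f i (k $ i)) has_sum (\<Prod>i\<in>UNIV. \<Sum>\<^sub>\<infinity>k. f i k)) UNIV"
proof -
  have bij: "bij_betw (\<lambda>g::'n \<Rightarrow> 'b. \<chi> i. g i) UNIV UNIV"
    by (rule bij_betwI[where g = "\<lambda>v i. v $ i"]) auto
  have "(\<lambda>g::'n \<Rightarrow> 'b. norm (\<Prod>i\<in>UNIV. f i (g i))) summable_on UNIV"
  proof (rule nonneg_bdd_above_summable_on)
    show "bdd_above (sum (\<lambda>g. norm (\<Prod>i\<in>UNIV. f i (g i))) ` {F. F \<subseteq> UNIV \<and> finite F})"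
    proof (rule bdd_aboveI2)
      fix F :: "('n \<Rightarrow> 'b) set" assume "F \<in> {F. F \<subseteq> UNIV \<and> finite F}"
      then have F: "finite F" by simp
      define B where "B i = (\<lambda>g. g i) ` F" for i :: 'n
      have B: "finite (B i)" for i using F by (simp add: B_def)
      have "F \<subseteq> PiE UNIV B" by (auto simp: B_def)
      then have "(\<Sum>g\<in>F. norm (\<Prod>i\<in>UNIV. f i (g i))) \<le> (\<Sum>g\<in>PiE UNIV B. norm (\<Prod>i\<in>UNIV. f i (g i)))"
        using B by (intro sum_mono2 finite_PiE) auto
      also have "\<dots> = (\<Prod>i\<in>UNIV. \<Sum>k\<in>B i. norm (f i k))"
        using B by (simp add: prod_norm[symmetric] prod_sum_PiE)
      also have "\<dots> \<le> (\<Prod>i\<in>UNIV. \<Sum>\<^sub>\<infinity>k. norm (f i k))"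
        using f B by (intro prod_mono conjI sum_nonneg finite_sum_le_infsum) auto
      finally show "(\<Sum>g\<in>F. norm (\<Prod>i\<in>UNIV. f i (g i))) \<le> (\<Prod>i\<in>UNIV. \<Sum>\<^sub>\<infinity>k. norm (f i k))" .
    qed
  qed auto
  then show *: "(\<lambda>k::'b^'n. norm (\<Prod>i\<in>UNIV. f i (k $ i))) summable_on UNIV"
    using summable_on_reindex_bij_betw[OF bij, of "\<lambda>k. norm (\<Prod>i\<in>UNIV. f i (k $ i))"] by simp
  have "(\<Sum>\<^sub>\<infinity>k::'b^'n. \<Prod>i\<in>UNIV. f i (k $ i)) = (\<Sum>\<^sub>\<infinity>g\<in>PiE UNIV (\<lambda>_. UNIV). \<Prod>i\<in>UNIV. f i (g i))"
    using infsum_reindex_bij_betw[OF bij, of "\<lambda>k. \<Prod>i\<in>UNIV. f i (k $ i)"] by simp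
  also have "\<dots> = (\<Prod>i\<in>UNIV. \<Sum>\<^sub>\<infinity>k. f i k)"
    by (rule infsum_prod_PiE_abs) (simp_all add: f)
  finally show "((\<lambda>k::'b^'n. \<Prod>i\<in>UNIV. f i (k $ i)) has_sum (\<Prod>i\<in>UNIV. \<Sum>\<^sub>\<infinity>k. f i k)) UNIV"
    using has_sum_infsum[OF abs_summable_summable[OF *]] by (simp only:)
qed

text \<open>
  The form of the interchange needed on both sides: the modes of the \<open>n\<close> factors are independent
  once the state \<open>s\<close> is fixed, so the bound on the double series factorizes.
\<close>

lemma fubini_prod_vec:
  fixes w :: "'a \<Rightarrow> complex" and f :: "'a \<Rightarrow> 'n::finite \<Rightarrow> 'b \<Rightarrow> complex"
  assumes f: "\<And>s i. s \<in> S \<Longrightarrow> (\<lambda>k. norm (f s i k)) summable_on UNIV"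
    and w: "(\<lambda>s. norm (w s) * (\<Prod>i\<in>UNIV. \<Sum>\<^sub>\<infinity>k. norm (f s i k))) summable_on S"
  shows "(\<lambda>k::'b^'n. \<Sum>\<^sub>\<infinity>s\<in>S. w s * (\<Prod>i\<in>UNIV. f s i (k $ i))) summable_on UNIV"
    and "(\<Sum>\<^sub>\<infinity>k::'b^'n. \<Sum>\<^sub>\<infinity>s\<in>S. w s * (\<Prod>i\<in>UNIV. f s i (k $ i)))
         = (\<Sum>\<^sub>\<infinity>s\<in>S. w s * (\<Prod>i\<in>UNIV. \<Sum>\<^sub>\<infinity>k. f s i k))"
proof -
  define h :: "'a \<times> ('b^'n) \<Rightarrow> complex" where "h = (\<lambda>(s, k). w s * (\<Prod>i\<in>UNIV. f s i (k $ i)))"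
  have "(\<lambda>p. norm (h p)) summable_on S \<times> UNIV"
  proof (rule summable_on_SigmaI[OF _ w])
    fix s assume "s \<in> S"
    have "((\<lambda>k::'b^'n. \<Prod>i\<in>UNIV. norm (f s i (k $ i))) has_sum (\<Prod>i\<in>UNIV. \<Sum>\<^sub>\<infinity>k. norm (f s i k))) UNIV"
      by (rule has_sum_prod_vec(2)) (use f[OF \<open>s \<in> S\<close>] in simp)
    from has_sum_cmult_right[OF this, of "norm (w s)"]
    show "((\<lambda>k::'b^'n. norm (h (s, k))) has_sum norm (w s) * (\<Prod>i\<in>UNIV. \<Sum>\<^sub>\<infinity>k. norm (f s i k))) UNIV"
      by (simp add: h_def norm_mult prod_norm)
  qed auto
  then have h: "h summable_on S \<times> UNIV" by (rule abs_summable_summable)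
  then have h': "(\<lambda>(k, s). h (s, k)) summable_on UNIV \<times> S"
    by (rule iffD1[OF summable_on_swap])
  show "(\<lambda>k::'b^'n. \<Sum>\<^sub>\<infinity>s\<in>S. w s * (\<Prod>i\<in>UNIV. f s i (k $ i))) summable_on UNIV"
    using summable_on_Sigma_banach[OF h'] by (simp add: h_def)
  have "(\<Sum>\<^sub>\<infinity>k::'b^'n. \<Sum>\<^sub>\<infinity>s\<in>S. h (s, k)) = (\<Sum>\<^sub>\<infinity>s\<in>S. \<Sum>\<^sub>\<infinity>k. h (s, k))"
    by (rule infsum_swap_banach) (use h' in simp)
  also have "\<dots> = (\<Sum>\<^sub>\<infinity>s\<in>S. w s * (\<Prod>i\<in>UNIV. \<Sum>\<^sub>\<infinity>k. f s i k))"
  proof (rule infsum_cong)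
    fix s assume "s \<in> S"
    from has_sum_cmult_right[OF has_sum_prod_vec(2)[of "f s", OF f[OF this]], of "w s"]
    show "(\<Sum>\<^sub>\<infinity>k. h (s, k)) = w s * (\<Prod>i\<in>UNIV. \<Sum>\<^sub>\<infinity>k. f s i k)"
      by (simp add: h_def infsumI)
  qed
  finally show "(\<Sum>\<^sub>\<infinity>k::'b^'n. \<Sum>\<^sub>\<infinity>s\<in>S. w s * (\<Prod>i\<in>UNIV. f s i (k $ i)))
         = (\<Sum>\<^sub>\<infinity>s\<in>S. w s * (\<Prod>i\<in>UNIV. \<Sum>\<^sub>\<infinity>k. f s i k))"
    by (simp add: h_def)
qed

lemma norm_exp_minus_linear_le:
  fixes w :: complex
  shows "norm (exp w - 1 - w) \<le> (norm w)\<^sup>2 * exp (norm w)"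
proof -
  have "norm (exp w - 1 - w) \<le> exp \<bar>Re w\<bar> * (norm w)\<^sup>2"
    using Taylor_exp[of w 1] by (simp add: power2_eq_square algebra_simps)
  also have "\<dots> \<le> exp (norm w) * (norm w)\<^sup>2"
    by (intro mult_right_mono) (auto simp: abs_Re_le_cmod)
  finally show ?thesis by (simp add: mult.commute)
qed

lemma le_exp_divide:
  fixes x \<epsilon> :: real
  assumes "0 < \<epsilon>"
  shows "x \<le> exp (x * \<epsilon>) / \<epsilon>"
proof -
  have "x * \<epsilon> \<le> exp (x * \<epsilon>)"
    using exp_ge_add_one_self[of "x * \<epsilon>"] by linarith
  then show ?thesis using assms by (simp add: pos_le_divide_eq)
qed

text \<open>
  An exponential series may be differentiated termwise as soon as it converges absolutely with
  an exponential margin \<open>\<epsilon>\<close>: the margin absorbs the quadratic remainder of each exponential. This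
  gives both \<open>d/d\<tau>\<close> of the trace and the holomorphy of \<open>G\<close> in several variables.
\<close>

lemma has_derivative_exp_series:
  fixes l :: "'k \<Rightarrow> 'v::real_normed_vector \<Rightarrow> complex"
  assumes lin: "\<And>k. k \<in> K \<Longrightarrow> bounded_linear (l k)"
    and bd: "\<And>k v. k \<in> K \<Longrightarrow> norm (l k v) \<le> N k * norm v"
    and N: "\<And>k. k \<in> K \<Longrightarrow> 0 \<le> N k" and "0 < \<epsilon>"
    and sum: "(\<lambda>k. norm (a k) * exp (N k * \<epsilon>)) summable_on K"
  shows "((\<lambda>v. \<Sum>\<^sub>\<infinity>k\<in>K. a k * exp (l k v)) has_derivative (\<lambda>v. \<Sum>\<^sub>\<infinity>k\<in>K. a k * l k v)) (at 0)"
proof -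
  define b where "b k = norm (a k) * exp (N k * \<epsilon>)" for k
  define C where "C = (\<Sum>\<^sub>\<infinity>k\<in>K. b k)"
  have b: "b summable_on K" using sum unfolding b_def[abs_def] .
  have sum_le: "(\<lambda>k. f k) summable_on K" "norm (\<Sum>\<^sub>\<infinity>k\<in>K. f k) \<le> c * C"
    if "\<And>k. k \<in> K \<Longrightarrow> norm (f k) \<le> c * b k" for f :: "'k \<Rightarrow> complex" and c
  proof -
    have cb: "(\<lambda>k. c * b k) summable_on K" using b by (rule summable_on_cmult_right)
    show f: "f summable_on K"
      by (rule abs_summable_summable, rule Infinite_Sum.abs_summable_on_comparison_test'[OF cb that])
    have "norm (\<Sum>\<^sub>\<infinity>k\<in>K. f k) \<le> (\<Sum>\<^sub>\<infinity>k\<in>K. c * b k)"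
      by (rule norm_infsum_le[OF has_sum_infsum[OF f] has_sum_infsum[OF cb] that])
    also have "\<dots> = c * C"
      unfolding C_def by (rule infsum_cmult_right) (use b in blast)
    finally show "norm (\<Sum>\<^sub>\<infinity>k\<in>K. f k) \<le> c * C" .
  qed
  have lin_bd: "norm (a k * l k v) \<le> (norm v / \<epsilon>) * b k" if "k \<in> K" for k v
  proof -
    have "norm (a k * l k v) \<le> norm (a k) * (N k * norm v)"
      using bd[OF that, of v] by (simp add: norm_mult mult_left_mono)
    also have "\<dots> \<le> norm (a k) * (exp (N k * \<epsilon>) / \<epsilon> * norm v)"
      using le_exp_divide[OF \<open>0 < \<epsilon>\<close>, of "N k"] by (intro mult_left_mono mult_right_mono) auto
    finally show ?thesis by (simp add: b_def mult_ac)
  qed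
  have exp_bd: "norm (a k * exp (l k v)) \<le> 1 * b k" if "k \<in> K" "norm v < \<epsilon>" for k v
  proof -
    have "Re (l k v) \<le> norm (l k v)" by (rule complex_Re_le_cmod)
    also have "\<dots> \<le> N k * norm v" by (rule bd[OF that(1)])
    also have "\<dots> \<le> N k * \<epsilon>" using that N[of k] by (intro mult_left_mono) auto
    finally show ?thesis by (simp add: norm_mult b_def mult_left_mono)
  qed
  have rem_bd: "norm (a k * (exp (l k v) - 1 - l k v)) \<le> (8 / \<epsilon>\<^sup>2 * (norm v)\<^sup>2) * b k"
    if "k \<in> K" "norm v < \<epsilon> / 2" for k v
  proof -
    have "N k * norm v \<le> N k * (\<epsilon> / 2)"
      using that N[of k] by (intro mult_left_mono) auto
    then have l: "norm (l k v) \<le> N k * (\<epsilon> / 2)"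
      using bd[OF that(1), of v] by linarith
    have "norm (exp (l k v) - 1 - l k v) \<le> (norm (l k v))\<^sup>2 * exp (norm (l k v))"
      by (rule norm_exp_minus_linear_le)
    also have "\<dots> \<le> (N k * norm v)\<^sup>2 * exp (N k * (\<epsilon> / 2))"
      using l bd[OF that(1), of v] by (intro mult_mono power_mono) auto
    also have "\<dots> \<le> (8 / \<epsilon>\<^sup>2 * (norm v)\<^sup>2) * exp (N k * \<epsilon>)"
    proof -
      \<comment> \<open>One half of the margin bounds the square by \<open>x\<^sup>2/2 \<le> e\<^sup>x\<close>, the other the exponential of the remainder.\<close>
      have "0 \<le> N k * (\<epsilon> / 2)" using N[OF that(1)] \<open>0 < \<epsilon>\<close> by simp
      then have "(N k * (\<epsilon> / 2))\<^sup>2 / 2 \<le> exp (N k * (\<epsilon> / 2))"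
        using exp_lower_Taylor_quadratic[of "N k * (\<epsilon> / 2)"] by linarith
      then have "(N k)\<^sup>2 \<le> 8 / \<epsilon>\<^sup>2 * exp (N k * (\<epsilon> / 2))"
        using \<open>0 < \<epsilon>\<close> by (simp add: power_mult_distrib power_divide pos_le_divide_eq mult_ac)
      then have "(N k)\<^sup>2 * ((norm v)\<^sup>2 * exp (N k * (\<epsilon> / 2)))
          \<le> 8 / \<epsilon>\<^sup>2 * exp (N k * (\<epsilon> / 2)) * ((norm v)\<^sup>2 * exp (N k * (\<epsilon> / 2)))"
        by (intro mult_right_mono) auto
      also have "\<dots> = (8 / \<epsilon>\<^sup>2 * (norm v)\<^sup>2) * (exp (N k * (\<epsilon> / 2)) * exp (N k * (\<epsilon> / 2)))"
        by (simp only: mult_ac)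
      also have "exp (N k * (\<epsilon> / 2)) * exp (N k * (\<epsilon> / 2)) = exp (N k * \<epsilon>)"
        by (simp add: mult_exp_exp)
      finally show ?thesis by (simp add: power_mult_distrib mult_ac)
    qed
    finally have "norm (a k) * norm (exp (l k v) - 1 - l k v)
        \<le> norm (a k) * ((8 / \<epsilon>\<^sup>2 * (norm v)\<^sup>2) * exp (N k * \<epsilon>))"
      by (intro mult_left_mono) auto
    then show ?thesis by (simp only: norm_mult b_def mult_ac)
  qed
  have lin0: "l k 0 = 0" if "k \<in> K" for k
    using linear_0[OF bounded_linear.linear[OF lin[OF that]]] .
  show ?thesis
  proof (rule has_derivativeI_sandwich[where e = "\<epsilon> / 2" and H = "\<lambda>v. 8 / \<epsilon>\<^sup>2 * C * norm v"])
    show "bounded_linear (\<lambda>v. \<Sum>\<^sub>\<infinity>k\<in>K. a k * l k v)"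
    proof (rule bounded_linear_intro)
      fix u v
      have "(\<Sum>\<^sub>\<infinity>k\<in>K. a k * l k (u + v)) = (\<Sum>\<^sub>\<infinity>k\<in>K. a k * l k u + a k * l k v)"
        by (rule infsum_cong) (simp add: bounded_linear.linear[OF lin] linear_add distrib_left)
      also have "\<dots> = (\<Sum>\<^sub>\<infinity>k\<in>K. a k * l k u) + (\<Sum>\<^sub>\<infinity>k\<in>K. a k * l k v)"
        by (intro infsum_add sum_le(1)) (rule lin_bd, assumption)+
      finally show "(\<Sum>\<^sub>\<infinity>k\<in>K. a k * l k (u + v)) = (\<Sum>\<^sub>\<infinity>k\<in>K. a k * l k u) + (\<Sum>\<^sub>\<infinity>k\<in>K. a k * l k v)" .
    next
      fix r v
      have "(\<Sum>\<^sub>\<infinity>k\<in>K. a k * l k (r *\<^sub>R v)) = (\<Sum>\<^sub>\<infinity>k\<in>K. r *\<^sub>R (a k * l k v))"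
        by (rule infsum_cong) (simp add: bounded_linear.linear[OF lin] linear_scale)
      then show "(\<Sum>\<^sub>\<infinity>k\<in>K. a k * l k (r *\<^sub>R v)) = r *\<^sub>R (\<Sum>\<^sub>\<infinity>k\<in>K. a k * l k v)"
        by (simp add: infsum_scaleR_right)
    next
      fix v
      show "norm (\<Sum>\<^sub>\<infinity>k\<in>K. a k * l k v) \<le> norm v * (C / \<epsilon>)"
        using sum_le(2)[OF lin_bd, of v] by simp
    qed
  next
    fix v :: 'v
    assume "v \<noteq> 0" "dist v 0 < \<epsilon> / 2"
    then have v: "norm v < \<epsilon> / 2" "0 < norm v" by auto
    have "(\<Sum>\<^sub>\<infinity>k\<in>K. a k * (exp (l k v) - 1 - l k v))
        = (\<Sum>\<^sub>\<infinity>k\<in>K. (a k * exp (l k v) - a k * exp (l k 0)) - a k * l k v)"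
      by (rule infsum_cong) (simp add: lin0 algebra_simps)
    also have "\<dots> = (\<Sum>\<^sub>\<infinity>k\<in>K. a k * exp (l k v)) - (\<Sum>\<^sub>\<infinity>k\<in>K. a k * exp (l k 0)) - (\<Sum>\<^sub>\<infinity>k\<in>K. a k * l k v)"
    proof -
      have 1: "(\<lambda>k. a k * exp (l k v)) summable_on K" "(\<lambda>k. a k * exp (l k 0)) summable_on K"
        "(\<lambda>k. a k * l k v) summable_on K"
        using v \<open>0 < \<epsilon>\<close>
        by (intro sum_le(1)[OF exp_bd[of _ v]] sum_le(1)[OF exp_bd[of _ 0]] sum_le(1)[OF lin_bd[of _ v]];
            simp)+
      show ?thesis
        using 1 by (intro infsumI has_sum_diff has_sum_infsum)
    qed
    finally have eq: "(\<Sum>\<^sub>\<infinity>k\<in>K. a k * exp (l k v)) - (\<Sum>\<^sub>\<infinity>k\<in>K. a k * exp (l k 0)) - (\<Sum>\<^sub>\<infinity>k\<in>K. a k * l k v)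
      = (\<Sum>\<^sub>\<infinity>k\<in>K. a k * (exp (l k v) - 1 - l k v))" by simp
    have "norm (\<Sum>\<^sub>\<infinity>k\<in>K. a k * (exp (l k v) - 1 - l k v)) \<le> (8 / \<epsilon>\<^sup>2 * (norm v)\<^sup>2) * C"
      by (rule sum_le(2)) (rule rem_bd, use v in auto)
    then show "norm ((\<Sum>\<^sub>\<infinity>k\<in>K. a k * exp (l k v)) - (\<Sum>\<^sub>\<infinity>k\<in>K. a k * exp (l k 0)) - (\<Sum>\<^sub>\<infinity>k\<in>K. a k * l k (v - 0)))
          / norm (v - 0) \<le> 8 / \<epsilon>\<^sup>2 * C * norm v"
      using v by (simp add: eq divide_le_eq power2_eq_square mult_ac)
  next
    show "((\<lambda>v::'v. 8 / \<epsilon>\<^sup>2 * C * norm v) \<longlongrightarrow> 0) (at 0)"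
      using \<open>0 < \<epsilon>\<close> by (auto intro!: tendsto_eq_intros)
  qed (use \<open>0 < \<epsilon>\<close> in auto)
qed

section \<open>Simultaneous diagonalization on the Fock space\<close>

text \<open>
  Finiteness of \<open>s\<close> is imposed because the sums over modes in the operators are infinite otherwise.
\<close>

definition acts_by :: "(fvec \<Rightarrow> fvec) \<Rightarrow> (int set \<Rightarrow> complex) \<Rightarrow> bool" where
  "acts_by A \<alpha> \<longleftrightarrow> (\<forall>v s. finite s \<longrightarrow> A v s = \<alpha> s * v s)"

definition neutral :: "int set set" where
  "neutral = {s. finite s \<and> charge s = 0}"

definition occupied :: "int \<Rightarrow> int set \<Rightarrow> bool" where
  "occupied k s \<longleftrightarrow> (k \<in> s \<longleftrightarrow> k < 0)"

definition mode_charge :: "int \<Rightarrow> complex" where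
  "mode_charge c = (if c < 0 then 1 else - 1)"

definition energy :: "int set \<Rightarrow> real" where
  "energy s = (\<Sum>c\<in>s. \<bar>of_int c + 1 / 2\<bar>)"

definition state_weight :: "complex \<Rightarrow> int set \<Rightarrow> complex" where
  "state_weight \<tau> s = exp (2 * of_real pi * \<i> * \<tau> * (of_real (energy s) - 1 / 24))"

abbreviation Lbar_const :: "nat \<Rightarrow> complex" where
  "Lbar_const r \<equiv> fls_nth (fps_to_fls (fps_exp (1/2)) / (fps_to_fls (fps_exp 1) - 1)) (int r)"

definition Lbar_eig :: "nat \<Rightarrow> int set \<Rightarrow> complex" where
  "Lbar_eig r s = (\<Sum>c\<in>s. mode_charge c * (- (of_int c + 1/2)) ^ r) + fact r * Lbar_const r"

lemma acts_by_id: "acts_by id (\<lambda>s. 1)"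
  by (simp add: acts_by_def)

lemma acts_by_comp:
  "acts_by A \<alpha> \<Longrightarrow> acts_by B \<mu> \<Longrightarrow> acts_by (A \<circ> B) (\<lambda>s. \<alpha> s * \<mu> s)"
  by (simp add: acts_by_def)

lemma acts_by_foldr:
  assumes "\<And>i. acts_by (A i) (\<alpha> i)" "acts_by B \<mu>"
  shows "acts_by (foldr (\<lambda>i B. A i \<circ> B) xs B) (\<lambda>s. (\<Prod>i\<leftarrow>xs. \<alpha> i s) * \<mu> s)"
proof (induction xs)
  case Nil
  then show ?case using assms(2) by simp
next
  case (Cons i xs)
  from acts_by_comp[OF assms(1)[of i] this] show ?case by (simp add: comp_def mult.assoc)
qed

lemma tr0_acts_by:
  assumes "acts_by A \<alpha>"
  shows "tr0 A = (\<Sum>\<^sub>\<infinity>s\<in>neutral. \<alpha> s)"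
  using assms unfolding tr0_def neutral_def acts_by_def
  by (intro infsum_cong) (auto simp: bvec_def)

lemma create_annih: "create k (annih k v) s = (if k \<in> s then v s else 0)"
proof -
  have "koszul k (s - {k}) = koszul k s"
    unfolding koszul_def by (rule arg_cong[where f = "\<lambda>A. (- 1) ^ card A"]) auto
  then show ?thesis
    using koszul_square[of k s] by (simp add: create_def annih_def insert_absorb flip: mult.assoc)
qed

lemma annih_create_same: "annih k (create k v) s = (if k \<in> s then 0 else v s)"
proof -
  have "koszul k (insert k s) = koszul k s"
    unfolding koszul_def by (rule arg_cong[where f = "\<lambda>A. (- 1) ^ card A"]) auto
  then show ?thesis
    using koszul_square[of k s] by (simp add: create_def annih_def flip: mult.assoc)
qed

lemma acts_by_o_coeff: "acts_by (o_coeff k) (\<lambda>s. of_bool (occupied k s))"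
  by (auto simp: acts_by_def o_coeff_def psi_def psis_def occupied_def create_annih annih_create_same)

lemma nord_psi_psis: "nord psi psis k (- k - 1) v s = (if k \<in> s then mode_charge k * v s else 0)"
  by (simp add: nord_def psi_def psis_def create_annih mode_charge_def)

lemma nord_psis_psi: "nord psis psi (- k - 1) k v s = (if k \<in> s then - mode_charge k * v s else 0)"
  by (simp add: nord_def psi_def psis_def create_annih mode_charge_def)

lemma acts_by_Lbar: "acts_by (L_bar r) (Lbar_eig r)"
  unfolding acts_by_def
proof (intro allI impI)
  fix v :: fvec and s :: "int set"
  assume "finite s"
  then have "Sum_any (\<lambda>k. (- (of_int k + 1/2)) ^ r * nord psi psis k (- k - 1) v s)
     = (\<Sum>k\<in>s. (- (of_int k + 1/2)) ^ r * nord psi psis k (- k - 1) v s)"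
    by (rule Sum_any.expand_superset) (auto simp: nord_psi_psis split: if_splits)
  also have "\<dots> = (\<Sum>k\<in>s. mode_charge k * (- (of_int k + 1/2)) ^ r) * v s"
    unfolding sum_distrib_right by (rule sum.cong) (auto simp: nord_psi_psis)
  finally show "L_bar r v s = Lbar_eig r s * v s"
    by (simp add: L_bar_def Lbar_eig_def distrib_right)
qed

text \<open>
  The creation mode with label \<open>k\<close> contributes the energy \<open>|k + 1/2|\<close>, whichever of the two fermions
  it belongs to.
\<close>

lemma acts_by_L0_bar: "acts_by L0_bar (\<lambda>s. of_real (energy s) - 1 / 24)"
  unfolding acts_by_def
proof (intro allI impI)
  fix v :: fvec and s :: "int set"
  assume "finite s"
  then have "L0 v s = (\<Sum>k\<in>s. 1/2 * (of_int k * nord psis psi (- k - 1) k v s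
                                  + of_int (- k - 1) * nord psi psis k (- k - 1) v s))"
    unfolding L0_def
    by (rule Sum_any.expand_superset) (auto simp: nord_psi_psis nord_psis_psi split: if_splits)
  also have "\<dots> = (\<Sum>k\<in>s. of_real \<bar>of_int k + 1/2\<bar> * v s)"
    by (rule sum.cong) (auto simp: nord_psi_psis nord_psis_psi mode_charge_def abs_if field_simps)
  finally show "L0_bar v s = (of_real (energy s) - 1 / 24) * v s"
    by (simp add: L0_bar_def energy_def sum_distrib_right left_diff_distrib)
qed

lemma acts_by_qpow:
  assumes "acts_by A \<alpha>"
  shows "acts_by (qpow \<tau> A) (\<lambda>s. exp (2 * of_real pi * \<i> * \<tau> * \<alpha> s))"
  unfolding acts_by_def
proof (intro allI impI)
  fix v :: fvec and s :: "int set"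
  assume "finite s"
  define \<mu> where "\<mu> = 2 * of_real pi * \<i> * \<tau> * \<alpha> s"
  have "((\<lambda>v s. 2 * of_real pi * \<i> * \<tau> * A v s) ^^ j) v s = \<mu> ^ j * v s" for j
    using assms \<open>finite s\<close> by (induction j) (simp_all add: acts_by_def \<mu>_def)
  moreover have "(\<lambda>j. \<mu> ^ j /\<^sub>R fact j * v s) sums (exp \<mu> * v s)"
    by (intro sums_mult2 exp_converges)
  ultimately show "qpow \<tau> A v s = exp (2 * of_real pi * \<i> * \<tau> * \<alpha> s) * v s"
    unfolding qpow_def op_exp_def \<mu>_def[symmetric]
    by (simp add: sums_iff scaleR_conv_of_real field_simps)
qed

lemma sorted_list_prod:
  fixes f :: "'n::{finite,linorder} \<Rightarrow> complex"
  shows "(\<Prod>i\<leftarrow>sorted_list_of_set UNIV. f i) = (\<Prod>i\<in>UNIV. f i)"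
  by (subst prod.distinct_set_conv_list[symmetric]) auto

lemma G_coeff_eq:
  fixes k :: "int ^ 'n::{finite,linorder}"
  shows "G_coeff \<tau> k = (\<Sum>\<^sub>\<infinity>s\<in>neutral. state_weight \<tau> s * (\<Prod>i\<in>UNIV. of_bool (occupied (k $ i) s)))"
proof -
  have "acts_by (foldr (\<lambda>i B. o_coeff (k $ i) \<circ> B) (sorted_list_of_set UNIV) (qpow \<tau> L0_bar))
    (\<lambda>s. (\<Prod>i\<leftarrow>sorted_list_of_set UNIV. of_bool (occupied (k $ i) s))
        * exp (2 * of_real pi * \<i> * \<tau> * (of_real (energy s) - 1 / 24)))"
    by (rule acts_by_foldr[OF acts_by_o_coeff acts_by_qpow[OF acts_by_L0_bar]])
  from tr0_acts_by[OF this] show ?thesis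
    by (simp add: G_coeff_def sorted_list_prod state_weight_def mult.commute)
qed

lemma V_series_eq:
  "V_series \<kappa> \<tau> = (2 * of_real pi * \<i>) ^ size \<kappa> / (\<Prod>i\<in>set_mset \<kappa>. fact (count \<kappa> i))
     * (\<Sum>\<^sub>\<infinity>s\<in>neutral. (\<Prod>i\<in>#\<kappa>. Lbar_eig i s) * exp (2 * of_real pi * \<i> * \<tau> * Lbar_eig 1 s))"
proof -
  have "acts_by (qpow \<tau> (L_bar 1) \<circ> foldr (\<lambda>i B. L_bar i \<circ> B) (sorted_list_of_multiset \<kappa>) id)
    (\<lambda>s. exp (2 * of_real pi * \<i> * \<tau> * Lbar_eig 1 s)
       * ((\<Prod>i\<leftarrow>sorted_list_of_multiset \<kappa>. Lbar_eig i s) * 1))"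
    by (intro acts_by_comp acts_by_qpow acts_by_Lbar acts_by_foldr acts_by_id)
  moreover have "(\<Prod>i\<leftarrow>sorted_list_of_multiset \<kappa>. Lbar_eig i s) = (\<Prod>i\<in>#\<kappa>. Lbar_eig i s)" for s
    by (metis mset_map mset_sorted_list_of_multiset prod_mset_prod_list)
  ultimately show ?thesis
    by (simp add: V_series_def tr0_acts_by mult.commute)
qed

section \<open>Sums over states\<close>

lemma summable_on_exp_abs:
  fixes \<alpha> :: real
  assumes "0 < \<alpha>"
  shows "(\<lambda>k::int. exp (- \<alpha> * \<bar>of_int k + 1 / 2\<bar>)) summable_on UNIV"
proof -
  have "summable (\<lambda>n. exp (- \<alpha>) ^ n)"
    by (rule summable_geometric) (use assms in simp)
  then have "summable (\<lambda>n. exp (- \<alpha> / 2) * exp (- \<alpha>) ^ n)"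
    by (rule summable_mult)
  also have "(\<lambda>n. exp (- \<alpha> / 2) * exp (- \<alpha>) ^ n) = (\<lambda>n::nat. exp (- \<alpha> * (of_nat n + 1 / 2)))"
    by (simp add: fun_eq_iff exp_of_nat_mult[symmetric] mult_exp_exp algebra_simps)
  finally have geo: "(\<lambda>n::nat. exp (- \<alpha> * (of_nat n + 1 / 2))) summable_on UNIV"
    by (rule summable_nonneg_imp_summable_on) auto
  have "(\<lambda>k::int. exp (- \<alpha> * \<bar>of_int k + 1 / 2\<bar>)) summable_on range int"
    using geo by (subst summable_on_reindex) (auto simp: o_def)
  moreover have "(\<lambda>k::int. exp (- \<alpha> * \<bar>of_int k + 1 / 2\<bar>)) summable_on range (\<lambda>n. - int n - 1)"
  proof -
    have "(\<lambda>k::int. exp (- \<alpha> * \<bar>of_int k + 1 / 2\<bar>)) \<circ> (\<lambda>n. - int n - 1)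
        = (\<lambda>n::nat. exp (- \<alpha> * (of_nat n + 1 / 2)))"
      by (simp add: fun_eq_iff algebra_simps)
    then show ?thesis using geo by (subst summable_on_reindex) (auto simp: inj_on_def)
  qed
  moreover have "range int \<union> range (\<lambda>n. - int n - 1) = UNIV"
  proof (intro equalityI subsetI)
    fix k :: int
    show "k \<in> range int \<union> range (\<lambda>n. - int n - 1)"
      by (cases "0 \<le> k") (auto intro: range_eqI[of _ _ "nat k"] range_eqI[of _ _ "nat (- k - 1)"])
  qed auto
  ultimately show ?thesis
    using summable_on_union[of _ "range int" "range (\<lambda>n. - int n - 1)"] by metis
qed

text \<open>
  The sum over all finite sets of the products of weights is at most \<open>\<Prod> (1 + w c)\<close>, hence at
  most \<open>exp (\<Sum> w c)\<close>.
\<close>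

lemma summable_on_prod_finite_sets:
  fixes w :: "'a \<Rightarrow> real"
  assumes "w summable_on UNIV" and nonneg: "\<And>c. 0 \<le> w c"
  shows "(\<lambda>s. \<Prod>c\<in>s. w c) summable_on {s. finite s}"
proof (rule nonneg_bdd_above_summable_on)
  show "bdd_above (sum (\<lambda>s. \<Prod>c\<in>s. w c) ` {F. F \<subseteq> {s. finite s} \<and> finite F})"
  proof (rule bdd_aboveI2)
    fix F :: "'a set set" assume "F \<in> {F. F \<subseteq> {s. finite s} \<and> finite F}"
    then have F: "finite F" "finite (\<Union>F)" by auto
    have "(\<Sum>s\<in>F. \<Prod>c\<in>s. w c) \<le> (\<Sum>s\<in>Pow (\<Union>F). \<Prod>c\<in>s. w c)"
      using F nonneg by (intro sum_mono2) (auto intro: prod_nonneg)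
    also have "\<dots> = (\<Prod>c\<in>\<Union>F. w c + 1)"
      using prod_add[OF F(2), of w "\<lambda>_. 1"] by simp
    also have "\<dots> \<le> (\<Prod>c\<in>\<Union>F. exp (w c))"
      using nonneg exp_ge_add_one_self
      by (intro prod_mono) (auto simp: add.commute add_nonneg_nonneg)
    also have "\<dots> = exp (\<Sum>c\<in>\<Union>F. w c)"
      using F by (simp add: exp_sum)
    also have "\<dots> \<le> exp (\<Sum>\<^sub>\<infinity>c. w c)"
      using F assms by (auto intro!: finite_sum_le_infsum)
    finally show "(\<Sum>s\<in>F. \<Prod>c\<in>s. w c) \<le> exp (\<Sum>\<^sub>\<infinity>c. w c)" .
  qed
qed (auto intro: prod_nonneg nonneg)

lemma summable_on_exp_energy:
  assumes "0 < \<alpha>"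
  shows "(\<lambda>s. exp (- \<alpha> * energy s)) summable_on {s. finite s}"
proof -
  have "(\<lambda>s. \<Prod>c\<in>s. exp (- \<alpha> * \<bar>of_int c + 1 / 2\<bar>)) summable_on {s :: int set. finite s}"
    by (intro summable_on_prod_finite_sets summable_on_exp_abs assms) auto
  then show ?thesis
    by (rule summable_on_cong[THEN iffD1, rotated])
      (simp add: energy_def sum_distrib_left exp_sum)
qed

lemma half_le_abs: "1 / 2 \<le> \<bar>of_int c + 1 / 2 :: real\<bar>"
proof (cases "0 \<le> c")
  case False
  then have "of_int c \<le> (- 1 :: real)" by (simp add: of_int_le_iff[of _ "-1", simplified])
  then show ?thesis by linarith
qed simp

lemma card_le_energy: "real (card s) \<le> 2 * energy s"
proof -
  have "(\<Sum>c\<in>s. 1 / 2) \<le> energy s"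
    unfolding energy_def by (rule sum_mono) (rule half_le_abs)
  then show ?thesis by simp
qed

lemma abs_le_energy: "finite s \<Longrightarrow> c \<in> s \<Longrightarrow> \<bar>of_int c + 1 / 2\<bar> \<le> energy s"
  unfolding energy_def by (rule member_le_sum[of c s "\<lambda>c. \<bar>of_int c + 1 / 2\<bar>"]) auto

lemma energy_nonneg: "0 \<le> energy s"
  by (simp add: energy_def sum_nonneg)

definition q_energy :: "complex \<Rightarrow> int set \<Rightarrow> complex" where
  "q_energy \<tau> s = exp (2 * of_real pi * \<i> * \<tau> * of_real (energy s))"

definition sector :: "int \<Rightarrow> int set set" where
  "sector c = {s. finite s \<and> charge s = c}"

definition sector_sum :: "complex \<Rightarrow> int \<Rightarrow> complex" where
  "sector_sum \<tau> c = (\<Sum>\<^sub>\<infinity>s\<in>sector c. q_energy \<tau> s)"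

lemma neutral_eq_sector: "neutral = sector 0"
  by (simp add: neutral_def sector_def)

lemma norm_q_energy: "norm (q_energy \<tau> s) = exp (- (2 * pi * Im \<tau>) * energy s)"
  by (simp add: q_energy_def)

lemma summable_norm_q_energy:
  "0 < Im \<tau> \<Longrightarrow> A \<subseteq> {s. finite s} \<Longrightarrow> (\<lambda>s. norm (q_energy \<tau> s)) summable_on A"
  using summable_on_exp_energy[of "2 * pi * Im \<tau>"]
  by (auto simp: norm_q_energy intro: summable_on_subset)

lemma summable_q_energy: "0 < Im \<tau> \<Longrightarrow> A \<subseteq> {s. finite s} \<Longrightarrow> q_energy \<tau> summable_on A"
  by (rule abs_summable_summable) (rule summable_norm_q_energy)

lemma charge_eq_sum:
  assumes "finite s"
  shows "charge s = (\<Sum>c\<in>s. if c < 0 then 1 else - 1)"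
proof -
  have "(\<Sum>c\<in>s. if c < 0 then 1 else - 1 :: int) = (\<Sum>c\<in>{c\<in>s. c < 0}. 1) + (\<Sum>c\<in>{c\<in>s. \<not> c < 0}. - 1)"
    using assms by (simp add: sum.If_cases Int_def conj_commute)
  then show ?thesis by (simp add: charge_def not_less)
qed

text \<open>
  Removing the label \<open>c\<close> is injective on the states containing it and releases the energy of \<open>c\<close>.
\<close>

lemma norm_sum_q_energy_containing:
  assumes "0 < Im \<tau>" "A \<subseteq> {s. finite s \<and> c \<in> s}"
  shows "norm (\<Sum>\<^sub>\<infinity>s\<in>A. q_energy \<tau> s)
     \<le> exp (- (2 * pi * Im \<tau>) * \<bar>of_int c + 1 / 2\<bar>) * (\<Sum>\<^sub>\<infinity>s\<in>{s. finite s}. norm (q_energy \<tau> s))"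
proof -
  define e where "e = exp (- (2 * pi * Im \<tau>) * \<bar>of_int c + 1 / 2\<bar>)"
  have inj: "inj_on (\<lambda>s. s - {c}) A"
    using assms(2) by (auto simp: inj_on_def)
  have A: "A \<subseteq> {s. finite s}" "(\<lambda>s. s - {c}) ` A \<subseteq> {s. finite s}" using assms(2) by auto
  have "norm (\<Sum>\<^sub>\<infinity>s\<in>A. q_energy \<tau> s) \<le> (\<Sum>\<^sub>\<infinity>s\<in>A. norm (q_energy \<tau> s))"
    using summable_norm_q_energy[OF assms(1) A(1)] by (rule norm_infsum_bound)
  also have "\<dots> = (\<Sum>\<^sub>\<infinity>s\<in>A. e * norm (q_energy \<tau> (s - {c})))"
  proof (rule infsum_cong)
    fix s assume "s \<in> A"
    then have "energy s = \<bar>of_int c + 1 / 2\<bar> + energy (s - {c})"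
      using assms(2) by (auto simp: energy_def intro: sum.remove)
    then show "norm (q_energy \<tau> s) = e * norm (q_energy \<tau> (s - {c}))"
      by (simp add: norm_q_energy e_def mult_exp_exp algebra_simps)
  qed
  also have "\<dots> = e * (\<Sum>\<^sub>\<infinity>s\<in>(\<lambda>s. s - {c}) ` A. norm (q_energy \<tau> s))"
    using inj by (simp add: infsum_cmult_right' infsum_reindex o_def)
  also have "\<dots> \<le> e * (\<Sum>\<^sub>\<infinity>s\<in>{s. finite s}. norm (q_energy \<tau> s))"
    using A(2) assms(1)
    by (intro mult_left_mono infsum_mono_neutral summable_norm_q_energy) (auto simp: e_def)
  finally show ?thesis by (simp add: e_def)
qed

text \<open>
  In terms of occupied modes this is the translation by one: the set of occupied modes is the
  symmetric difference of \<open>s\<close> and the nonnegative integers, and translating it means to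
  translate \<open>s\<close> and to toggle \<open>0\<close>. The charge drops by one.
\<close>

definition shift :: "int set \<Rightarrow> int set" where
  "shift s = {c. (c - 1 \<in> s) \<noteq> (c = 0)}"

lemma sum_shift:
  fixes f :: "int \<Rightarrow> 'a::ab_group_add"
  assumes "finite s"
  shows "finite (shift s)"
    and "sum f (shift s) = (\<Sum>c\<in>s - {- 1}. f (c + 1)) + (if - 1 \<in> s then 0 else f 0)"
proof -
  have eq: "shift s = (\<lambda>c. c + 1) ` (s - {- 1}) \<union> (if - 1 \<in> s then {} else {0})"
  proof (intro equalityI subsetI)
    fix c assume "c \<in> shift s"
    then show "c \<in> (\<lambda>c. c + 1) ` (s - {- 1}) \<union> (if - 1 \<in> s then {} else {0})"
      by (cases "c = 0") (auto simp: shift_def intro: image_eqI[of _ _ "c - 1"])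
  qed (auto simp: shift_def split: if_splits)
  show "finite (shift s)" using assms by (simp add: eq)
  show "sum f (shift s) = (\<Sum>c\<in>s - {- 1}. f (c + 1)) + (if - 1 \<in> s then 0 else f 0)"
    unfolding eq using assms by (subst sum.union_disjoint) (auto simp: sum.reindex add_eq_0_iff)
qed

lemma charge_shift:
  assumes "finite s"
  shows "charge (shift s) = charge s - 1"
proof -
  have "charge (shift s) = (\<Sum>c\<in>s - {- 1}. if c + 1 < 0 then 1 else - 1) + (if - 1 \<in> s then 0 else - 1)"
    using sum_shift(2)[OF assms, of "\<lambda>c. if c < 0 then 1 else - 1 :: int"]
    by (simp add: charge_eq_sum[OF sum_shift(1)[OF assms]])
  also have "(\<Sum>c\<in>s - {- 1}. if c + 1 < 0 then 1 else - 1 :: int) = (\<Sum>c\<in>s - {- 1}. if c < 0 then 1 else - 1)"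
    by (rule sum.cong) auto
  finally show ?thesis using assms by (simp add: charge_eq_sum sum_diff1)
qed

lemma energy_shift:
  assumes "finite s"
  shows "energy (shift s) = energy s - of_int (charge s) + 1 / 2"
proof -
  have "energy (shift s) = (\<Sum>c\<in>s - {- 1}. \<bar>of_int (c + 1) + 1 / 2\<bar>) + (if - 1 \<in> s then 0 else 1 / 2)"
    using sum_shift(2)[OF assms, of "\<lambda>c. \<bar>of_int c + 1 / 2 :: real\<bar>"] by (simp add: energy_def)
  also have "(\<Sum>c\<in>s - {- 1}. \<bar>of_int (c + 1) + 1 / 2 :: real\<bar>)
      = (\<Sum>c\<in>s - {- 1}. \<bar>of_int c + 1 / 2\<bar> - of_int (if c < 0 then 1 else - 1))"
  proof (rule sum.cong)
    fix c assume "c \<in> s - {- 1}"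
    then have "c \<le> - 2 \<or> 0 \<le> c" by auto
    then have "of_int c \<le> (- 2 :: real) \<and> c < 0 \<or> (0 :: real) \<le> of_int c \<and> 0 \<le> c"
      using of_int_le_iff[of c "- 2", where ?'a = real] by auto
    then show "\<bar>of_int (c + 1) + 1 / 2 :: real\<bar> = \<bar>of_int c + 1 / 2\<bar> - of_int (if c < 0 then 1 else - 1)"
      by auto
  qed simp
  also have "\<dots> = energy s - of_int (charge s) - (if - 1 \<in> s then - 1 / 2 else 0)"
    using assms by (simp add: energy_def charge_eq_sum sum_subtractf sum_diff1 of_int_sum)
  finally show ?thesis by (simp split: if_splits)
qed

lemma bij_shift: "bij_betw shift (sector c) (sector (c - 1))"
proof -
  define unshift where "unshift t = {c. (c + 1 \<in> t) \<noteq> (c = - 1)}" for t :: "int set"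
  have [simp]: "unshift (shift s) = s" "shift (unshift s) = s" for s
    by (auto simp: shift_def unshift_def)
  have fin: "finite (unshift t)" if "finite t" for t
  proof (rule finite_subset)
    show "unshift t \<subseteq> insert (- 1) ((\<lambda>c. c - 1) ` t)"
    proof
      fix c assume "c \<in> unshift t"
      then show "c \<in> insert (- 1) ((\<lambda>c. c - 1) ` t)"
        by (cases "c = - 1") (auto simp: unshift_def intro: image_eqI[of _ _ "c + 1"])
    qed
  qed (use that in simp)
  show ?thesis
  proof (rule bij_betwI[where g = unshift])
    show "shift \<in> sector c \<rightarrow> sector (c - 1)"
      by (auto simp: sector_def charge_shift sum_shift)
    show "unshift \<in> sector (c - 1) \<rightarrow> sector c"
    proof
      fix t assume "t \<in> sector (c - 1)"
      then show "unshift t \<in> sector c"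
        using charge_shift[OF fin, of t] by (simp add: sector_def fin)
    qed
  qed auto
qed

text \<open>
  Since all \<open>q\<close>-powers are nonzero, the sums of neighbouring sectors vanish together.
\<close>

lemma sector_sum_shift: "sector_sum \<tau> (c - 1) = exp (2 * of_real pi * \<i> * \<tau> * (1 / 2 - of_int c)) * sector_sum \<tau> c"
proof -
  have "sector_sum \<tau> (c - 1) = (\<Sum>\<^sub>\<infinity>s\<in>sector c. q_energy \<tau> (shift s))"
    unfolding sector_sum_def by (rule infsum_reindex_bij_betw[OF bij_shift, symmetric])
  also have "\<dots> = (\<Sum>\<^sub>\<infinity>s\<in>sector c. exp (2 * of_real pi * \<i> * \<tau> * (1 / 2 - of_int c)) * q_energy \<tau> s)"
    by (rule infsum_cong)
      (simp add: sector_def q_energy_def energy_shift mult_exp_exp algebra_simps)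
  finally show ?thesis by (simp add: sector_sum_def infsum_cmult_right')
qed

text \<open>
  Without the constraint on the charge the modes are independent, so the sum is the infinite
  product of the factors \<open>1 + q\<^sup>|\<^sup>k\<^sup>+\<^sup>1\<^sup>/\<^sup>2\<^sup>|\<close>. It converges absolutely and no factor vanishes, as
  \<open>|q| < 1\<close>. The modes \<open>n\<close> and \<open>- n - 1\<close> have the same energy, whence the square.
\<close>

lemma sum_all_q_energy_nonzero:
  assumes "0 < Im \<tau>"
  shows "(\<Sum>\<^sub>\<infinity>s\<in>{s. finite s}. q_energy \<tau> s) \<noteq> 0"
proof -
  define u where "u k = exp (2 * of_real pi * \<i> * \<tau> * of_real \<bar>of_int k + 1 / 2\<bar>)" for k :: int
  have norm_u: "norm (u k) = exp (- (2 * pi * Im \<tau>) * \<bar>of_int k + 1 / 2\<bar>)" for k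
    by (simp add: u_def)
  have u_neq: "1 + u k \<noteq> 0" for k
  proof
    assume "1 + u k = 0"
    then have "u k = - 1" by (simp add: add_eq_0_iff)
    then have "norm (u k) = 1" by simp
    moreover have "0 < 2 * pi * Im \<tau> * \<bar>of_int k + 1 / 2\<bar>"
      using assms half_le_abs[of k] by (intro mult_pos_pos) (auto intro: less_le_trans[of _ "1 / 2"])
    ultimately show False unfolding norm_u exp_eq_one_iff mult_minus_left by linarith
  qed
  have "(\<lambda>k. norm (u k)) summable_on UNIV"
    using summable_on_exp_abs[of "2 * pi * Im \<tau>"] assms by (simp add: norm_u)
  then have "(\<lambda>k. norm (u k)) summable_on range int"
    by (rule summable_on_subset) simp
  then have "(\<lambda>n. norm (u (int n))) summable_on UNIV"
    by (subst (asm) summable_on_reindex) (auto simp: o_def)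
  then have "summable (\<lambda>n. norm (u (int n)))"
    by (rule summable_on_imp_summable)
  then have conv: "convergent_prod (\<lambda>n. 1 + u (int n))"
    by (intro abs_convergent_prod_imp_convergent_prod summable_imp_abs_convergent_prod) simp
  have "(\<lambda>n. \<Prod>i\<le>n. 1 + u (int i)) \<longlonglongrightarrow> prodinf (\<lambda>n. 1 + u (int n))"
    "prodinf (\<lambda>n. 1 + u (int n)) \<noteq> 0"
    using convergent_prod_LIMSEQ[OF conv] prodinf_nonzero[OF conv u_neq] by simp_all
  then have lim: "(\<lambda>n. (\<Prod>i\<le>n. 1 + u (int i)) ^ 2) \<longlonglongrightarrow> prodinf (\<lambda>n. 1 + u (int n)) ^ 2"
    "prodinf (\<lambda>n. 1 + u (int n)) ^ 2 \<noteq> 0"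
    by (auto intro!: tendsto_power)
  define I where "I n = {- int n - 1..int n}" for n
  have "(\<Prod>i\<le>n. 1 + u (int i)) ^ 2 = (\<Sum>s\<in>Pow (I n). q_energy \<tau> s)" for n
  proof -
    have I: "I n = int ` {..n} \<union> (\<lambda>i. - int i - 1) ` {..n}"
    proof (intro equalityI subsetI)
      fix k assume "k \<in> I n"
      then show "k \<in> int ` {..n} \<union> (\<lambda>i. - int i - 1) ` {..n}"
        by (cases "0 \<le> k")
          (auto simp: I_def intro: image_eqI[of _ _ "nat k"] image_eqI[of _ _ "nat (- k - 1)"])
    qed (auto simp: I_def)
    have u': "u (- int i - 1) = u (int i)" for i by (simp add: u_def algebra_simps)
    have "(\<Prod>k\<in>I n. 1 + u k) = (\<Prod>k\<in>int ` {..n}. 1 + u k) * (\<Prod>k\<in>(\<lambda>i. - int i - 1) ` {..n}. 1 + u k)"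
      unfolding I by (rule prod.union_disjoint) auto
    also have "\<dots> = (\<Prod>i\<le>n. 1 + u (int i)) ^ 2"
      by (simp add: prod.reindex inj_on_def o_def u' power2_eq_square)
    also have "(\<Prod>k\<in>I n. 1 + u k) = (\<Sum>s\<in>Pow (I n). \<Prod>k\<in>s. u k)"
      using prod_add[of "I n" u "\<lambda>_. 1"] by (simp add: I_def add.commute)
    also have "\<dots> = (\<Sum>s\<in>Pow (I n). q_energy \<tau> s)"
    proof (rule sum.cong)
      fix s assume "s \<in> Pow (I n)"
      then have "finite s" by (auto simp: I_def intro: finite_subset)
      then show "(\<Prod>k\<in>s. u k) = q_energy \<tau> s"
        by (simp add: u_def q_energy_def energy_def of_real_sum sum_distrib_left exp_sum)
    qed simp
    finally show ?thesis by simp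
  qed
  moreover have "filterlim (\<lambda>n. Pow (I n)) (finite_subsets_at_top {s. finite s}) sequentially"
    unfolding filterlim_finite_subsets_at_top
  proof (intro allI impI)
    fix X :: "int set set" assume X: "finite X \<and> X \<subseteq> {s. finite s}"
    then have "finite (abs ` \<Union>X)" by auto
    then obtain b where b: "\<And>k. k \<in> \<Union>X \<Longrightarrow> \<bar>k\<bar> \<le> b"
      by (metis bdd_above.E bdd_above_finite image_eqI)
    show "\<forall>\<^sub>F n in sequentially. finite (Pow (I n)) \<and> X \<subseteq> Pow (I n) \<and> Pow (I n) \<subseteq> {s. finite s}"
      using eventually_ge_at_top[of "nat b"]
    proof eventually_elim
      case (elim n)
      have "k \<in> I n" if "k \<in> \<Union>X" for k
        using b[OF that] elim by (auto simp: I_def)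
      then have "X \<subseteq> Pow (I n)" by blast
      then show ?case by (auto simp: I_def intro: finite_subset)
    qed
  qed
  then have "(\<lambda>n. \<Sum>s\<in>Pow (I n). q_energy \<tau> s) \<longlonglongrightarrow> (\<Sum>\<^sub>\<infinity>s\<in>{s. finite s}. q_energy \<tau> s)"
    using infsum_tendsto[OF summable_q_energy[OF assms subset_refl]] by (rule filterlim_compose[rotated])
  ultimately have "(\<Sum>\<^sub>\<infinity>s\<in>{s. finite s}. q_energy \<tau> s) = prodinf (\<lambda>n. 1 + u (int n)) ^ 2"
    using lim(1) by (auto intro: LIMSEQ_unique)
  then show ?thesis using lim(2) by simp
qed

text \<open>
  If one sector sum vanished, all would, and with them the sum over all states.
\<close>

lemma sector_sum_nonzero:
  assumes "0 < Im \<tau>"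
  shows "sector_sum \<tau> c \<noteq> 0"
proof
  assume "sector_sum \<tau> c = 0"
  have "sector_sum \<tau> d = 0" for d
  proof (induction d rule: int_induct[where k = c])
    case (step1 d)
    then show ?case using sector_sum_shift[of \<tau> "d + 1"] by simp
  next
    case (step2 d)
    then show ?case using sector_sum_shift[of \<tau> d] by simp
  qed (fact \<open>sector_sum \<tau> c = 0\<close>)
  moreover have "bij_betw snd (Sigma UNIV sector) {s. finite s}"
    by (rule bij_betwI[where g = "\<lambda>s. (charge s, s)"]) (auto simp: sector_def)
  then have "(\<lambda>p. q_energy \<tau> (snd p)) summable_on Sigma UNIV sector"
    "(\<Sum>\<^sub>\<infinity>s\<in>{s. finite s}. q_energy \<tau> s) = (\<Sum>\<^sub>\<infinity>p\<in>Sigma UNIV sector. q_energy \<tau> (snd p))"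
    using summable_on_reindex_bij_betw[of snd "Sigma UNIV sector" "{s. finite s}" "q_energy \<tau>"]
      infsum_reindex_bij_betw[of snd "Sigma UNIV sector" "{s. finite s}" "q_energy \<tau>"]
      summable_q_energy[OF assms subset_refl] by auto
  ultimately have "(\<Sum>\<^sub>\<infinity>s\<in>{s. finite s}. q_energy \<tau> s) = 0"
    using infsum_Sigma_banach[of "\<lambda>p. q_energy \<tau> (snd p)" UNIV sector] by (simp add: sector_sum_def)
  then show False using sum_all_q_energy_nonzero[OF assms] by simp
qed

section \<open>The character of a state\<close>

definition state_char :: "int set \<Rightarrow> complex \<Rightarrow> complex" where
  "state_char s y = (\<Sum>c\<in>s. mode_charge c * exp (- (of_int c + 1/2) * y)) + exp (y / 2) / (exp y - 1)"

lemma has_sum_int_atLeast: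
  fixes f :: "nat \<Rightarrow> 'a::{topological_comm_monoid_add}"
  assumes "(f has_sum S) UNIV"
  shows "((\<lambda>r::int. if d \<le> r then f (nat (r - d)) else 0) has_sum S) UNIV"
proof -
  have bij: "bij_betw (\<lambda>n. int n + d) UNIV {d..}"
    by (rule bij_betwI[where g = "\<lambda>r. nat (r - d)"]) auto
  have "((\<lambda>r. f (nat (r - d))) has_sum S) {d..}"
    using has_sum_reindex_bij_betw[OF bij, of "\<lambda>r. f (nat (r - d))" S] assms by simp
  then show ?thesis
    by (rule has_sum_cong_neutral[THEN iffD1, rotated -1]) auto
qed

text \<open>
  Every mode of \<open>s\<close> has energy at least \<open>1/2\<close> and at most that of \<open>s\<close>.
\<close>

lemma norm_sum_chars_le:
  assumes "finite s" "\<And>c. c \<in> s \<Longrightarrow> norm (f c) \<le> exp (\<bar>of_int c + 1 / 2\<bar> * x)" "0 \<le> x"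
  shows "(\<Sum>c\<in>s. norm (f c)) \<le> 2 * energy s * exp (energy s * x)"
proof -
  have "(\<Sum>c\<in>s. norm (f c)) \<le> (\<Sum>c\<in>s. exp (energy s * x))"
  proof (rule sum_mono)
    fix c assume "c \<in> s"
    then have "norm (f c) \<le> exp (\<bar>of_int c + 1 / 2\<bar> * x)" by (rule assms)
    also have "\<dots> \<le> exp (energy s * x)"
      using abs_le_energy[OF assms(1) \<open>c \<in> s\<close>] assms(3) by (simp add: mult_right_mono)
    finally show "norm (f c) \<le> exp (energy s * x)" .
  qed
  also have "\<dots> = real (card s) * exp (energy s * x)" by simp
  also have "\<dots> \<le> 2 * energy s * exp (energy s * x)"
    by (intro mult_right_mono card_le_energy) simp
  finally show ?thesis .
qed

lemma norm_mode_charge: "norm (mode_charge c) = 1"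
  by (simp add: mode_charge_def)

text \<open>
  In the vacuum exactly the modes \<open>k \<ge> 0\<close> are occupied. The labels of \<open>s\<close> add the modes \<open>k < 0\<close>
  and remove modes \<open>k \<ge> 0\<close>, and \<open>mode_charge\<close> gives the sign.
\<close>

lemma has_sum_occupied:
  assumes "finite s" "0 < Re y"
  shows "((\<lambda>k. of_bool (occupied k s) * exp (- (of_int k + 1/2) * y)) has_sum state_char s y) UNIV"
proof -
  have lt: "norm (exp (- y)) < 1" using assms(2) by simp
  then have "(\<lambda>n. exp (- y / 2) * exp (- y) ^ n) sums (exp (- y / 2) * (1 / (1 - exp (- y))))"
    by (intro sums_mult geometric_sums)
  moreover have "summable (\<lambda>n. norm (exp (- y / 2) * exp (- y) ^ n))"
    using lt by (auto simp: norm_mult norm_power simp del: norm_exp_eq_Re intro!: summable_mult summable_geometric)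
  ultimately have "((\<lambda>n. exp (- y / 2) * exp (- y) ^ n) has_sum (exp (- y / 2) * (1 / (1 - exp (- y))))) UNIV"
    by (intro norm_summable_imp_has_sum)
  moreover have "exp (- y / 2) * (1 / (1 - exp (- y))) = exp (y / 2) / (exp y - 1)"
  proof -
    have "exp (- y) \<noteq> 1" using lt by (metis less_irrefl norm_one)
    then have "1 - exp (- y) \<noteq> 0" by simp
    moreover have "exp (- y) * exp (y / 2) = exp (- y / 2)" "exp y * exp (- y / 2) = exp (y / 2)"
      "exp (- y) * exp y = 1"
      by (simp_all add: mult_exp_exp field_simps)
    moreover have "exp y \<noteq> 0" by simp
    moreover have "exp y - 1 \<noteq> 0" using \<open>exp (- y) * exp y = 1\<close> \<open>1 - exp (- y) \<noteq> 0\<close> by auto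
    ultimately show ?thesis by (simp add: frac_eq_eq, simp add: algebra_simps)
  qed
  ultimately have 1: "((\<lambda>k::int. if 0 \<le> k then exp (- y / 2) * exp (- y) ^ nat (k - 0) else 0)
      has_sum exp (y / 2) / (exp y - 1)) UNIV"
    by (intro has_sum_int_atLeast) simp
  have 2: "((\<lambda>k. if k \<in> s then mode_charge k * exp (- (of_int k + 1/2) * y) else 0)
      has_sum (\<Sum>k\<in>s. mode_charge k * exp (- (of_int k + 1/2) * y))) UNIV"
    using has_sum_finite[OF assms(1), of "\<lambda>k. mode_charge k * exp (- (of_int k + 1/2) * y)"]
    by (rule has_sum_cong_neutral[THEN iffD1, rotated -1]) auto
  from has_sum_add[OF 2 1] show ?thesis
    unfolding state_char_def
  proof (rule has_sum_cong[THEN iffD1, rotated])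
    fix k :: int
    have "exp (- y / 2) * exp (- y) ^ nat k = exp (- (of_int k + 1/2) * y)" if "0 \<le> k"
      using that by (simp add: exp_of_nat_mult[symmetric] mult_exp_exp algebra_simps)
    then show "(if k \<in> s then mode_charge k * exp (- (of_int k + 1/2) * y) else 0)
        + (if 0 \<le> k then exp (- y / 2) * exp (- y) ^ nat (k - 0) else 0)
      = of_bool (occupied k s) * exp (- (of_int k + 1/2) * y)"
      by (auto simp: mode_charge_def occupied_def)
  qed
qed

text \<open>
  The norms of the terms are the terms at \<open>Re y\<close>, so the character itself computes their sum.
\<close>

lemma norm_occupied:
  assumes "finite s" "0 < Re y"
  shows "(\<lambda>k. norm (of_bool (occupied k s) * exp (- (of_int k + 1/2) * y))) summable_on UNIV"
    and "(\<Sum>\<^sub>\<infinity>k. norm (of_bool (occupied k s) * exp (- (of_int k + 1/2) * y)))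
      \<le> (2 * energy s + norm (exp (of_real (Re y) / 2) / (exp (of_real (Re y)) - 1 :: complex))) * exp (energy s * Re y)"
proof -
  define x where "x = Re y"
  have x: "0 < x" using assms(2) by (simp add: x_def)
  have norm_eq: "norm (of_bool (occupied k s) * exp (- (of_int k + 1/2) * y))
      = Re (of_bool (occupied k s) * exp (- (of_int k + 1/2) * of_real x))" for k
  proof -
    have "- (of_int k + 1/2) * complex_of_real x = of_real (- (of_int k + 1/2) * x)" by simp
    then show ?thesis by (simp only: exp_of_real) (simp add: norm_mult x_def)
  qed
  have "((\<lambda>k. norm (of_bool (occupied k s) * exp (- (of_int k + 1/2) * y))) has_sum Re (state_char s (of_real x))) UNIV"
    unfolding norm_eq by (rule has_sum_Re[OF has_sum_occupied[OF assms(1)]]) (use x in simp)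
  then have *: "(\<lambda>k. norm (of_bool (occupied k s) * exp (- (of_int k + 1/2) * y))) summable_on UNIV"
    "(\<Sum>\<^sub>\<infinity>k. norm (of_bool (occupied k s) * exp (- (of_int k + 1/2) * y))) = Re (state_char s (of_real x))"
    by (auto simp: has_sum_iff)
  show "(\<lambda>k. norm (of_bool (occupied k s) * exp (- (of_int k + 1/2) * y))) summable_on UNIV" by fact
  have "Re (state_char s (of_real x)) \<le> norm (state_char s (of_real x))" by (rule complex_Re_le_cmod)
  also have "\<dots> \<le> norm (\<Sum>c\<in>s. mode_charge c * exp (- (of_int c + 1/2) * of_real x))
      + norm (exp (of_real x / 2) / (exp (of_real x) - 1 :: complex))"
    unfolding state_char_def by (rule norm_triangle_ineq)
  also have "norm (\<Sum>c\<in>s. mode_charge c * exp (- (of_int c + 1/2) * complex_of_real x))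
      \<le> (\<Sum>c\<in>s. norm (mode_charge c * exp (- (of_int c + 1/2) * complex_of_real x)))"
    by (rule norm_sum)
  also have "\<dots> \<le> 2 * energy s * exp (energy s * x)"
  proof (rule norm_sum_chars_le[OF assms(1)])
    fix c
    have "- (of_int c + 1 / 2) * x \<le> \<bar>of_int c + 1 / 2\<bar> * x"
      using x by (intro mult_right_mono) auto
    then show "norm (mode_charge c * exp (- (of_int c + 1/2) * of_real x)) \<le> exp (\<bar>of_int c + 1 / 2\<bar> * x)"
      by (simp add: norm_mult norm_mode_charge)
  qed (use x in simp)
  also have "norm (exp (of_real x / 2) / (exp (of_real x) - 1 :: complex))
      \<le> norm (exp (of_real x / 2) / (exp (of_real x) - 1 :: complex)) * exp (energy s * x)"
    using mult_left_mono[of 1 "exp (energy s * x)" "norm (exp (of_real x / 2) / (exp (of_real x) - 1 :: complex))"]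
      x energy_nonneg[of s] by simp
  finally show "(\<Sum>\<^sub>\<infinity>k. norm (of_bool (occupied k s) * exp (- (of_int k + 1/2) * y)))
      \<le> (2 * energy s + norm (exp (of_real (Re y) / 2) / (exp (of_real (Re y)) - 1 :: complex))) * exp (energy s * Re y)"
    unfolding *(2) by (simp add: x_def algebra_simps)
qed

section \<open>Laurent expansion of the character\<close>

text \<open>
  The coefficient of \<open>y\<^sup>r\<close> that \<open>\<sigma>(y)\<close> contributes on the state \<open>s\<close>.
\<close>

definition char_coeff :: "int set \<Rightarrow> int \<Rightarrow> complex" where
  "char_coeff s r = (if r = - 1 then 1 else if 1 \<le> r then Lbar_eig (nat r) s / fact (nat r) else 0)"

text \<open>
  The expansion of \<open>y e\<^sup>y\<^sup>/\<^sup>2/(e\<^sup>y - 1)\<close>, the generating function of the Bernoulli polynomials at \<open>1/2\<close>.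
\<close>

definition bernoulli_half_fps :: "complex fps" where
  "bernoulli_half_fps = fps_exp (1/2) / fps_shift 1 (fps_exp 1 - 1)"

lemma bernoulli_half_fps_mult: "bernoulli_half_fps * fps_shift 1 (fps_exp 1 - 1) = fps_exp (1/2)"
proof -
  have "fps_nth (fps_shift 1 (fps_exp 1 - 1) :: complex fps) 0 \<noteq> 0" by simp
  then show ?thesis
    unfolding bernoulli_half_fps_def by (simp add: fps_divide_unit mult.assoc inverse_mult_eq_1)
qed

text \<open>
  The coefficient of \<open>y\<close> vanishes because \<open>e\<^sup>y\<^sup>/\<^sup>2/(e\<^sup>y - 1)\<close> is odd, and that of \<open>y\<^sup>2\<close> is the shift by
  \<open>-1/24\<close> of the energy.
\<close>

lemma bernoulli_half_fps_nth: "fps_nth bernoulli_half_fps 0 = 1" "fps_nth bernoulli_half_fps 1 = 0" "fps_nth bernoulli_half_fps 2 = - 1 / 24"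
proof -
  have eq: "fps_nth (bernoulli_half_fps * fps_shift 1 (fps_exp 1 - 1)) n = fps_nth (fps_exp (1/2)) n" for n
    unfolding bernoulli_half_fps_mult ..
  show 0: "fps_nth bernoulli_half_fps 0 = 1" using eq[of 0] by (simp add: fps_mult_nth)
  show 1: "fps_nth bernoulli_half_fps 1 = 0" using eq[of 1] 0 by (simp add: fps_mult_nth)
  have "fps_nth bernoulli_half_fps 2 * 48 = - 2"
    using eq[of 2] 0 1
    by (simp add: fps_mult_nth numeral_2_eq_2 fact_numeral field_simps add_eq_0_iff)
  then have "fps_nth bernoulli_half_fps 2 = - 2 / 48" by (subst eq_divide_eq) simp
  then show "fps_nth bernoulli_half_fps 2 = - 1 / 24" by simp
qed

lemma Lbar_const_eq: "Lbar_const r = fps_nth bernoulli_half_fps (r + 1)"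
proof -
  define S :: "complex fps" where "S = fps_shift 1 (fps_exp 1 - 1)"
  have S: "S \<noteq> 0" using bernoulli_half_fps_mult by (auto simp: S_def)
  have "fps_exp 1 - 1 = S * fps_X"
    by (rule fps_ext) (simp add: S_def fps_X_mult_right_nth)
  then have "fps_to_fls (fps_exp 1) - 1 = fps_to_fls S * (fls_X :: complex fls)"
    by (metis fls_times_fps_to_fls fps_X_to_fls fps_one_to_fls fps_to_fls_minus)
  moreover have "fps_to_fls (fps_exp (1/2)) = fps_to_fls bernoulli_half_fps * fps_to_fls S"
    by (simp add: bernoulli_half_fps_mult[symmetric] S_def fls_times_fps_to_fls)
  ultimately have "fps_to_fls (fps_exp (1/2)) / (fps_to_fls (fps_exp 1) - 1)
      = fps_to_fls bernoulli_half_fps / (fls_X :: complex fls)"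
    using S by simp
  also have "\<dots> = fps_to_fls bernoulli_half_fps * (fls_X_inv :: complex fls)"
    by (simp only: divide_inverse fls_inverse_X)
  also have "fls_nth \<dots> (int r) = fps_nth bernoulli_half_fps (r + 1)"
    by (simp add: fls_X_inv_times_conv_shift nat_add_distrib)
  finally show ?thesis .
qed

text \<open>
  The two operators \<open>L\<^sup>(\<^sup>1\<^sup>)(0)\<close> and \<open>L(0) - 1/24\<close> agree, so both traces carry the same weight.
\<close>

lemma Lbar_eig_1: "Lbar_eig 1 s = of_real (energy s) - 1 / 24"
proof -
  have "(\<Sum>c\<in>s. mode_charge c * (- (of_int c + 1/2)) ^ 1) = of_real (energy s)"
    unfolding energy_def of_real_sum
    by (rule sum.cong) (auto simp: mode_charge_def abs_if field_simps)
  then show ?thesis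
    unfolding Lbar_eig_def Lbar_const_eq using bernoulli_half_fps_nth(3) by (simp add: numeral_2_eq_2)
qed

lemma bernoulli_half_fps_expansion:
  obtains R where "0 < R"
    "\<And>y. norm y < R \<Longrightarrow> summable (\<lambda>n. norm (fps_nth bernoulli_half_fps n * y ^ n))"
    "\<And>y. norm y < R \<Longrightarrow> y \<noteq> 0 \<Longrightarrow>
      (\<lambda>n. fps_nth bernoulli_half_fps n * y ^ n) sums (y * (exp (y / 2) / (exp y - 1)))"
proof -
  have "(\<lambda>y::complex. exp y - 1) has_fps_expansion fps_exp 1 - 1"
    by (intro fps_expansion_intros)
  then have "(\<lambda>y::complex. if y = 0 then 1 else (exp y - 1) / y ^ 1) has_fps_expansion fps_shift 1 (fps_exp 1 - 1)"
    by (rule has_fps_expansion_shift) (auto intro: subdegree_geI)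
  moreover have "(\<lambda>y::complex. exp (1/2 * y)) has_fps_expansion fps_exp (1/2)"
    by (intro fps_expansion_intros)
  ultimately have *: "(\<lambda>y. exp (1/2 * y) / (if y = 0 then 1 else (exp y - 1) / y ^ 1)) has_fps_expansion bernoulli_half_fps"
    unfolding bernoulli_half_fps_def by (intro has_fps_expansion_divide') auto
  then obtain e where e: "0 < e"
    "\<And>y. norm y < e \<Longrightarrow> eval_fps bernoulli_half_fps y = exp (1/2 * y) / (if y = 0 then 1 else (exp y - 1) / y ^ 1)"
    by (auto simp: has_fps_expansion_def eventually_nhds_metric)
  have "0 < fps_conv_radius bernoulli_half_fps" using * by (simp add: has_fps_expansion_def)
  then obtain r :: real where r: "0 < r" "ereal r \<le> fps_conv_radius bernoulli_half_fps"
    by (metis ereal_dense2 ereal_less(2) less_imp_le)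
  show thesis
  proof (rule that[of "min e r"])
    fix y :: complex assume y: "norm y < min e r"
    then have "ereal (norm y) < ereal r" by simp
    with r(2) have lt: "ereal (norm y) < fps_conv_radius bernoulli_half_fps" by order
    then show "summable (\<lambda>n. norm (fps_nth bernoulli_half_fps n * y ^ n))" by (rule norm_summable_fps)
    assume "y \<noteq> 0"
    then show "(\<lambda>n. fps_nth bernoulli_half_fps n * y ^ n) sums (y * (exp (y / 2) / (exp y - 1)))"
      using sums_eval_fps[OF lt] e(2)[of y] y by (simp add: mult_ac)
  qed (use e r in simp)
qed

text \<open>
  The two summands are the expansions of the two parts of the character. Their constant terms are
  the charge, which is \<open>0\<close> for a neutral state, and the vanishing Bernoulli coefficient; this is
  why \<open>\<sigma>(y)\<close> can do without the term \<open>r = 0\<close>.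
\<close>

lemma char_coeff_decomp:
  assumes "s \<in> neutral" "y \<noteq> 0"
  shows "char_coeff s r * y powi r
    = (if 0 \<le> r then (\<lambda>m. \<Sum>c\<in>s. mode_charge c * ((- (of_int c + 1/2) * y) ^ m / fact m)) (nat (r - 0)) else 0)
    + (if - 1 \<le> r then (\<lambda>n. fps_nth bernoulli_half_fps n * y ^ n / y) (nat (r - - 1)) else 0)"
proof -
  consider "r < - 1" | "r = - 1" | "r = 0" | "1 \<le> r" by linarith
  then show ?thesis
  proof cases
    case 3
    have "(\<Sum>c\<in>s. mode_charge c) = of_int (\<Sum>c\<in>s. if c < 0 then 1 else - 1)"
      unfolding of_int_sum by (rule sum.cong) (auto simp: mode_charge_def)
    also have "(\<Sum>c\<in>s. if c < 0 then 1 else - 1) = charge s"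
      by (rule charge_eq_sum[symmetric]) (use assms(1) in \<open>simp add: neutral_def\<close>)
    finally have "(\<Sum>c\<in>s. mode_charge c) = 0"
      using assms(1) by (simp add: neutral_def)
    then show ?thesis using 3 bernoulli_half_fps_nth by (simp add: char_coeff_def)
  next
    case 4
    define m where "m = nat r"
    have r: "r = int m" "1 \<le> m" using 4 by (auto simp: m_def)
    have "char_coeff s r * y powi r = Lbar_eig m s / fact m * y ^ m"
      using r by (simp add: char_coeff_def)
    also have "\<dots> = (\<Sum>c\<in>s. mode_charge c * (- (of_int c + 1/2)) ^ m) / fact m * y ^ m + fps_nth bernoulli_half_fps (m + 1) * y ^ m"
      unfolding Lbar_eig_def Lbar_const_eq by (simp add: field_simps)
    also have "(\<Sum>c\<in>s. mode_charge c * (- (of_int c + 1/2)) ^ m) / fact m * y ^ m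
        = (\<Sum>c\<in>s. mode_charge c * ((- (of_int c + 1/2) * y) ^ m / fact m))"
      unfolding sum_divide_distrib sum_distrib_right
      by (rule sum.cong) (simp_all add: power_mult_distrib)
    also have "fps_nth bernoulli_half_fps (m + 1) * y ^ m = fps_nth bernoulli_half_fps (m + 1) * y ^ (m + 1) / y"
      using assms(2) by simp
    finally show ?thesis using r by (simp add: nat_add_distrib)
  qed (auto simp: char_coeff_def bernoulli_half_fps_nth power_int_minus field_simps)
qed

lemma has_sum_sum:
  fixes f :: "'c \<Rightarrow> 'a \<Rightarrow> 'b::topological_comm_monoid_add"
  assumes "\<And>c. (f c has_sum a c) A"
  shows "((\<lambda>x. \<Sum>c\<in>s. f c x) has_sum (\<Sum>c\<in>s. a c)) A"
  using assms by (induction s rule: infinite_finite_induct) (auto intro: has_sum_add)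

text \<open>
  The radius \<open>R\<close> and the constants \<open>g y\<close> do not depend on the state, which the summation over
  all states requires.
\<close>

lemma char_coeff_has_sum:
  obtains R :: real and g :: "complex \<Rightarrow> real" where "0 < R"
    "\<And>s y. s \<in> neutral \<Longrightarrow> y \<noteq> 0 \<Longrightarrow> norm y < R \<Longrightarrow>
      ((\<lambda>r. char_coeff s r * y powi r) has_sum state_char s y) UNIV"
    "\<And>s y. s \<in> neutral \<Longrightarrow> y \<noteq> 0 \<Longrightarrow> norm y < R \<Longrightarrow>
      (\<lambda>r. norm (char_coeff s r * y powi r)) summable_on UNIV \<and>
      (\<Sum>\<^sub>\<infinity>r. norm (char_coeff s r * y powi r)) \<le> (2 * energy s + g y) * exp (energy s * norm y)"
    "\<And>y. 0 \<le> g y"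
proof -
  obtain R where R: "0 < R"
    "\<And>y. norm y < R \<Longrightarrow> summable (\<lambda>n. norm (fps_nth bernoulli_half_fps n * y ^ n))"
    "\<And>y. norm y < R \<Longrightarrow> y \<noteq> 0 \<Longrightarrow>
      (\<lambda>n. fps_nth bernoulli_half_fps n * y ^ n) sums (y * (exp (y / 2) / (exp y - 1)))"
    by (rule bernoulli_half_fps_expansion) auto
  define g where "g y = (\<Sum>\<^sub>\<infinity>n. norm (fps_nth bernoulli_half_fps n * y ^ n / y))" for y :: complex
  have g0: "0 \<le> g y" for y by (simp add: g_def infsum_nonneg)
  have exp_has_sum: "((\<lambda>m. z ^ m / fact m) has_sum exp z) UNIV" for z :: complex
  proof (rule norm_summable_imp_has_sum)
    show "summable (\<lambda>m. norm (z ^ m / fact m))"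
      using summable_norm_exp[of z] by (simp add: scaleR_conv_of_real norm_divide norm_mult norm_power divide_inverse mult.commute)
    show "(\<lambda>m. z ^ m / fact m) sums exp z"
      using exp_converges[of z] by (simp add: scaleR_conv_of_real divide_inverse mult.commute)
  qed
  have exp_norm: "((\<lambda>m. norm (z ^ m / fact m)) has_sum exp (norm z)) UNIV" for z :: complex
  proof -
    have "((\<lambda>m. Re (of_real (norm z) ^ m / fact m)) has_sum Re (exp (of_real (norm z)))) UNIV"
      by (intro has_sum_Re exp_has_sum)
    moreover have "Re (of_real (norm z) ^ m / fact m) = norm (z ^ m / fact m)" for m
    proof -
      have "of_real (norm z) ^ m / fact m = (of_real (norm z ^ m / fact m) :: complex)" by simp
      then show ?thesis by (simp only: Re_complex_of_real) (simp add: norm_divide norm_power)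
    qed
    moreover have "Re (exp (complex_of_real (norm z))) = exp (norm z)"
      by (simp only: exp_of_real Re_complex_of_real)
    ultimately show ?thesis by simp
  qed
  have fps_sum: "((\<lambda>n. fps_nth bernoulli_half_fps n * y ^ n / y) has_sum (exp (y / 2) / (exp y - 1))) UNIV"
    "(\<lambda>n. norm (fps_nth bernoulli_half_fps n * y ^ n / y)) summable_on UNIV" if "y \<noteq> 0" "norm y < R" for y
  proof -
    have "((\<lambda>n. fps_nth bernoulli_half_fps n * y ^ n) has_sum (y * (exp (y / 2) / (exp y - 1)))) UNIV"
      by (rule norm_summable_imp_has_sum[OF R(2)[OF that(2)] R(3)[OF that(2,1)]])
    then have "((\<lambda>n. fps_nth bernoulli_half_fps n * y ^ n / y) has_sum (y * (exp (y / 2) / (exp y - 1)) / y)) UNIV"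
      by (rule has_sum_divide_const)
    also have "y * (exp (y / 2) / (exp y - 1)) / y = exp (y / 2) / (exp y - 1)"
      using that by simp
    finally show *: "((\<lambda>n. fps_nth bernoulli_half_fps n * y ^ n / y) has_sum (exp (y / 2) / (exp y - 1))) UNIV" .
    show "(\<lambda>n. norm (fps_nth bernoulli_half_fps n * y ^ n / y)) summable_on UNIV"
      by (rule summable_on_iff_abs_summable_on_complex[THEN iffD1, OF has_sum_imp_summable[OF *]])
  qed
  show thesis
  proof (rule that[of R g])
    fix s and y :: complex assume s: "s \<in> neutral" and y: "y \<noteq> 0" "norm y < R"
    have "finite s" using s by (simp add: neutral_def)
    have 1: "((\<lambda>m. \<Sum>c\<in>s. mode_charge c * ((- (of_int c + 1/2) * y) ^ m / fact m))
        has_sum (\<Sum>c\<in>s. mode_charge c * exp (- (of_int c + 1/2) * y))) UNIV"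
      by (intro has_sum_sum has_sum_cmult_right exp_has_sum)
    show "((\<lambda>r. char_coeff s r * y powi r) has_sum state_char s y) UNIV"
      unfolding char_coeff_decomp[OF s y(1)] state_char_def
      by (intro has_sum_add has_sum_int_atLeast 1 fps_sum(1) y)
    define M where "M r = (if 0 \<le> r then (\<lambda>m. \<Sum>c\<in>s. norm ((- (of_int c + 1/2) * y) ^ m / fact m)) (nat (r - 0)) else 0)
    + (if - 1 \<le> r then (\<lambda>n. norm (fps_nth bernoulli_half_fps n * y ^ n / y)) (nat (r - - 1)) else 0)" for r :: int
    have M: "(M has_sum ((\<Sum>c\<in>s. exp (norm (- (of_int c + 1/2) * y))) + g y)) UNIV"
      unfolding M_def g_def
      by (intro has_sum_add has_sum_int_atLeast has_sum_sum exp_norm has_sum_infsum fps_sum(2) y)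
    have le: "norm (char_coeff s r * y powi r) \<le> M r" for r
    proof -
      have "norm (\<Sum>c\<in>s. mode_charge c * ((- (of_int c + 1/2) * y) ^ m / fact m))
          \<le> (\<Sum>c\<in>s. norm ((- (of_int c + 1/2) * y) ^ m / fact m))" for m
        by (rule order_trans[OF norm_sum]) (simp only: norm_mult norm_mode_charge mult_1 order_refl)
      then show ?thesis
        unfolding char_coeff_decomp[OF s y(1)] M_def
        by (intro order_trans[OF norm_triangle_ineq] add_mono) simp_all
    qed
    have sum: "(\<lambda>r. norm (char_coeff s r * y powi r)) summable_on UNIV"
      by (rule Infinite_Sum.abs_summable_on_comparison_test'[OF has_sum_imp_summable[OF M] le])
    have "(\<Sum>\<^sub>\<infinity>r. norm (char_coeff s r * y powi r)) \<le> (\<Sum>c\<in>s. exp (norm (- (of_int c + 1/2) * y))) + g y"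
      using infsum_mono[OF sum has_sum_imp_summable[OF M] le] infsumI[OF M] by simp
    also have "(\<Sum>c\<in>s. exp (norm (- (of_int c + 1/2) * y))) = (\<Sum>c\<in>s. norm (exp (norm (- (of_int c + 1/2) * y))))"
      by simp
    also have "\<dots> \<le> 2 * energy s * exp (energy s * norm y)"
    proof (rule norm_sum_chars_le[OF \<open>finite s\<close>])
      fix c
      have "of_int c + 1 / 2 = complex_of_real (of_int c + 1 / 2)" by simp
      then have "norm (- (of_int c + 1/2) * y) = \<bar>of_int c + 1 / 2\<bar> * norm y"
        by (simp only: norm_mult norm_minus_cancel norm_of_real)
      then show "norm (exp (norm (- (of_int c + 1/2) * y))) \<le> exp (\<bar>of_int c + 1 / 2\<bar> * norm y)"
        by simp
    qed simp
    also have "g y \<le> g y * exp (energy s * norm y)"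
      using mult_left_mono[of 1 "exp (energy s * norm y)" "g y"] g0[of y] energy_nonneg[of s] by simp
    finally show "(\<lambda>r. norm (char_coeff s r * y powi r)) summable_on UNIV \<and>
      (\<Sum>\<^sub>\<infinity>r. norm (char_coeff s r * y powi r)) \<le> (2 * energy s + g y) * exp (energy s * norm y)"
      using sum by (simp add: algebra_simps)
  qed (use R(1) g0 in auto)
qed

section \<open>Multiple series over states\<close>

definition vacuum_weight :: "complex \<Rightarrow> complex" where
  "vacuum_weight \<tau> = exp (- (2 * of_real pi * \<i> * \<tau> / 24))"

lemma state_weight_eq: "state_weight \<tau> s = vacuum_weight \<tau> * q_energy \<tau> s"
  by (simp add: state_weight_def vacuum_weight_def q_energy_def mult_exp_exp algebra_simps)

lemma norm_state_weight: "norm (state_weight \<tau> s) = exp (2 * pi * Im \<tau> / 24) * exp (- (2 * pi * Im \<tau>) * energy s)"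
  by (simp add: state_weight_eq vacuum_weight_def norm_mult norm_q_energy)

lemma linear_le_exp:
  fixes g \<delta> E :: real
  assumes "0 < \<delta>" "0 \<le> g" "0 \<le> E"
  shows "2 * E + g \<le> (2 / \<delta> + g) * exp (\<delta> * E)"
proof -
  have "2 * E \<le> 2 / \<delta> * exp (\<delta> * E)"
    using le_exp_divide[OF assms(1), of E] by (simp add: mult.commute)
  moreover have "g * 1 \<le> g * exp (\<delta> * E)"
    using assms by (intro mult_left_mono) auto
  ultimately show ?thesis by (simp add: distrib_right)
qed

text \<open>
  Half of the gap between \<open>\<alpha>\<close> and the sum of the \<open>x i\<close> is spent, in equal shares \<open>\<delta>\<close>, on the factors
  that are linear in the energy; the other half keeps the sum over states convergent.
\<close>

lemma summable_weighted_chars: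
  fixes x g :: "'n::finite \<Rightarrow> real"
  assumes "(\<Sum>i\<in>UNIV. x i) < \<alpha>" and g: "\<And>i. 0 \<le> g i"
  shows "(\<lambda>s. exp (- \<alpha> * energy s) * (\<Prod>i\<in>UNIV. (2 * energy s + g i) * exp (energy s * x i)))
    summable_on {s. finite s}"
proof -
  define \<beta> where "\<beta> = (\<alpha> - (\<Sum>i\<in>UNIV. x i)) / 2"
  define \<delta> where "\<delta> = \<beta> / real CARD('n)"
  have pos: "0 < \<beta>" "0 < \<delta>" using assms(1) by (simp_all add: \<beta>_def \<delta>_def)
  have card_\<delta>: "real CARD('n) * \<delta> = \<beta>" by (simp add: \<delta>_def)
  have "(\<lambda>s. (\<Prod>i\<in>UNIV. 2 / \<delta> + g i) * exp (- \<beta> * energy s)) summable_on {s. finite s}"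
    using pos by (intro summable_on_cmult_right summable_on_exp_energy)
  then show ?thesis
  proof (rule summable_on_comparison_test)
    fix s :: "int set"
    have "(\<Prod>i\<in>UNIV. (2 * energy s + g i) * exp (energy s * x i))
        \<le> (\<Prod>i\<in>UNIV. (2 / \<delta> + g i) * exp (\<delta> * energy s) * exp (energy s * x i))"
      using g pos energy_nonneg[of s]
      by (intro prod_mono conjI mult_right_mono linear_le_exp mult_nonneg_nonneg add_nonneg_nonneg) auto
    also have "\<dots> = (\<Prod>i\<in>UNIV. 2 / \<delta> + g i) * exp (\<beta> * energy s + energy s * (\<Sum>i\<in>UNIV. x i))"
      by (simp add: prod.distrib exp_sum[symmetric] exp_of_nat_mult[symmetric] mult_exp_exp
          sum_distrib_left sum.distrib card_\<delta>[symmetric] mult.assoc)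
    finally have "exp (- \<alpha> * energy s) * (\<Prod>i\<in>UNIV. (2 * energy s + g i) * exp (energy s * x i))
        \<le> exp (- \<alpha> * energy s) * ((\<Prod>i\<in>UNIV. 2 / \<delta> + g i) * exp (\<beta> * energy s + energy s * (\<Sum>i\<in>UNIV. x i)))"
      by (intro mult_left_mono) auto
    also have "\<dots> = (\<Prod>i\<in>UNIV. 2 / \<delta> + g i)
        * (exp (- \<alpha> * energy s) * exp (\<beta> * energy s + energy s * (\<Sum>i\<in>UNIV. x i)))"
      by (simp only: mult_ac)
    also have "exp (- \<alpha> * energy s) * exp (\<beta> * energy s + energy s * (\<Sum>i\<in>UNIV. x i)) = exp (- \<beta> * energy s)"
    proof -
      have "- \<alpha> * energy s + (\<beta> * energy s + energy s * (\<Sum>i\<in>UNIV. x i)) = - \<beta> * energy s"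
        by (simp add: \<beta>_def field_simps)
      then show ?thesis by (simp only: mult_exp_exp)
    qed
    finally show "exp (- \<alpha> * energy s) * (\<Prod>i\<in>UNIV. (2 * energy s + g i) * exp (energy s * x i))
        \<le> (\<Prod>i\<in>UNIV. 2 / \<delta> + g i) * exp (- \<beta> * energy s)" .
  qed (use g in \<open>auto intro!: mult_nonneg_nonneg prod_nonneg add_nonneg_nonneg energy_nonneg\<close>)
qed

lemma state_sum_vec:
  fixes f :: "int set \<Rightarrow> 'n::finite \<Rightarrow> int \<Rightarrow> complex" and x g :: "'n \<Rightarrow> real"
  assumes f: "\<And>s i. s \<in> neutral \<Longrightarrow> (\<lambda>k. norm (f s i k)) summable_on UNIV"
    and bound: "\<And>s i. s \<in> neutral \<Longrightarrow> (\<Sum>\<^sub>\<infinity>k. norm (f s i k)) \<le> (2 * energy s + g i) * exp (energy s * x i)"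
    and g: "\<And>i. 0 \<le> g i" and x: "(\<Sum>i\<in>UNIV. x i) < 2 * pi * Im \<tau>"
  shows "(\<lambda>k::int^'n. \<Sum>\<^sub>\<infinity>s\<in>neutral. state_weight \<tau> s * (\<Prod>i\<in>UNIV. f s i (k $ i))) summable_on UNIV"
    and "(\<Sum>\<^sub>\<infinity>k::int^'n. \<Sum>\<^sub>\<infinity>s\<in>neutral. state_weight \<tau> s * (\<Prod>i\<in>UNIV. f s i (k $ i)))
         = (\<Sum>\<^sub>\<infinity>s\<in>neutral. state_weight \<tau> s * (\<Prod>i\<in>UNIV. \<Sum>\<^sub>\<infinity>k. f s i k))"
proof -
  have "(\<lambda>s. exp (2 * pi * Im \<tau> / 24) * (exp (- (2 * pi * Im \<tau>) * energy s)
      * (\<Prod>i\<in>UNIV. (2 * energy s + g i) * exp (energy s * x i)))) summable_on neutral"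
    by (intro summable_on_cmult_right summable_on_subset[OF summable_weighted_chars] x g)
      (auto simp: neutral_def)
  then have "(\<lambda>s. norm (state_weight \<tau> s) * (\<Prod>i\<in>UNIV. \<Sum>\<^sub>\<infinity>k. norm (f s i k))) summable_on neutral"
  proof (rule summable_on_comparison_test)
    fix s assume s: "s \<in> neutral"
    show "norm (state_weight \<tau> s) * (\<Prod>i\<in>UNIV. \<Sum>\<^sub>\<infinity>k. norm (f s i k))
      \<le> exp (2 * pi * Im \<tau> / 24) * (exp (- (2 * pi * Im \<tau>) * energy s)
        * (\<Prod>i\<in>UNIV. (2 * energy s + g i) * exp (energy s * x i)))"
      unfolding norm_state_weight mult.assoc[symmetric]
      by (intro mult_left_mono prod_mono) (auto simp: bound[OF s] infsum_nonneg)
  qed (auto intro!: mult_nonneg_nonneg prod_nonneg infsum_nonneg)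
  from fubini_prod_vec[OF f this]
  show "(\<lambda>k::int^'n. \<Sum>\<^sub>\<infinity>s\<in>neutral. state_weight \<tau> s * (\<Prod>i\<in>UNIV. f s i (k $ i))) summable_on UNIV"
    and "(\<Sum>\<^sub>\<infinity>k::int^'n. \<Sum>\<^sub>\<infinity>s\<in>neutral. state_weight \<tau> s * (\<Prod>i\<in>UNIV. f s i (k $ i)))
         = (\<Sum>\<^sub>\<infinity>s\<in>neutral. state_weight \<tau> s * (\<Prod>i\<in>UNIV. \<Sum>\<^sub>\<infinity>k. f s i k))" by simp_all
qed

section \<open>The series G\<close>

lemma G_term_eq:
  "G_term \<tau> y k = (\<Sum>\<^sub>\<infinity>s\<in>neutral. state_weight \<tau> s
     * (\<Prod>i\<in>UNIV. of_bool (occupied (k $ i) s) * exp (- (of_int (k $ i) + 1/2) * y $ i)))"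
proof -
  have "exp (of_int (- (2 * (k $ i) + 1)) * (y $ i) / 2) = exp (- (of_int (k $ i) + 1/2) * y $ i)" for i
    by (rule arg_cong[where f = exp]) (simp add: field_simps)
  then show ?thesis
    unfolding G_term_def G_coeff_eq
    by (simp add: infsum_cmult_left'[symmetric] prod.distrib mult.assoc del: exp_divide_power_eq)
qed

lemma G_converges_and_sum:
  fixes y :: "complex ^ 'n::{finite,linorder}"
  assumes pos: "\<And>i. 0 < Re (y $ i)" and lt: "(\<Sum>i\<in>UNIV. Re (y $ i)) < 2 * pi * Im \<tau>"
  shows "G_converges \<tau> y"
    and "(\<Sum>\<^sub>\<infinity>k. G_term \<tau> y k) = (\<Sum>\<^sub>\<infinity>s\<in>neutral. state_weight \<tau> s * (\<Prod>i\<in>UNIV. state_char s (y $ i)))"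
proof -
  define f where "f s i k = of_bool (occupied k s) * exp (- (of_int k + 1/2) * y $ i)"
    for s :: "int set" and i :: 'n and k :: int
  have fin: "finite s" if "s \<in> neutral" for s using that by (simp add: neutral_def)
  note * = state_sum_vec[of f
      "\<lambda>i. norm (exp (of_real (Re (y $ i)) / 2) / (exp (of_real (Re (y $ i))) - 1 :: complex))"
      "\<lambda>i. Re (y $ i)" \<tau>, unfolded f_def, OF norm_occupied(1)[OF fin pos] norm_occupied(2)[OF fin pos] norm_ge_zero lt]
  have tm: "G_term \<tau> y = (\<lambda>k. \<Sum>\<^sub>\<infinity>s\<in>neutral. state_weight \<tau> s
     * (\<Prod>i\<in>UNIV. of_bool (occupied (k $ i) s) * exp (- (of_int (k $ i) + 1/2) * y $ i)))"
    by (rule ext) (rule G_term_eq)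
  show "G_converges \<tau> y" unfolding G_converges_def tm by (rule *(1))
  show "(\<Sum>\<^sub>\<infinity>k. G_term \<tau> y k) = (\<Sum>\<^sub>\<infinity>s\<in>neutral. state_weight \<tau> s * (\<Prod>i\<in>UNIV. state_char s (y $ i)))"
    unfolding tm
    by (rule trans[OF *(2)], assumption, assumption, intro infsum_cong arg_cong2[where f = "(*)"] refl prod.cong infsumI has_sum_occupied fin pos)
qed

section \<open>The coefficients of the n-point function\<close>

text \<open>
  Polynomial growth in the energy: a class of factors that is stable under products and that the
  exponential decay of the weights beats.
\<close>

definition poly_bounded :: "(int set \<Rightarrow> complex) \<Rightarrow> bool" where
  "poly_bounded p \<longleftrightarrow> (\<exists>K m. \<forall>s. finite s \<longrightarrow> norm (p s) \<le> K * (1 + energy s) ^ m)"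

lemma poly_boundedI:
  "(\<And>s. finite s \<Longrightarrow> norm (p s) \<le> K * (1 + energy s) ^ m) \<Longrightarrow> poly_bounded p"
  unfolding poly_bounded_def by blast

lemma poly_bounded_const: "poly_bounded (\<lambda>s. c)"
  by (rule poly_boundedI[of _ "norm c" 0]) simp

lemma poly_bounded_mult:
  assumes "poly_bounded p" "poly_bounded p'"
  shows "poly_bounded (\<lambda>s. p s * p' s)"
proof -
  obtain K m K' m' where p: "\<And>s. finite s \<Longrightarrow> norm (p s) \<le> K * (1 + energy s) ^ m"
      "\<And>s. finite s \<Longrightarrow> norm (p' s) \<le> K' * (1 + energy s) ^ m'"
    using assms by (auto simp: poly_bounded_def)
  show ?thesis
  proof (rule poly_boundedI[of _ "K * K'" "m + m'"])
    fix s :: "int set" assume "finite s"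
    then have "norm (p s) * norm (p' s) \<le> (K * (1 + energy s) ^ m) * (K' * (1 + energy s) ^ m')"
      by (intro mult_mono p order_trans[OF norm_ge_zero p(1)]) auto
    then show "norm (p s * p' s) \<le> K * K' * (1 + energy s) ^ (m + m')"
      by (simp add: norm_mult power_add mult_ac)
  qed
qed

lemma poly_bounded_add:
  assumes "poly_bounded p" "poly_bounded p'"
  shows "poly_bounded (\<lambda>s. p s + p' s)"
proof -
  obtain K m K' m' where p: "\<And>s. finite s \<Longrightarrow> norm (p s) \<le> K * (1 + energy s) ^ m"
      "\<And>s. finite s \<Longrightarrow> norm (p' s) \<le> K' * (1 + energy s) ^ m'"
    using assms by (auto simp: poly_bounded_def)
  show ?thesis
  proof (rule poly_boundedI[of _ "\<bar>K\<bar> + \<bar>K'\<bar>" "m + m'"])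
    fix s :: "int set" assume s: "finite s"
    have E: "1 \<le> 1 + energy s" using energy_nonneg by simp
    have "norm (p s + p' s) \<le> K * (1 + energy s) ^ m + K' * (1 + energy s) ^ m'"
      using norm_triangle_ineq[of "p s" "p' s"] p[OF s] by linarith
    also have "\<dots> \<le> \<bar>K\<bar> * (1 + energy s) ^ (m + m') + \<bar>K'\<bar> * (1 + energy s) ^ (m + m')"
      using E by (intro add_mono mult_mono power_increasing) auto
    finally show "norm (p s + p' s) \<le> (\<bar>K\<bar> + \<bar>K'\<bar>) * (1 + energy s) ^ (m + m')"
      by (simp add: distrib_right)
  qed
qed

lemma poly_bounded_Lbar_eig: "poly_bounded (Lbar_eig r)"
proof -
  have "poly_bounded (\<lambda>s. \<Sum>c\<in>s. mode_charge c * (- (of_int c + 1/2)) ^ r)"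
  proof (rule poly_boundedI[of _ 2 "Suc r"])
    fix s :: "int set" assume s: "finite s"
    have "norm (\<Sum>c\<in>s. mode_charge c * (- (of_int c + 1/2)) ^ r) \<le> (\<Sum>c\<in>s. (1 + energy s) ^ r)"
    proof (rule sum_norm_le)
      fix c assume "c \<in> s"
      have "- (of_int c + 1/2) = complex_of_real (- (of_int c + 1/2))" by simp
      then have "norm (mode_charge c * (- (of_int c + 1/2)) ^ r) = \<bar>of_int c + 1 / 2\<bar> ^ r"
        by (simp only: norm_mult norm_mode_charge norm_power norm_of_real abs_minus_cancel mult_1)
      also have "\<dots> \<le> (1 + energy s) ^ r"
        using abs_le_energy[OF s \<open>c \<in> s\<close>] by (intro power_mono) auto
      finally show "norm (mode_charge c * (- (of_int c + 1/2)) ^ r) \<le> (1 + energy s) ^ r" .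
    qed
    also have "\<dots> = real (card s) * (1 + energy s) ^ r" by simp
    also have "\<dots> \<le> (2 * (1 + energy s)) * (1 + energy s) ^ r"
      using card_le_energy[of s] energy_nonneg[of s] by (intro mult_right_mono) auto
    finally show "norm (\<Sum>c\<in>s. mode_charge c * (- (of_int c + 1/2)) ^ r) \<le> 2 * (1 + energy s) ^ Suc r"
      by (simp only: power_Suc mult.assoc)
  qed
  from poly_bounded_add[OF this poly_bounded_const] show ?thesis
    by (simp add: Lbar_eig_def[abs_def])
qed

lemma poly_bounded_char_coeff: "poly_bounded (\<lambda>s. char_coeff s r)"
proof -
  have "poly_bounded (\<lambda>s. Lbar_eig (nat r) s * (1 / fact (nat r)))"
    by (intro poly_bounded_mult poly_bounded_Lbar_eig poly_bounded_const)
  then show ?thesis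
    by (cases "r = - 1"; cases "1 \<le> r") (simp_all add: char_coeff_def poly_bounded_const)
qed

lemma poly_bounded_prod_list:
  "(\<And>i. poly_bounded (p i)) \<Longrightarrow> poly_bounded (\<lambda>s. \<Prod>i\<leftarrow>xs. p i s)"
  by (induction xs) (auto intro: poly_bounded_const poly_bounded_mult)

lemma poly_bounded_prod_mset:
  "(\<And>i. poly_bounded (p i)) \<Longrightarrow> poly_bounded (\<lambda>s. \<Prod>i\<in>#\<kappa>. p i s)"
  by (induction \<kappa>) (auto intro: poly_bounded_const poly_bounded_mult)

lemma summable_poly_bounded:
  assumes "poly_bounded p" "0 < \<delta>"
  shows "(\<lambda>s. norm (p s) * exp (- \<delta> * energy s)) summable_on neutral"
proof -
  obtain K m where p: "\<And>s. finite s \<Longrightarrow> norm (p s) \<le> K * (1 + energy s) ^ m"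
    using assms(1) by (auto simp: poly_bounded_def)
  \<comment> \<open>The \<open>m\<close> linear factors share one half of the exponential decay.\<close>
  define \<epsilon> where "\<epsilon> = \<delta> / (2 * (real m + 1))"
  have \<epsilon>: "0 < \<epsilon>" "real m * \<epsilon> \<le> \<delta> / 2" using assms(2) by (simp_all add: \<epsilon>_def field_simps)
  have "(\<lambda>s. \<bar>K\<bar> * (2 / \<epsilon> + 1) ^ m * exp (- (\<delta> / 2) * energy s)) summable_on neutral"
    using assms(2)
    by (intro summable_on_cmult_right summable_on_subset[OF summable_on_exp_energy]) (auto simp: neutral_def)
  then show ?thesis
  proof (rule summable_on_comparison_test)
    fix s assume "s \<in> neutral"
    then have s: "finite s" by (simp add: neutral_def)
    have E: "0 \<le> energy s" by (rule energy_nonneg)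
    have "norm (p s) \<le> \<bar>K\<bar> * (1 + energy s) ^ m"
      using E by (intro order_trans[OF p[OF s]] mult_right_mono) auto
    also have "\<dots> \<le> \<bar>K\<bar> * ((2 / \<epsilon> + 1) * exp (\<epsilon> * energy s)) ^ m"
      using linear_le_exp[OF \<epsilon>(1) _ E, of 1] E by (intro mult_left_mono power_mono) auto
    also have "\<dots> = \<bar>K\<bar> * (2 / \<epsilon> + 1) ^ m * exp (real m * \<epsilon> * energy s)"
      by (simp add: power_mult_distrib exp_of_nat_mult[symmetric] mult.assoc)
    also have "\<dots> \<le> \<bar>K\<bar> * (2 / \<epsilon> + 1) ^ m * exp (\<delta> / 2 * energy s)"
      using \<epsilon>(1) mult_right_mono[OF \<epsilon>(2) E] by (intro mult_left_mono mult_nonneg_nonneg zero_le_power) auto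
    finally have "norm (p s) * exp (- \<delta> * energy s)
        \<le> \<bar>K\<bar> * (2 / \<epsilon> + 1) ^ m * exp (\<delta> / 2 * energy s) * exp (- \<delta> * energy s)"
      by (intro mult_right_mono) auto
    also have "\<dots> = \<bar>K\<bar> * (2 / \<epsilon> + 1) ^ m * (exp (\<delta> / 2 * energy s) * exp (- \<delta> * energy s))"
      by (simp only: mult_ac)
    also have "exp (\<delta> / 2 * energy s) * exp (- \<delta> * energy s) = exp (- (\<delta> / 2) * energy s)"
    proof -
      have "\<delta> / 2 * energy s + - \<delta> * energy s = - (\<delta> / 2) * energy s" by (simp add: field_simps)
      then show ?thesis by (simp only: mult_exp_exp)
    qed
    finally show "norm (p s) * exp (- \<delta> * energy s) \<le> \<bar>K\<bar> * (2 / \<epsilon> + 1) ^ m * exp (- (\<delta> / 2) * energy s)" .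
  qed simp
qed

text \<open>
  Each \<open>d/d\<tau>\<close> brings down a factor \<open>2\<pi>i L\<^sup>(\<^sup>1\<^sup>)(0)\<close>.
\<close>

lemma state_weight_sum_has_derivative:
  assumes p: "poly_bounded p" and \<tau>: "0 < Im \<tau>"
  shows "((\<lambda>\<tau>. \<Sum>\<^sub>\<infinity>s\<in>neutral. state_weight \<tau> s * p s) has_field_derivative
     2 * of_real pi * \<i> * (\<Sum>\<^sub>\<infinity>s\<in>neutral. state_weight \<tau> s * (Lbar_eig 1 s * p s))) (at \<tau>)"
proof -
  define l where "l s h = 2 * of_real pi * \<i> * Lbar_eig 1 s * h" for s and h :: complex
  define N where "N s = 2 * pi * (energy s + 1)" for s
  \<comment> \<open>A margin of half the distance of \<open>\<tau>\<close> from the real axis leaves half of the decay of the weights.\<close>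
  define \<epsilon> where "\<epsilon> = Im \<tau> / 2"
  have lin: "bounded_linear (l s)" for s
    unfolding l_def by (rule bounded_linear_mult_right)
  have bd: "norm (l s h) \<le> N s * norm h" for s h
  proof -
    have "norm (Lbar_eig 1 s) \<le> energy s + 1"
      unfolding Lbar_eig_1 using energy_nonneg[of s] norm_triangle_ineq4[of "of_real (energy s)" "1 / 24 :: complex"]
      by simp
    then have "(2 * pi * norm (Lbar_eig 1 s)) * norm h \<le> (2 * pi * (energy s + 1)) * norm h"
      by (intro mult_right_mono mult_left_mono) auto
    then show ?thesis by (simp add: l_def N_def norm_mult)
  qed
  have N: "0 \<le> N s" for s using energy_nonneg[of s] by (simp add: N_def)
  have \<epsilon>: "0 < \<epsilon>" using \<tau> by (simp add: \<epsilon>_def)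
  have "(\<lambda>s. exp (2 * pi * Im \<tau> / 24) * exp (2 * pi * \<epsilon>) * (norm (p s) * exp (- (pi * Im \<tau>) * energy s))) summable_on neutral"
    by (intro summable_on_cmult_right summable_poly_bounded p) (use \<tau> in auto)
  also have "(\<lambda>s. exp (2 * pi * Im \<tau> / 24) * exp (2 * pi * \<epsilon>) * (norm (p s) * exp (- (pi * Im \<tau>) * energy s)))
      = (\<lambda>s. norm (state_weight \<tau> s * p s) * exp (N s * \<epsilon>))"
  proof
    fix s
    have "exp (2 * pi * \<epsilon>) * exp (- (pi * Im \<tau>) * energy s) = exp (- (2 * pi * Im \<tau>) * energy s) * exp (N s * \<epsilon>)"
      unfolding mult_exp_exp by (rule arg_cong[where f = exp]) (simp add: N_def \<epsilon>_def field_simps)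
    then have "exp (2 * pi * Im \<tau> / 24) * norm (p s) * (exp (2 * pi * \<epsilon>) * exp (- (pi * Im \<tau>) * energy s))
        = exp (2 * pi * Im \<tau> / 24) * norm (p s) * (exp (- (2 * pi * Im \<tau>) * energy s) * exp (N s * \<epsilon>))"
      by (simp only:)
    then show "exp (2 * pi * Im \<tau> / 24) * exp (2 * pi * \<epsilon>) * (norm (p s) * exp (- (pi * Im \<tau>) * energy s))
      = norm (state_weight \<tau> s * p s) * exp (N s * \<epsilon>)"
      unfolding norm_mult norm_state_weight by (simp only: mult_ac)
  qed
  finally have sum: "(\<lambda>s. norm (state_weight \<tau> s * p s) * exp (N s * \<epsilon>)) summable_on neutral" .
  have "((\<lambda>h. \<Sum>\<^sub>\<infinity>s\<in>neutral. state_weight \<tau> s * p s * exp (l s h)) has_derivative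
      (\<lambda>h. \<Sum>\<^sub>\<infinity>s\<in>neutral. state_weight \<tau> s * p s * l s h)) (at 0)"
    by (rule has_derivative_exp_series[OF lin bd N \<epsilon> sum])
  moreover have "state_weight \<tau> s * p s * exp (l s h) = state_weight (h + \<tau>) s * p s" for s h
    unfolding state_weight_def l_def Lbar_eig_1[symmetric] by (simp add: mult_exp_exp algebra_simps)
  moreover have "(\<Sum>\<^sub>\<infinity>s\<in>neutral. state_weight \<tau> s * p s * l s h)
      = (2 * of_real pi * \<i> * (\<Sum>\<^sub>\<infinity>s\<in>neutral. state_weight \<tau> s * (Lbar_eig 1 s * p s))) * h" for h
    unfolding infsum_cmult_left'[symmetric] infsum_cmult_right'[symmetric]
    by (rule infsum_cong) (simp add: l_def mult_ac)
  ultimately have "((\<lambda>h. \<Sum>\<^sub>\<infinity>s\<in>neutral. state_weight (h + \<tau>) s * p s) has_field_derivative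
      2 * of_real pi * \<i> * (\<Sum>\<^sub>\<infinity>s\<in>neutral. state_weight \<tau> s * (Lbar_eig 1 s * p s))) (at 0)"
    by (simp add: has_field_derivative_def)
  then show ?thesis
    using DERIV_shift[of "\<lambda>\<tau>. \<Sum>\<^sub>\<infinity>s\<in>neutral. state_weight \<tau> s * p s" _ 0 \<tau>] by simp
qed

definition monomial_coeff :: "nat multiset \<Rightarrow> complex" where
  "monomial_coeff \<kappa> = (2 * of_real pi * \<i>) ^ size \<kappa> / (\<Prod>i\<in>set_mset \<kappa>. fact (count \<kappa> i))"

text \<open>
  Differentiating the monomial with respect to \<open>\<tau>\<^sub>m\<close> cancels one factor of its factorials.
\<close>

lemma monomial_coeff_add:
  "of_nat (count \<kappa> m + 1) * monomial_coeff (add_mset m \<kappa>) = 2 * of_real pi * \<i> * monomial_coeff \<kappa>"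
proof -
  have "(\<Prod>i\<in>set_mset (add_mset m \<kappa>). fact (count (add_mset m \<kappa>) i) :: complex)
      = fact (count \<kappa> m + 1) * (\<Prod>i\<in>set_mset \<kappa> - {m}. fact (count (add_mset m \<kappa>) i))"
    by (simp add: prod.insert_remove)
  also have "(\<Prod>i\<in>set_mset \<kappa> - {m}. fact (count (add_mset m \<kappa>) i) :: complex)
      = (\<Prod>i\<in>set_mset \<kappa> - {m}. fact (count \<kappa> i))"
    by (rule prod.cong) auto
  also have "(\<Prod>i\<in>set_mset \<kappa>. fact (count \<kappa> i) :: complex)
      = fact (count \<kappa> m) * (\<Prod>i\<in>set_mset \<kappa> - {m}. fact (count \<kappa> i))"
    by (cases "m \<in># \<kappa>") (auto simp: prod.remove not_in_iff)
  moreover have "fact (count \<kappa> m + 1) * (\<Prod>i\<in>set_mset \<kappa> - {m}. fact (count \<kappa> i))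
      = of_nat (count \<kappa> m + 1) * (fact (count \<kappa> m) * (\<Prod>i\<in>set_mset \<kappa> - {m}. fact (count \<kappa> i) :: complex))"
    by simp
  ultimately have "(\<Prod>i\<in>set_mset (add_mset m \<kappa>). fact (count (add_mset m \<kappa>) i) :: complex)
      = of_nat (count \<kappa> m + 1) * (\<Prod>i\<in>set_mset \<kappa>. fact (count \<kappa> i))" by metis
  moreover have "(of_nat (count \<kappa> m + 1) :: complex) \<noteq> 0" by (simp only: of_nat_eq_0_iff)
  ultimately show ?thesis
    unfolding monomial_coeff_def by (simp add: field_simps del: of_nat_Suc of_nat_add)
qed

text \<open>
  The operator \<open>\<partial>/\<partial>\<tau>\<^sub>r\<close> inserts \<open>2\<pi>i L\<^sup>(\<^sup>r\<^sup>)(0)\<close> for every \<open>r\<close>, for \<open>r = 1\<close> by termwise differentiation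
  and for \<open>r \<ge> 2\<close> because the exponential series in \<open>\<tau>\<^sub>r\<close> is differentiated formally. The claim is
  needed for all \<open>\<kappa>\<close> and on the whole half-plane for the induction, since these operators change
  \<open>\<kappa>\<close> and differentiate in \<open>\<tau>\<close>.
\<close>

lemma sigma_foldr_V:
  assumes "0 < Im \<tau>"
  shows "foldr (\<lambda>i. sigma_coeff (\<rho> i)) xs V_series \<kappa> \<tau>
    = monomial_coeff \<kappa> * (\<Sum>\<^sub>\<infinity>s\<in>neutral. state_weight \<tau> s * ((\<Prod>i\<in>#\<kappa>. Lbar_eig i s) * (\<Prod>i\<leftarrow>xs. char_coeff s (\<rho> i))))"
  using assms
proof (induction xs arbitrary: \<kappa> \<tau>)
  case Nil
  then show ?case
    unfolding foldr.simps(1) id_apply V_series_eq monomial_coeff_def state_weight_def Lbar_eig_1[symmetric]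
    by (simp add: mult_ac)
next
  case (Cons i xs)
  define f where "f = foldr (\<lambda>i. sigma_coeff (\<rho> i)) xs V_series"
  define P where "P \<kappa> s = (\<Prod>i\<in>#\<kappa>. Lbar_eig i s) * (\<Prod>i\<leftarrow>xs. char_coeff s (\<rho> i))" for \<kappa> s
  have f: "f \<kappa> \<tau> = monomial_coeff \<kappa> * (\<Sum>\<^sub>\<infinity>s\<in>neutral. state_weight \<tau> s * P \<kappa> s)" if "0 < Im \<tau>" for \<kappa> \<tau>
    unfolding f_def P_def by (rule Cons.IH[OF that])
  define r where "r = \<rho> i"
  have d: "d_tau m f \<kappa> \<tau> = 2 * of_real pi * \<i> * monomial_coeff \<kappa> * (\<Sum>\<^sub>\<infinity>s\<in>neutral. state_weight \<tau> s * (Lbar_eig m s * P \<kappa> s))" for m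
  proof (cases "m = 1")
    case True
    have "poly_bounded (P \<kappa>)"
      unfolding P_def
      by (intro poly_bounded_mult poly_bounded_prod_mset poly_bounded_prod_list poly_bounded_Lbar_eig poly_bounded_char_coeff)
    from DERIV_cmult[OF state_weight_sum_has_derivative[OF this Cons.prems], of "monomial_coeff \<kappa>"]
    have "((\<lambda>\<tau>. monomial_coeff \<kappa> * (\<Sum>\<^sub>\<infinity>s\<in>neutral. state_weight \<tau> s * P \<kappa> s)) has_field_derivative
       monomial_coeff \<kappa> * (2 * of_real pi * \<i> * (\<Sum>\<^sub>\<infinity>s\<in>neutral. state_weight \<tau> s * (Lbar_eig 1 s * P \<kappa> s)))) (at \<tau>)" .
    moreover have "\<forall>\<^sub>F \<tau>' in nhds \<tau>. f \<kappa> \<tau>' = monomial_coeff \<kappa> * (\<Sum>\<^sub>\<infinity>s\<in>neutral. state_weight \<tau>' s * P \<kappa> s)"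
    proof -
      have "\<forall>\<^sub>F \<tau>' in nhds \<tau>. \<tau>' \<in> {z. 0 < Im z}"
        using Cons.prems by (intro eventually_nhds_in_open open_halfspace_Im_gt) auto
      then show ?thesis by eventually_elim (simp add: f)
    qed
    ultimately show ?thesis
      using True by (simp add: d_tau_def deriv_cong_ev DERIV_imp_deriv mult_ac)
  next
    case False
    have "d_tau m f \<kappa> \<tau> = of_nat (count \<kappa> m + 1) * monomial_coeff (add_mset m \<kappa>)
        * (\<Sum>\<^sub>\<infinity>s\<in>neutral. state_weight \<tau> s * (Lbar_eig m s * P \<kappa> s))"
      using False by (simp add: d_tau_def f[OF Cons.prems] P_def mult.assoc)
    then show ?thesis by (simp only: monomial_coeff_add)
  qed
  have "sigma_coeff r f \<kappa> \<tau> = monomial_coeff \<kappa> * (\<Sum>\<^sub>\<infinity>s\<in>neutral. state_weight \<tau> s * (char_coeff s r * P \<kappa> s))"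
  proof -
    consider "r = - 1" | "1 \<le> r" | "r \<noteq> - 1" "\<not> 1 \<le> r" by blast
    then show ?thesis
    proof cases
      case 2
      define S where "S = (\<Sum>\<^sub>\<infinity>s\<in>neutral. state_weight \<tau> s * (Lbar_eig (nat r) s * P \<kappa> s))"
      have "(\<Sum>\<^sub>\<infinity>s\<in>neutral. state_weight \<tau> s * (char_coeff s r * P \<kappa> s))
          = (\<Sum>\<^sub>\<infinity>s\<in>neutral. 1 / fact (nat r) * (state_weight \<tau> s * (Lbar_eig (nat r) s * P \<kappa> s)))"
        using 2 by (intro infsum_cong) (simp add: char_coeff_def)
      also have "\<dots> = 1 / fact (nat r) * S"
        unfolding S_def by (rule infsum_cmult_right')
      finally have sum: "(\<Sum>\<^sub>\<infinity>s\<in>neutral. state_weight \<tau> s * (char_coeff s r * P \<kappa> s)) = 1 / fact (nat r) * S" .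
      have "sigma_coeff r f \<kappa> \<tau> = 2 * of_real pi * \<i> * monomial_coeff \<kappa> * S / (2 * of_real pi * \<i> * fact (nat r))"
        using 2 by (simp add: sigma_coeff_def d S_def)
      then show ?thesis
        unfolding sum by simp
    qed (auto simp: sigma_coeff_def char_coeff_def f[OF Cons.prems])
  qed
  then show ?case by (simp add: f_def[symmetric] r_def[symmetric] P_def mult_ac)
qed

lemma npoint_coeff_eq:
  assumes "0 < Im \<tau>"
  shows "npoint_coeff \<tau> r = dedekind_eta \<tau> * (\<Sum>\<^sub>\<infinity>s\<in>neutral. state_weight \<tau> s * (\<Prod>i\<in>UNIV. char_coeff s (r $ i)))"
  unfolding npoint_coeff_def sigma_foldr_V[OF assms]
  by (simp add: monomial_coeff_def sorted_list_prod)

lemma npoint_small: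
  assumes \<tau>: "0 < Im \<tau>"
  obtains R where "0 < R"
    "\<And>y :: complex ^ 'n::{finite,linorder}. (\<And>i. y $ i \<noteq> 0) \<Longrightarrow> (\<And>i. norm (y $ i) < R) \<Longrightarrow> npoint_converges \<tau> y \<and>
      npoint_sum \<tau> y = dedekind_eta \<tau> * (\<Sum>\<^sub>\<infinity>s\<in>neutral. state_weight \<tau> s * (\<Prod>i\<in>UNIV. state_char s (y $ i)))"
proof -
  obtain R :: real and g :: "complex \<Rightarrow> real" where R: "0 < R"
    "\<And>s y. s \<in> neutral \<Longrightarrow> y \<noteq> 0 \<Longrightarrow> norm y < R \<Longrightarrow>
      ((\<lambda>r. char_coeff s r * y powi r) has_sum state_char s y) UNIV"
    "\<And>s y. s \<in> neutral \<Longrightarrow> y \<noteq> 0 \<Longrightarrow> norm y < R \<Longrightarrow>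
      (\<lambda>r. norm (char_coeff s r * y powi r)) summable_on UNIV \<and>
      (\<Sum>\<^sub>\<infinity>r. norm (char_coeff s r * y powi r)) \<le> (2 * energy s + g y) * exp (energy s * norm y)"
    "\<And>y. 0 \<le> g y"
    by (rule char_coeff_has_sum) blast
  \<comment> \<open>The second bound ensures that the sum of the \<open>|y\<^sub>i|\<close> is less than \<open>2\<pi> Im \<tau>\<close>.\<close>
  define R' where "R' = min R (2 * pi * Im \<tau> / CARD('n))"
  show thesis
  proof (rule that[of R'])
    show "0 < R'" using R(1) \<tau> by (simp add: R'_def)
    fix y :: "complex ^ 'n::{finite,linorder}" assume y0: "\<And>i. y $ i \<noteq> 0" and yR: "\<And>i. norm (y $ i) < R'"
    have yR1: "norm (y $ i) < R" for i using yR[of i] by (simp add: R'_def)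
    have "(\<Sum>i\<in>UNIV. norm (y $ i)) < (\<Sum>i\<in>(UNIV :: 'n set). 2 * pi * Im \<tau> / CARD('n))"
      by (rule sum_strict_mono) (use yR in \<open>auto simp: R'_def\<close>)
    then have lt: "(\<Sum>i\<in>UNIV. norm (y $ i)) < 2 * pi * Im \<tau>" by simp
    define f where "f s i r = char_coeff s r * (y $ i) powi r" for s i r
    note * = state_sum_vec[of f "\<lambda>i. g (y $ i)" "\<lambda>i. norm (y $ i)" \<tau>, unfolded f_def,
        OF conjunct1[OF R(3)[OF _ y0 yR1]] conjunct2[OF R(3)[OF _ y0 yR1]] R(4) lt]
    have tm: "npoint_term \<tau> y = (\<lambda>r. dedekind_eta \<tau> *
        (\<Sum>\<^sub>\<infinity>s\<in>neutral. state_weight \<tau> s * (\<Prod>i\<in>UNIV. char_coeff s (r $ i) * (y $ i) powi (r $ i))))"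
      by (simp add: fun_eq_iff npoint_term_def npoint_coeff_eq[OF \<tau>] infsum_cmult_left'[symmetric]
          prod.distrib mult.assoc)
    show "npoint_converges \<tau> y \<and>
      npoint_sum \<tau> y = dedekind_eta \<tau> * (\<Sum>\<^sub>\<infinity>s\<in>neutral. state_weight \<tau> s * (\<Prod>i\<in>UNIV. state_char s (y $ i)))"
    proof
      show "npoint_converges \<tau> y"
        unfolding npoint_converges_def tm using y0 *(1) by (auto intro: summable_on_cmult_right)
      have "(\<Sum>\<^sub>\<infinity>s\<in>neutral. state_weight \<tau> s * (\<Prod>i\<in>UNIV. \<Sum>\<^sub>\<infinity>r. char_coeff s r * (y $ i) powi r))
        = (\<Sum>\<^sub>\<infinity>s\<in>neutral. state_weight \<tau> s * (\<Prod>i\<in>UNIV. state_char s (y $ i)))"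
        by (intro infsum_cong arg_cong2[where f = "(*)"] refl prod.cong infsumI R(2) y0 yR1)
      then show "npoint_sum \<tau> y = dedekind_eta \<tau> * (\<Sum>\<^sub>\<infinity>s\<in>neutral. state_weight \<tau> s * (\<Prod>i\<in>UNIV. state_char s (y $ i)))"
        unfolding npoint_sum_def tm infsum_cmult_right' using *(2) by simp
    qed
  qed
qed

section \<open>The domain of convergence\<close>

definition G_domain :: "complex \<Rightarrow> (complex ^ 'n::finite) set" where
  "G_domain \<tau> = {y. (\<forall>i. 0 < Re (y $ i)) \<and> (\<Sum>i\<in>UNIV. Re (y $ i)) < 2 * pi * Im \<tau>}"

lemma summable_on_imp_tendsto_0:
  fixes f :: "'a \<Rightarrow> complex"
  assumes "f summable_on UNIV" "inj \<kappa>"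
  shows "(\<lambda>n::nat. f (\<kappa> n)) \<longlonglongrightarrow> 0"
proof -
  have "f summable_on range \<kappa>" by (rule summable_on_subset_banach[OF assms(1)]) simp
  then have "(\<lambda>n. f (\<kappa> n)) summable_on UNIV"
    using summable_on_reindex[OF assms(2), of f] by (simp add: o_def)
  then show ?thesis
    by (intro summable_LIMSEQ_zero summable_on_imp_summable)
qed

lemma not_tendsto_0I:
  fixes f :: "nat \<Rightarrow> complex"
  assumes "0 < c" "\<forall>\<^sub>F n in sequentially. c \<le> norm (f n)"
  shows "\<not> f \<longlonglongrightarrow> 0"
proof
  assume "f \<longlonglongrightarrow> 0"
  then have "(\<lambda>n. norm (f n)) \<longlonglongrightarrow> 0" by (simp add: tendsto_norm_zero)
  from tendsto_lowerbound[OF this assms(2)] assms(1) show False by simp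
qed

definition abs_state_sum :: "complex \<Rightarrow> real" where
  "abs_state_sum \<tau> = (\<Sum>\<^sub>\<infinity>s\<in>{s. finite s}. norm (q_energy \<tau> s))"

lemma norm_G_term:
  "norm (G_term \<tau> y k) = norm (G_coeff \<tau> k) * (\<Prod>i\<in>UNIV. exp (- (of_int (k $ i) + 1 / 2) * Re (y $ i)))"
proof -
  have "Re (of_int (- (2 * (k $ i) + 1)) * (y $ i) / 2) = - (of_int (k $ i) + 1 / 2) * Re (y $ i)" for i
    by (simp add: field_simps)
  then show ?thesis
    by (simp only: G_term_def norm_mult prod_norm[symmetric] norm_exp_eq_Re)
qed

text \<open>
  If all \<open>k\<^sub>i\<close> are large, then the states in which one of them is not occupied have high energy,
  so the coefficient is close to a multiple of the neutral sector sum.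
\<close>

lemma G_coeff_eq_sub:
  assumes "0 < Im \<tau>" "\<And>i. 0 \<le> k $ i"
  shows "G_coeff \<tau> k = vacuum_weight \<tau> * (sector_sum \<tau> 0 - (\<Sum>\<^sub>\<infinity>s\<in>{s \<in> neutral. \<exists>i. k $ i \<in> s}. q_energy \<tau> s))"
proof -
  define B where "B = {s \<in> neutral. \<exists>i. k $ i \<in> s}"
  have B: "B \<subseteq> neutral" by (auto simp: B_def)
  have fin: "neutral \<subseteq> {s. finite s}" by (auto simp: neutral_def)
  have "G_coeff \<tau> k = (\<Sum>\<^sub>\<infinity>s\<in>neutral - B. vacuum_weight \<tau> * q_energy \<tau> s)"
    unfolding G_coeff_eq
    using assms(2) by (intro infsum_cong_neutral) (auto simp: B_def occupied_def state_weight_eq vacuum_weight_def not_less)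
  also have "\<dots> = vacuum_weight \<tau> * (\<Sum>\<^sub>\<infinity>s\<in>neutral - B. q_energy \<tau> s)"
    by (rule infsum_cmult_right')
  also have "(\<Sum>\<^sub>\<infinity>s\<in>neutral - B. q_energy \<tau> s) = sector_sum \<tau> 0 - (\<Sum>\<^sub>\<infinity>s\<in>B. q_energy \<tau> s)"
    unfolding sector_sum_def neutral_eq_sector[symmetric]
    using B fin by (intro infsum_Diff summable_q_energy assms(1)) auto
  finally show ?thesis by (simp add: B_def)
qed

text \<open>
  On the diagonal all conditions coincide, so the mode \<open>k\<close> is paid for only once. Emptying it
  leaves a state of charge \<open>-1\<close>.
\<close>

lemma G_coeff_diagonal_eq:
  fixes k :: int
  assumes "0 < Im \<tau>" "k < 0"
  shows "G_coeff \<tau> ((\<chi> i. k) :: int ^ 'n::{finite,linorder})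
    = vacuum_weight \<tau> * exp (2 * of_real pi * \<i> * \<tau> * of_real \<bar>of_int k + 1 / 2\<bar>)
      * (sector_sum \<tau> (- 1) - (\<Sum>\<^sub>\<infinity>t\<in>{t \<in> sector (- 1). k \<in> t}. q_energy \<tau> t))"
proof -
  define B where "B = {t \<in> sector (- 1). k \<in> t}"
  define u where "u = exp (2 * of_real pi * \<i> * \<tau> * of_real \<bar>of_int k + 1 / 2\<bar>)"
  have charge_insert: "charge (insert k t) = charge t + 1" if "finite t" "k \<notin> t" for t
    using that assms(2) by (simp add: charge_eq_sum)
  have bij: "bij_betw (insert k) (sector (- 1) - B) {s \<in> neutral. k \<in> s}"
  proof (rule bij_betwI[where g = "\<lambda>s. s - {k}"])
    show "insert k \<in> sector (- 1) - B \<rightarrow> {s \<in> neutral. k \<in> s}"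
      by (auto simp: sector_def neutral_def B_def charge_insert)
    show "(\<lambda>s. s - {k}) \<in> {s \<in> neutral. k \<in> s} \<rightarrow> sector (- 1) - B"
    proof
      fix s assume s: "s \<in> {s \<in> neutral. k \<in> s}"
      then show "s - {k} \<in> sector (- 1) - B"
        using charge_insert[of "s - {k}"] by (auto simp: sector_def neutral_def B_def insert_absorb)
    qed
  qed (auto simp: B_def)
  have "G_coeff \<tau> ((\<chi> i. k) :: int ^ 'n::{finite,linorder}) = (\<Sum>\<^sub>\<infinity>s\<in>{s \<in> neutral. k \<in> s}. vacuum_weight \<tau> * q_energy \<tau> s)"
    unfolding G_coeff_eq
    using assms(2) by (intro infsum_cong_neutral) (auto simp: occupied_def state_weight_eq vacuum_weight_def)
  also have "\<dots> = (\<Sum>\<^sub>\<infinity>t\<in>sector (- 1) - B. vacuum_weight \<tau> * q_energy \<tau> (insert k t))"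
    by (rule infsum_reindex_bij_betw[OF bij, symmetric])
  also have "\<dots> = (\<Sum>\<^sub>\<infinity>t\<in>sector (- 1) - B. vacuum_weight \<tau> * u * q_energy \<tau> t)"
  proof (rule infsum_cong)
    fix t assume "t \<in> sector (- 1) - B"
    then have "energy (insert k t) = \<bar>of_int k + 1 / 2\<bar> + energy t"
      by (simp add: energy_def sector_def B_def)
    then have "q_energy \<tau> (insert k t) = u * q_energy \<tau> t"
      by (simp add: q_energy_def u_def mult_exp_exp algebra_simps)
    then show "vacuum_weight \<tau> * q_energy \<tau> (insert k t) = vacuum_weight \<tau> * u * q_energy \<tau> t" by simp
  qed
  also have "\<dots> = vacuum_weight \<tau> * u * (\<Sum>\<^sub>\<infinity>t\<in>sector (- 1) - B. q_energy \<tau> t)"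
    by (rule infsum_cmult_right')
  also have "(\<Sum>\<^sub>\<infinity>t\<in>sector (- 1) - B. q_energy \<tau> t) = sector_sum \<tau> (- 1) - (\<Sum>\<^sub>\<infinity>t\<in>B. q_energy \<tau> t)"
    unfolding sector_sum_def
    by (intro infsum_Diff summable_q_energy assms(1)) (auto simp: B_def sector_def)
  finally show ?thesis by (simp add: B_def u_def)
qed

lemma tail_eventually_small:
  assumes "0 < Im \<tau>" "0 < c"
  shows "\<forall>\<^sub>F n in sequentially. exp (- (2 * pi * Im \<tau>) * (real n + 1 / 2)) * abs_state_sum \<tau> < c"
proof -
  have "(\<lambda>n. exp (- (2 * pi * Im \<tau>) * (real n + 1 / 2)) * abs_state_sum \<tau>) \<longlonglongrightarrow> 0"
    using assms(1) by real_asymp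
  then show ?thesis using assms(2) by (rule order_tendstoD)
qed

text \<open>
  The indices have \<open>k\<^sub>i = K + n\<close> in the given component and \<open>k\<^sub>j = K\<close> in the others. For large \<open>K\<close> the
  coefficients stay away from \<open>0\<close>, and if \<open>Re y\<^sub>i \<le> 0\<close>, so do the terms.
\<close>

lemma G_converges_imp_pos:
  fixes y :: "complex ^ 'n::{finite,linorder}"
  assumes \<tau>: "0 < Im \<tau>" and conv: "G_converges \<tau> y"
  shows "0 < Re (y $ i)"
proof (rule ccontr)
  assume "\<not> 0 < Re (y $ i)"
  then have neg: "Re (y $ i) \<le> 0" by simp
  obtain K where K: "exp (- (2 * pi * Im \<tau>) * (real K + 1 / 2)) * abs_state_sum \<tau> < norm (sector_sum \<tau> 0) / 4"
    using eventually_happens[OF tail_eventually_small[OF \<tau>, of "norm (sector_sum \<tau> 0) / 4"]] sector_sum_nonzero[OF \<tau>] by auto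
  define \<kappa> :: "nat \<Rightarrow> int ^ 'n::{finite,linorder}"
    where "\<kappa> n = (\<chi> j. if j = i then int K + int n else int K)" for n
  have inj: "inj \<kappa>"
    by (rule injI) (auto simp: \<kappa>_def vec_eq_iff dest: spec[of _ i])
  define c where "c = norm (vacuum_weight \<tau>) * (norm (sector_sum \<tau> 0) / 2) * (\<Prod>j\<in>UNIV - {i}. exp (- (real K + 1 / 2) * Re (y $ j)))"
  have "0 < c" using sector_sum_nonzero[OF \<tau>] by (auto simp: c_def vacuum_weight_def intro!: mult_pos_pos prod_pos)
  moreover have "c \<le> norm (G_term \<tau> y (\<kappa> n))" for n
  proof -
    define B where "B = {s \<in> neutral. \<exists>j. \<kappa> n $ j \<in> s}"
    have B: "B = (B \<inter> {s. int K \<in> s}) \<union> (B \<inter> {s. int K \<notin> s})" by auto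
    have fin: "B \<subseteq> {s. finite s}" by (auto simp: B_def neutral_def)
    have "(\<Sum>\<^sub>\<infinity>s\<in>B. q_energy \<tau> s) = (\<Sum>\<^sub>\<infinity>s\<in>B \<inter> {s. int K \<in> s}. q_energy \<tau> s) + (\<Sum>\<^sub>\<infinity>s\<in>B \<inter> {s. int K \<notin> s}. q_energy \<tau> s)"
      by (subst B, rule infsum_Un_disjoint) (use fin in \<open>auto intro!: summable_q_energy \<tau>\<close>)
    moreover have "norm (\<Sum>\<^sub>\<infinity>s\<in>B \<inter> {s. int K \<in> s}. q_energy \<tau> s) \<le> exp (- (2 * pi * Im \<tau>) * \<bar>of_int (int K) + 1 / 2\<bar>) * abs_state_sum \<tau>"
      unfolding abs_state_sum_def using fin by (intro norm_sum_q_energy_containing \<tau>) auto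
    moreover have "norm (\<Sum>\<^sub>\<infinity>s\<in>B \<inter> {s. int K \<notin> s}. q_energy \<tau> s)
        \<le> exp (- (2 * pi * Im \<tau>) * \<bar>of_int (int K + int n) + 1 / 2\<bar>) * abs_state_sum \<tau>"
      unfolding abs_state_sum_def using fin by (intro norm_sum_q_energy_containing \<tau>) (auto simp: B_def \<kappa>_def split: if_splits)
    moreover have "exp (- (2 * pi * Im \<tau>) * \<bar>of_int (int K + int n) + 1 / 2\<bar>) * abs_state_sum \<tau>
        \<le> exp (- (2 * pi * Im \<tau>) * (real K + 1 / 2)) * abs_state_sum \<tau>"
      using \<tau> by (intro mult_right_mono) (auto simp: abs_state_sum_def intro: infsum_nonneg)
    ultimately have "norm (\<Sum>\<^sub>\<infinity>s\<in>B. q_energy \<tau> s) \<le> norm (sector_sum \<tau> 0) / 2"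
      using K norm_triangle_ineq[of "\<Sum>\<^sub>\<infinity>s\<in>B \<inter> {s. int K \<in> s}. q_energy \<tau> s" "\<Sum>\<^sub>\<infinity>s\<in>B \<inter> {s. int K \<notin> s}. q_energy \<tau> s"]
      by simp
    then have "norm (sector_sum \<tau> 0) / 2 \<le> norm (sector_sum \<tau> 0 - (\<Sum>\<^sub>\<infinity>s\<in>B. q_energy \<tau> s))"
      using norm_triangle_ineq2[of "sector_sum \<tau> 0" "\<Sum>\<^sub>\<infinity>s\<in>B. q_energy \<tau> s"] by linarith
    moreover have "G_coeff \<tau> (\<kappa> n) = vacuum_weight \<tau> * (sector_sum \<tau> 0 - (\<Sum>\<^sub>\<infinity>s\<in>B. q_energy \<tau> s))"
      unfolding B_def by (rule G_coeff_eq_sub[OF \<tau>]) (simp add: \<kappa>_def)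
    ultimately have 1: "norm (vacuum_weight \<tau>) * (norm (sector_sum \<tau> 0) / 2) \<le> norm (G_coeff \<tau> (\<kappa> n))"
      using mult_left_mono[of "norm (sector_sum \<tau> 0) / 2" _ "norm (vacuum_weight \<tau>)"] by (simp only: norm_mult norm_ge_zero)
    have "(\<Prod>j\<in>UNIV. exp (- (of_int (\<kappa> n $ j) + 1 / 2) * Re (y $ j)))
        = exp (- (of_int (\<kappa> n $ i) + 1 / 2) * Re (y $ i)) * (\<Prod>j\<in>UNIV - {i}. exp (- (of_int (\<kappa> n $ j) + 1 / 2) * Re (y $ j)))"
      by (rule prod.remove) auto
    also have "(\<Prod>j\<in>UNIV - {i}. exp (- (of_int (\<kappa> n $ j) + 1 / 2) * Re (y $ j)))
        = (\<Prod>j\<in>UNIV - {i}. exp (- (real K + 1 / 2) * Re (y $ j)))"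
      by (rule prod.cong) (auto simp: \<kappa>_def)
    finally have 2: "(\<Prod>j\<in>UNIV. exp (- (of_int (\<kappa> n $ j) + 1 / 2) * Re (y $ j)))
        = exp (- (of_int (\<kappa> n $ i) + 1 / 2) * Re (y $ i)) * (\<Prod>j\<in>UNIV - {i}. exp (- (real K + 1 / 2) * Re (y $ j)))" .
    have "1 \<le> exp (- (of_int (\<kappa> n $ i) + 1 / 2) * Re (y $ i))"
      using neg by (auto simp: \<kappa>_def intro!: mult_nonpos_nonpos)
    then have "1 * (\<Prod>j\<in>UNIV - {i}. exp (- (real K + 1 / 2) * Re (y $ j)))
        \<le> (\<Prod>j\<in>UNIV. exp (- (of_int (\<kappa> n $ j) + 1 / 2) * Re (y $ j)))"
      unfolding 2 by (intro mult_right_mono) (auto intro: prod_nonneg)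
    then show ?thesis
      unfolding c_def norm_G_term using 1 by (intro mult_mono) (auto intro: prod_nonneg)
  qed
  ultimately have "\<not> (\<lambda>n. G_term \<tau> y (\<kappa> n)) \<longlonglongrightarrow> 0"
    by (intro not_tendsto_0I) auto
  then show False
    using summable_on_imp_tendsto_0[OF conv[unfolded G_converges_def] inj] by simp
qed

text \<open>
  Along the diagonal \<open>k = - n - 1\<close> the coefficients decay precisely like \<open>|q|\<^sup>n\<close>, while the
  exponentials grow like \<open>e\<close> to the power \<open>n \<Sum> Re y\<^sub>i\<close>.
\<close>

lemma G_converges_imp_lt:
  fixes y :: "complex ^ 'n::{finite,linorder}"
  assumes \<tau>: "0 < Im \<tau>" and conv: "G_converges \<tau> y"
  shows "(\<Sum>i\<in>UNIV. Re (y $ i)) < 2 * pi * Im \<tau>"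
proof (rule ccontr)
  assume "\<not> ?thesis"
  then have ge: "2 * pi * Im \<tau> \<le> (\<Sum>i\<in>UNIV. Re (y $ i))" by simp
  define \<kappa> :: "nat \<Rightarrow> int ^ 'n::{finite,linorder}" where "\<kappa> n = (\<chi> j. - int n - 1)" for n
  have inj: "inj \<kappa>" by (rule injI) (auto simp: \<kappa>_def vec_eq_iff)
  define c where "c = norm (vacuum_weight \<tau>) * (norm (sector_sum \<tau> (- 1)) / 2)"
  have Z_pos: "0 < norm (sector_sum \<tau> (- 1)) / 2" using sector_sum_nonzero[OF \<tau>] by simp
  then have "0 < c" by (simp add: c_def vacuum_weight_def)
  moreover have "\<forall>\<^sub>F n in sequentially. c \<le> norm (G_term \<tau> y (\<kappa> n))"
    using tail_eventually_small[OF \<tau> Z_pos]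
  proof eventually_elim
    case (elim n)
    define k where "k = - int n - 1"
    have abs_k: "\<bar>of_int k + 1 / 2 :: real\<bar> = real n + 1 / 2" by (simp add: k_def)
    have "norm (\<Sum>\<^sub>\<infinity>t\<in>{t \<in> sector (- 1). k \<in> t}. q_energy \<tau> t)
        \<le> exp (- (2 * pi * Im \<tau>) * \<bar>of_int k + 1 / 2\<bar>) * abs_state_sum \<tau>"
      unfolding abs_state_sum_def by (intro norm_sum_q_energy_containing \<tau>) (auto simp: sector_def)
    then have "norm (sector_sum \<tau> (- 1)) / 2 \<le> norm (sector_sum \<tau> (- 1) - (\<Sum>\<^sub>\<infinity>t\<in>{t \<in> sector (- 1). k \<in> t}. q_energy \<tau> t))"
      using elim norm_triangle_ineq2[of "sector_sum \<tau> (- 1)" "\<Sum>\<^sub>\<infinity>t\<in>{t \<in> sector (- 1). k \<in> t}. q_energy \<tau> t"]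
      unfolding abs_k by linarith
    then have "norm (vacuum_weight \<tau>) * exp (- (2 * pi * Im \<tau>) * (real n + 1 / 2)) * (norm (sector_sum \<tau> (- 1)) / 2)
        \<le> norm (vacuum_weight \<tau>) * exp (- (2 * pi * Im \<tau>) * (real n + 1 / 2))
          * norm (sector_sum \<tau> (- 1) - (\<Sum>\<^sub>\<infinity>t\<in>{t \<in> sector (- 1). k \<in> t}. q_energy \<tau> t))"
      by (intro mult_left_mono) auto
    also have "\<dots> = norm (G_coeff \<tau> (\<kappa> n))"
    proof -
      have "k < 0" by (simp add: k_def)
      moreover have "Re (2 * of_real pi * \<i> * \<tau> * of_real (real n + 1 / 2)) = - (2 * pi * Im \<tau>) * (real n + 1 / 2)"
        by simp
      ultimately show ?thesis
        unfolding \<kappa>_def k_def[symmetric]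
        by (simp only: G_coeff_diagonal_eq[OF \<tau>] abs_k norm_mult norm_exp_eq_Re)
    qed
    finally have "norm (vacuum_weight \<tau>) * exp (- (2 * pi * Im \<tau>) * (real n + 1 / 2)) * (norm (sector_sum \<tau> (- 1)) / 2)
        \<le> norm (G_coeff \<tau> (\<kappa> n))" .
    moreover have "exp ((real n + 1 / 2) * (2 * pi * Im \<tau>)) \<le> (\<Prod>i\<in>UNIV. exp (- (of_int (\<kappa> n $ i) + 1 / 2) * Re (y $ i)))"
    proof -
      have "(\<Prod>i\<in>UNIV. exp (- (of_int (\<kappa> n $ i) + 1 / 2) * Re (y $ i)))
          = exp (\<Sum>i\<in>UNIV. (real n + 1 / 2) * Re (y $ i))"
        by (simp add: exp_sum \<kappa>_def)
      then show ?thesis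
        using ge by (simp add: sum_distrib_left[symmetric] mult_left_mono)
    qed
    ultimately have "norm (vacuum_weight \<tau>) * exp (- (2 * pi * Im \<tau>) * (real n + 1 / 2)) * (norm (sector_sum \<tau> (- 1)) / 2)
          * exp ((real n + 1 / 2) * (2 * pi * Im \<tau>))
        \<le> norm (G_term \<tau> y (\<kappa> n))"
      unfolding norm_G_term by (intro mult_mono) auto
    also have "norm (vacuum_weight \<tau>) * exp (- (2 * pi * Im \<tau>) * (real n + 1 / 2)) * (norm (sector_sum \<tau> (- 1)) / 2)
          * exp ((real n + 1 / 2) * (2 * pi * Im \<tau>))
        = c * (exp (- (2 * pi * Im \<tau>) * (real n + 1 / 2)) * exp ((real n + 1 / 2) * (2 * pi * Im \<tau>)))"
      by (simp only: c_def mult_ac)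
    also have "\<dots> = c" by (simp add: mult_exp_exp)
    finally show ?case .
  qed
  ultimately have "\<not> (\<lambda>n. G_term \<tau> y (\<kappa> n)) \<longlonglongrightarrow> 0"
    by (intro not_tendsto_0I) auto
  then show False
    using summable_on_imp_tendsto_0[OF conv[unfolded G_converges_def] inj] by simp
qed

lemma G_converges_iff:
  fixes y :: "complex ^ 'n::{finite,linorder}"
  assumes "0 < Im \<tau>"
  shows "G_converges \<tau> y \<longleftrightarrow> y \<in> G_domain \<tau>"
  using G_converges_imp_pos[OF assms] G_converges_imp_lt[OF assms] G_converges_and_sum(1)[of y \<tau>]
  by (auto simp: G_domain_def)

lemma open_G_domain: "open (G_domain \<tau>)"
proof -
  have "G_domain \<tau> = (\<Inter>i. {y. 0 < Re (y $ i)}) \<inter> {y. (\<Sum>i\<in>UNIV. Re (y $ i)) < 2 * pi * Im \<tau>}"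
    by (auto simp: G_domain_def)
  also have "open \<dots>"
    by (auto intro!: open_Int open_INT open_Collect_less continuous_intros)
  finally show ?thesis .
qed

lemma convex_G_domain: "convex (G_domain \<tau>)"
proof (rule convexI)
  fix y z :: "complex ^ 'n" and u v :: real
  assume y: "y \<in> G_domain \<tau>" and z: "z \<in> G_domain \<tau>" and uv: "0 \<le> u" "0 \<le> v" "u + v = 1"
  have "(\<Sum>i\<in>UNIV. Re ((u *\<^sub>R y + v *\<^sub>R z) $ i)) = u * (\<Sum>i\<in>UNIV. Re (y $ i)) + v * (\<Sum>i\<in>UNIV. Re (z $ i))"
    by (simp add: sum.distrib sum_distrib_left)
  also have "\<dots> < 2 * pi * Im \<tau>"
    using y z uv by (intro convex_bound_lt) (auto simp: G_domain_def)
  moreover have "0 < Re ((u *\<^sub>R y + v *\<^sub>R z) $ i)" for i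
  proof -
    have "u * - Re (y $ i) + v * - Re (z $ i) < 0"
      using y z uv by (intro convex_bound_lt) (auto simp: G_domain_def)
    then show ?thesis by simp
  qed
  ultimately show "u *\<^sub>R y + v *\<^sub>R z \<in> G_domain \<tau>" by (simp add: G_domain_def)
qed

lemma open_convex_line:
  fixes y :: "complex ^ 'n::finite"
  shows "open {z. z *s y \<in> G_domain \<tau>}" "convex {z. z *s y \<in> G_domain \<tau>}"
proof -
  have lin: "linear (\<lambda>z. z *s y)"
    by (rule linearI) (simp_all add: vec_eq_iff algebra_simps)
  then have "continuous_on UNIV (\<lambda>z. z *s y)" by (rule linear_continuous_on_compose[OF continuous_on_id])
  from open_vimage[OF open_G_domain this] show "open {z. z *s y \<in> G_domain \<tau>}"
    by (simp add: vimage_def)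
  from convex_linear_vimage[OF lin convex_G_domain] show "convex {z. z *s y \<in> G_domain \<tau>}"
    by (simp add: vimage_def)
qed

section \<open>Analytic continuation along complex lines\<close>

lemma norm_linear_sum_le:
  fixes v :: "complex ^ 'n::finite"
  shows "norm (\<Sum>i\<in>UNIV. - (of_int (k i) + 1/2) * v $ i) \<le> (\<Sum>i\<in>UNIV. \<bar>of_int (k i) + 1 / 2\<bar>) * norm v"
  unfolding sum_distrib_right
proof (rule sum_norm_le)
  fix i
  have "- (of_int (k i) + 1/2) = complex_of_real (- (of_int (k i) + 1/2))" by simp
  then have "norm (- (of_int (k i) + 1/2) * v $ i) = \<bar>of_int (k i) + 1 / 2\<bar> * norm (v $ i)"
    by (simp only: norm_mult norm_of_real abs_minus_cancel)
  also have "\<dots> \<le> \<bar>of_int (k i) + 1 / 2\<bar> * norm v"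
    by (intro mult_left_mono Finite_Cartesian_Product.norm_nth_le) auto
  finally show "norm (- (of_int (k i) + 1/2) * v $ i) \<le> \<bar>of_int (k i) + 1 / 2\<bar> * norm v" .
qed

lemma norm_G_term_add:
  "norm (G_term \<tau> (y + u) k) = norm (G_term \<tau> y k) * (\<Prod>i\<in>UNIV. exp (- (of_int (k $ i) + 1 / 2) * Re (u $ i)))"
  by (simp add: norm_G_term distrib_left exp_add prod.distrib mult.assoc)

text \<open>
  The domain is open, so the series still converges absolutely after a displacement of every
  coordinate by \<open>\<plusminus>\<epsilon>\<close>. Summing over all choices of signs dominates \<open>exp (\<epsilon> \<Sum> |k\<^sub>i + 1/2|)\<close>.
\<close>

lemma G_term_margin:
  fixes y :: "complex ^ 'n::{finite,linorder}"
  assumes \<tau>: "0 < Im \<tau>" and y: "y \<in> G_domain \<tau>"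
  obtains \<epsilon> where "0 < \<epsilon>"
    "(\<lambda>k. norm (G_term \<tau> y k) * exp ((\<Sum>i\<in>UNIV. \<bar>of_int (k $ i) + 1 / 2\<bar>) * \<epsilon>)) summable_on UNIV"
proof -
  obtain e where e: "0 < e" "ball y e \<subseteq> G_domain \<tau>"
    using open_G_domain y by (meson open_contains_ball)
  define \<epsilon> where "\<epsilon> = e / (2 * real CARD('n))"
  have \<epsilon>: "0 < \<epsilon>" using e by (simp add: \<epsilon>_def)
  define u :: "'n::{finite,linorder} set \<Rightarrow> complex ^ 'n::{finite,linorder}"
    where "u X = (\<chi> i. of_real (if i \<in> X then - \<epsilon> else \<epsilon>))" for X
  have "y + u X \<in> G_domain \<tau>" for X
  proof -
    have "norm (u X) \<le> (\<Sum>i\<in>UNIV. norm (u X $ i))" by (simp add: norm_vec_def L2_set_le_sum)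
    also have "\<dots> = (\<Sum>i\<in>(UNIV :: 'n set). \<epsilon>)"
      by (rule sum.cong) (use \<epsilon> in \<open>auto simp: u_def\<close>)
    also have "\<dots> < e" using e by (simp add: \<epsilon>_def)
    finally show ?thesis using e(2) by (auto simp: dist_norm)
  qed
  then have "(\<lambda>k. norm (G_term \<tau> (y + u X) k)) summable_on UNIV" for X
    using G_converges_iff[OF \<tau>, of "y + u X"] summable_on_iff_abs_summable_on_complex
    by (auto simp: G_converges_def)
  then have "((\<lambda>k. \<Sum>X\<in>UNIV. norm (G_term \<tau> (y + u X) k)) has_sum (\<Sum>X\<in>UNIV. \<Sum>\<^sub>\<infinity>k. norm (G_term \<tau> (y + u X) k))) UNIV"
    by (intro has_sum_sum has_sum_infsum)
  then have "(\<lambda>k. \<Sum>X\<in>UNIV. norm (G_term \<tau> (y + u X) k)) summable_on UNIV"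
    by (rule has_sum_imp_summable)
  then have "(\<lambda>k. norm (G_term \<tau> y k) * exp ((\<Sum>i\<in>UNIV. \<bar>of_int (k $ i) + 1 / 2\<bar>) * \<epsilon>)) summable_on UNIV"
  proof (rule summable_on_comparison_test)
    fix k :: "int ^ 'n::{finite,linorder}"
    define a where "a i = (of_int (k $ i) + 1 / 2 :: real)" for i
    have "exp ((\<Sum>i\<in>UNIV. \<bar>a i\<bar>) * \<epsilon>) = (\<Prod>i\<in>UNIV. exp (\<bar>a i\<bar> * \<epsilon>))"
      by (simp add: sum_distrib_right exp_sum)
    also have "\<dots> \<le> (\<Prod>i\<in>UNIV. exp (a i * \<epsilon>) + exp (- (a i * \<epsilon>)))"
      by (intro prod_mono) (auto simp: abs_if)
    also have "\<dots> = (\<Sum>X\<in>UNIV. \<Prod>i\<in>UNIV. exp (- a i * Re (u X $ i)))"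
    proof -
      have "(\<Prod>i\<in>X. exp (a i * \<epsilon>)) * (\<Prod>i\<in>UNIV - X. exp (- (a i * \<epsilon>))) = (\<Prod>i\<in>UNIV. exp (- a i * Re (u X $ i)))" for X
      proof -
        have "(\<Prod>i\<in>UNIV. exp (- a i * Re (u X $ i)))
            = (\<Prod>i\<in>UNIV - X. exp (- a i * Re (u X $ i))) * (\<Prod>i\<in>X. exp (- a i * Re (u X $ i)))"
          by (rule prod.subset_diff) auto
        then show ?thesis by (simp add: u_def mult.commute)
      qed
      then show ?thesis by (subst prod_add) auto
    qed
    finally have "norm (G_term \<tau> y k) * exp ((\<Sum>i\<in>UNIV. \<bar>a i\<bar>) * \<epsilon>)
        \<le> norm (G_term \<tau> y k) * (\<Sum>X\<in>UNIV. \<Prod>i\<in>UNIV. exp (- a i * Re (u X $ i)))"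
      by (intro mult_left_mono) auto
    then show "norm (G_term \<tau> y k) * exp ((\<Sum>i\<in>UNIV. \<bar>of_int (k $ i) + 1 / 2\<bar>) * \<epsilon>)
        \<le> (\<Sum>X\<in>UNIV. norm (G_term \<tau> (y + u X) k))"
      by (simp add: a_def norm_G_term_add sum_distrib_left)
  qed simp
  with \<epsilon> show thesis by (rule that)
qed

lemma G_exp_differentiable:
  assumes \<tau>: "0 < Im \<tau>"
  shows "complex_differentiable_on (G_exp \<tau>) (G_domain \<tau> :: (complex ^ 'n::{finite,linorder}) set)"
  unfolding complex_differentiable_on_def
proof
  fix y :: "complex ^ 'n::{finite,linorder}" assume y: "y \<in> G_domain \<tau>"
  obtain \<epsilon> where \<epsilon>: "0 < \<epsilon>"
    "(\<lambda>k. norm (G_term \<tau> y k) * exp ((\<Sum>i\<in>UNIV. \<bar>of_int (k $ i) + 1 / 2\<bar>) * \<epsilon>)) summable_on UNIV"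
    by (rule G_term_margin[OF \<tau> y])
  define l where "l k v = (\<Sum>i\<in>UNIV. - (of_int (k $ i) + 1/2) * v $ i)"
    for k :: "int ^ 'n::{finite,linorder}" and v :: "complex ^ 'n::{finite,linorder}"
  define f' where "f' v = dedekind_eta \<tau> * (\<Sum>\<^sub>\<infinity>k. G_term \<tau> y k * l k v)" for v
  have lin: "bounded_linear (l k)" for k
    unfolding l_def
    by (intro bounded_linear_sum bounded_linear_const_mult bounded_linear_vec_nth)
  have "((\<lambda>v. \<Sum>\<^sub>\<infinity>k. G_term \<tau> y k * exp (l k v)) has_derivative (\<lambda>v. \<Sum>\<^sub>\<infinity>k. G_term \<tau> y k * l k v)) (at 0)"
  proof (rule has_derivative_exp_series[where N = "\<lambda>k. \<Sum>i\<in>UNIV. \<bar>of_int (k $ i) + 1 / 2\<bar>", OF lin _ _ \<epsilon>])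
    show "norm (l k v) \<le> (\<Sum>i\<in>UNIV. \<bar>of_int (k $ i) + 1 / 2\<bar>) * norm v" for k v
      unfolding l_def by (rule norm_linear_sum_le)
  qed (auto intro: sum_nonneg)
  from has_derivative_mult_right[OF this, of "dedekind_eta \<tau>"]
  have "((\<lambda>v. dedekind_eta \<tau> * (\<Sum>\<^sub>\<infinity>k. G_term \<tau> y k * exp (l k v))) has_derivative f') (at (y - y))"
    by (simp add: f'_def[abs_def])
  moreover have "((\<lambda>v. v - y) has_derivative (\<lambda>v. v)) (at y)"
    by (auto intro!: derivative_eq_intros)
  ultimately have "((\<lambda>v. dedekind_eta \<tau> * (\<Sum>\<^sub>\<infinity>k. G_term \<tau> y k * exp (l k (v - y)))) has_derivative f') (at y)"
    using has_derivative_compose[of "\<lambda>v. v - y" "\<lambda>v. v" y UNIV _ f'] by simp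
  moreover have "G_term \<tau> y k * exp (l k (v - y)) = G_term \<tau> v k" for v k
  proof -
    have *: "(\<Prod>i\<in>UNIV. exp (of_int (- (2 * (k $ i) + 1)) * (z $ i) / 2)) = exp (l k z)" for z
      unfolding l_def exp_sum[OF finite]
      by (intro prod.cong arg_cong[where f = exp] refl) (simp add: field_simps)
    have "l k v = l k y + l k (v - y)"
      using bounded_linear.linear[OF lin, of k] by (simp add: linear_diff)
    then show ?thesis unfolding G_term_def * by (simp only: exp_add mult.assoc)
  qed
  ultimately have "(G_exp \<tau> has_derivative f') (at y)"
    by (simp add: G_exp_def[abs_def])
  moreover have "f' (c *s v) = c * f' v" for c v
  proof -
    have "l k (c *s v) = c * l k v" for k by (simp add: l_def sum_distrib_left mult_ac)
    then have "(\<Sum>\<^sub>\<infinity>k. G_term \<tau> y k * l k (c *s v)) = (\<Sum>\<^sub>\<infinity>k. c * (G_term \<tau> y k * l k v))"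
      by (simp add: mult_ac)
    also have "\<dots> = c * (\<Sum>\<^sub>\<infinity>k. G_term \<tau> y k * l k v)" by (rule infsum_cmult_right')
    finally show ?thesis by (simp add: f'_def mult_ac)
  qed
  ultimately show "\<exists>f'. (G_exp \<tau> has_derivative f') (at y) \<and> (\<forall>c v. f' (c *s v) = c * f' v)" by blast
qed

lemma holomorphic_on_line:
  fixes f :: "complex ^ 'n::finite \<Rightarrow> complex"
  assumes f: "complex_differentiable_on f D" and S: "open S" "\<And>z. z \<in> S \<Longrightarrow> z *s y \<in> D"
  shows "(\<lambda>z. f (z *s y)) holomorphic_on S"
  unfolding holomorphic_on_open[OF S(1)]
proof
  fix z assume "z \<in> S"
  then obtain f' where f': "(f has_derivative f') (at (z *s y))" "\<And>c v. f' (c *s v) = c * f' v"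
    using f S(2) unfolding complex_differentiable_on_def by blast
  have "((\<lambda>z. z *s y) has_derivative (\<lambda>h. h *s y)) (at z)"
    by (intro bounded_linear_imp_has_derivative linear_conv_bounded_linear[THEN iffD1] linearI)
      (simp_all add: vec_eq_iff algebra_simps)
  from has_derivative_compose[OF this f'(1)]
  have "((\<lambda>z. f (z *s y)) has_derivative (\<lambda>h. h * f' y)) (at z)" by (simp add: f'(2))
  moreover have "(\<lambda>h. h * f' y) = (*) (f' y)" by (simp add: fun_eq_iff mult.commute)
  ultimately have "((\<lambda>z. f (z *s y)) has_field_derivative f' y) (at z)"
    by (simp add: has_field_derivative_def)
  then show "\<exists>f'. ((\<lambda>z. f (z *s y)) has_field_derivative f') (at z)" ..
qed

lemma power_int_sum:
  fixes z :: "'a::field"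
  assumes "z \<noteq> 0"
  shows "z powi (\<Sum>i\<in>I. f i) = (\<Prod>i\<in>I. z powi f i)"
  using assms by (induction I rule: infinite_finite_induct) (simp_all add: power_int_add)

text \<open>
  Only exponents \<open>r\<^sub>i \<ge> -1\<close> occur, so multiplication by \<open>z\<^sup>n\<close> turns the Laurent series on the line
  \<open>z y\<close> into a power series in \<open>z\<close>. It converges absolutely at \<open>z = 1\<close>, hence uniformly on the closed
  disc.
\<close>

lemma npoint_line:
  fixes y :: "complex ^ 'n::{finite,linorder}"
  assumes \<tau>: "0 < Im \<tau>" and conv: "npoint_converges \<tau> y"
  obtains h where "continuous_on (cball 0 1) h" "h holomorphic_on ball 0 1"
    "\<And>z. z \<noteq> 0 \<Longrightarrow> h z = z ^ CARD('n) * npoint_sum \<tau> (z *s y)"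
proof -
  define N where "N r = (\<Sum>i\<in>UNIV. r $ i) + int CARD('n)" for r :: "int ^ 'n::{finite,linorder}"
  define h where "h z = (\<Sum>\<^sub>\<infinity>r. npoint_term \<tau> y r * z ^ nat (N r))" for z
  have "(\<lambda>r. norm (npoint_term \<tau> y r)) summable_on UNIV"
    using conv summable_on_iff_abs_summable_on_complex by (auto simp: npoint_converges_def)
  then have unif: "uniform_limit (cball 0 1) (\<lambda>X z. \<Sum>r\<in>X. npoint_term \<tau> y r * z ^ nat (N r)) h (finite_subsets_at_top UNIV)"
    unfolding h_def
    by (intro Weierstrass_m_test_general[where M = "\<lambda>r. norm (npoint_term \<tau> y r)"])
      (auto simp: norm_mult norm_power intro!: mult_left_le power_le_one)
  have "\<forall>\<^sub>F X in finite_subsets_at_top UNIV.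
      continuous_on (cball 0 1) (\<lambda>z. \<Sum>r\<in>X. npoint_term \<tau> y r * z ^ nat (N r)) \<and>
      (\<lambda>z. \<Sum>r\<in>X. npoint_term \<tau> y r * z ^ nat (N r)) holomorphic_on ball 0 1"
    by (intro always_eventually allI conjI continuous_intros holomorphic_intros)
  from holomorphic_uniform_limit[OF this unif]
  have h: "continuous_on (cball 0 1) h" "h holomorphic_on ball 0 1" by auto
  have "npoint_term \<tau> y r * z ^ nat (N r) = z ^ CARD('n) * npoint_term \<tau> (z *s y) r" if "z \<noteq> 0" for z r
  proof (cases "\<forall>i. - 1 \<le> r $ i")
    case True
    have "(\<Sum>i\<in>(UNIV :: 'n set). - 1) \<le> (\<Sum>i\<in>UNIV. r $ i)" using True by (intro sum_mono) auto
    then have "0 \<le> N r" by (simp add: N_def)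
    then have "z ^ nat (N r) = z powi N r" by (simp add: power_int_def)
    also have "\<dots> = (\<Prod>i\<in>UNIV. z powi (r $ i)) * z ^ CARD('n)"
      using that by (simp add: N_def power_int_add power_int_sum)
    finally show ?thesis
      by (simp add: npoint_term_def power_int_mult_distrib prod.distrib mult_ac)
  next
    case False
    then obtain i where "r $ i < - 1" by (auto simp: not_le)
    then have "char_coeff s (r $ i) = 0" for s by (simp add: char_coeff_def)
    then have zero: "(\<Prod>i\<in>UNIV. char_coeff s (r $ i)) = 0" for s
      by (intro prod_zero) auto
    have "npoint_coeff \<tau> r = 0" unfolding npoint_coeff_eq[OF \<tau>] zero by simp
    then show ?thesis by (simp add: npoint_term_def)
  qed
  then have "h z = z ^ CARD('n) * npoint_sum \<tau> (z *s y)" if "z \<noteq> 0" for z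
    using that by (simp add: h_def npoint_sum_def infsum_cmult_right')
  with h show thesis by (rule that)
qed

lemma npoint_sum_eq_near_0:
  assumes \<tau>: "0 < Im \<tau>"
  obtains R where "0 < R"
    "\<And>y :: complex ^ 'n::{finite,linorder}. y \<in> G_domain \<tau> \<Longrightarrow> (\<And>i. norm (y $ i) < R) \<Longrightarrow>
      npoint_converges \<tau> y \<and> npoint_sum \<tau> y = G_exp \<tau> y"
proof -
  obtain R where R: "0 < R"
    "\<And>y :: complex ^ 'n::{finite,linorder}. (\<And>i. y $ i \<noteq> 0) \<Longrightarrow> (\<And>i. norm (y $ i) < R) \<Longrightarrow> npoint_converges \<tau> y \<and>
      npoint_sum \<tau> y = dedekind_eta \<tau> * (\<Sum>\<^sub>\<infinity>s\<in>neutral. state_weight \<tau> s * (\<Prod>i\<in>UNIV. state_char s (y $ i)))"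
    by (rule npoint_small[OF \<tau>]) blast
  show thesis
  proof (rule that[OF R(1)])
    fix y :: "complex ^ 'n::{finite,linorder}" assume y: "y \<in> G_domain \<tau>" and small: "\<And>i. norm (y $ i) < R"
    have "y $ i \<noteq> 0" for i using y by (auto simp: G_domain_def dest: spec[of _ i])
    from R(2)[OF this small] show "npoint_converges \<tau> y \<and> npoint_sum \<tau> y = G_exp \<tau> y"
      using G_converges_and_sum(2)[of y \<tau>] y by (simp add: G_domain_def G_exp_def)
  qed
qed

lemma line_near_0:
  fixes y :: "complex ^ 'n::{finite,linorder}"
  assumes \<tau>: "0 < Im \<tau>" and y: "y \<in> G_domain \<tau>"
  obtains \<rho> where "0 < \<rho>" "\<rho> \<le> 1"
    "\<And>z. norm z < \<rho> \<Longrightarrow> z *s y \<in> G_domain \<tau> \<Longrightarrow>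
      npoint_converges \<tau> (z *s y) \<and> npoint_sum \<tau> (z *s y) = G_exp \<tau> (z *s y)"
    "\<And>t. 0 < t \<Longrightarrow> t \<le> 1 \<Longrightarrow> of_real t *s y \<in> G_domain \<tau>"
proof -
  obtain R where R: "0 < R"
    "\<And>y :: complex ^ 'n::{finite,linorder}. y \<in> G_domain \<tau> \<Longrightarrow> (\<And>i. norm (y $ i) < R) \<Longrightarrow>
      npoint_converges \<tau> y \<and> npoint_sum \<tau> y = G_exp \<tau> y"
    by (rule npoint_sum_eq_near_0[OF \<tau>]) blast
  show thesis
  proof (rule that[of "min 1 (R / (norm y + 1))"])
    show "0 < min 1 (R / (norm y + 1))" using R(1) by (simp add: add_nonneg_pos)
    fix z assume z: "norm z < min 1 (R / (norm y + 1))" "z *s y \<in> G_domain \<tau>"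
    have "norm ((z *s y) $ i) < R" for i
    proof -
      have "norm ((z *s y) $ i) = norm z * norm (y $ i)" by (simp add: norm_mult)
      also have "\<dots> \<le> norm z * (norm y + 1)"
        using Finite_Cartesian_Product.norm_nth_le[of y i] by (intro mult_left_mono) auto
      also have "\<dots> < R" using z(1) by (simp add: pos_less_divide_eq add_nonneg_pos)
      finally show ?thesis .
    qed
    then show "npoint_converges \<tau> (z *s y) \<and> npoint_sum \<tau> (z *s y) = G_exp \<tau> (z *s y)"
      using R(2) z(2) by blast
  next
    fix t :: real assume t: "0 < t" "t \<le> 1"
    define S where "S = (\<Sum>i\<in>UNIV. Re (y $ i))"
    have "0 \<le> Re (y $ i)" for i using y by (simp add: G_domain_def less_imp_le)
    then have "0 \<le> S" unfolding S_def by (rule sum_nonneg)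
    then have "t * S \<le> S" using t by (simp add: mult_left_le_one_le)
    then show "of_real t *s y \<in> G_domain \<tau>"
      using y t by (auto simp: G_domain_def S_def sum_distrib_left)
  qed auto
qed

text \<open>
  The point \<open>z = 1\<close> lies on the boundary of the disc in which the power series is holomorphic, so
  the identity theorem is applied inside and the value at \<open>1\<close> is reached by continuity.
\<close>

lemma npoint_sum_eq_G_exp:
  fixes y :: "complex ^ 'n::{finite,linorder}"
  assumes \<tau>: "0 < Im \<tau>" and y: "y \<in> G_domain \<tau>" and conv: "npoint_converges \<tau> y"
  shows "npoint_sum \<tau> y = G_exp \<tau> y"
proof -
  obtain \<rho> where \<rho>: "0 < \<rho>" "\<rho> \<le> 1"
    "\<And>z. norm z < \<rho> \<Longrightarrow> z *s y \<in> G_domain \<tau> \<Longrightarrow>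
      npoint_converges \<tau> (z *s y) \<and> npoint_sum \<tau> (z *s y) = G_exp \<tau> (z *s y)"
    "\<And>t. 0 < t \<Longrightarrow> t \<le> 1 \<Longrightarrow> of_real t *s y \<in> G_domain \<tau>"
    by (rule line_near_0[OF \<tau> y]) blast
  obtain h where h: "continuous_on (cball 0 1) h" "h holomorphic_on ball 0 1"
    "\<And>z. z \<noteq> 0 \<Longrightarrow> h z = z ^ CARD('n) * npoint_sum \<tau> (z *s y)"
    by (rule npoint_line[OF \<tau> conv]) blast
  define T where "T = {z. z *s y \<in> G_domain \<tau>}"
  define g where "g z = z ^ CARD('n) * G_exp \<tau> (z *s y)" for z
  have T: "open T" "convex T" by (simp_all add: T_def open_convex_line)
  have holG: "g holomorphic_on T"
    unfolding g_def
    by (intro holomorphic_intros holomorphic_on_line[OF G_exp_differentiable[OF \<tau>] T(1)]) (simp add: T_def)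
  have not0: "z \<noteq> 0" if "z \<in> T" for z
    using that by (auto simp: T_def G_domain_def)
  have eq: "h z = g z" if "z \<in> T \<inter> ball 0 1" for z
  proof (rule analytic_continuation_open[of "T \<inter> ball 0 \<rho>" "T \<inter> ball 0 1" h g])
    show "T \<inter> ball 0 \<rho> \<noteq> {}"
      using \<rho>(1,2) \<rho>(4)[of "\<rho> / 2"] by (auto simp: T_def intro!: exI[of _ "of_real (\<rho> / 2)"])
    show "connected (T \<inter> ball 0 1)"
      by (intro convex_connected convex_Int T convex_ball)
    show "h z = g z" if "z \<in> T \<inter> ball 0 \<rho>" for z
      using that \<rho>(3)[of z] h(3)[of z] not0[of z] by (auto simp: T_def g_def)
  qed (use that T \<rho> h(2) holG in \<open>auto intro: holomorphic_on_subset\<close>)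
  define t where "t n = 1 - 1 / (real n + 2)" for n
  have t: "0 < t n" "t n < 1" "\<bar>t n\<bar> \<le> 1" for n by (simp_all add: t_def)
  have t_lim: "(\<lambda>n. of_real (t n) :: complex) \<longlonglongrightarrow> 1"
  proof -
    have "t \<longlonglongrightarrow> 1" unfolding t_def by real_asymp
    from tendsto_of_real[OF this] show ?thesis by simp
  qed
  have "(\<lambda>n. h (of_real (t n))) \<longlonglongrightarrow> h 1"
    by (rule continuous_on_tendsto_compose[OF h(1) t_lim]) (use t in \<open>auto intro: less_imp_le\<close>)
  moreover have "(\<lambda>n. g (of_real (t n))) \<longlonglongrightarrow> g 1"
    using \<rho>(4) t y
    by (intro continuous_on_tendsto_compose[OF holomorphic_on_imp_continuous_on[OF holG] t_lim])
      (auto simp: T_def less_imp_le)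
  moreover have "h (of_real (t n)) = g (of_real (t n))" for n
    using eq[of "of_real (t n)"] t[of n] \<rho>(4)[of "t n"] by (auto simp: T_def)
  ultimately have "h 1 = g 1" by (auto intro: LIMSEQ_unique)
  then show ?thesis using h(3)[of 1] by (simp add: g_def)
qed

text \<open>
  The line through \<open>y\<close> meets every neighbourhood of \<open>0\<close> inside the domain, and there the value of
  \<open>F\<close> is prescribed by the convergent Laurent series.
\<close>

lemma npoint_function_unique:
  fixes F :: "complex ^ 'n::{finite,linorder} \<Rightarrow> complex"
  assumes \<tau>: "0 < Im \<tau>" and F: "is_npoint_function_on \<tau> (G_domain \<tau>) F" and y: "y \<in> G_domain \<tau>"
  shows "F y = G_exp \<tau> y"
proof -
  obtain \<rho> where \<rho>: "0 < \<rho>" "\<rho> \<le> 1"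
    "\<And>z. norm z < \<rho> \<Longrightarrow> z *s y \<in> G_domain \<tau> \<Longrightarrow>
      npoint_converges \<tau> (z *s y) \<and> npoint_sum \<tau> (z *s y) = G_exp \<tau> (z *s y)"
    "\<And>t. 0 < t \<Longrightarrow> t \<le> 1 \<Longrightarrow> of_real t *s y \<in> G_domain \<tau>"
    by (rule line_near_0[OF \<tau> y]) blast
  define T where "T = {z. z *s y \<in> G_domain \<tau>}"
  have T: "open T" "convex T" by (simp_all add: T_def open_convex_line)
  have "F (1 *s y) = G_exp \<tau> (1 *s y)"
  proof (rule analytic_continuation_open[of "T \<inter> ball 0 \<rho>" T "\<lambda>z. F (z *s y)" "\<lambda>z. G_exp \<tau> (z *s y)"])
    show "T \<inter> ball 0 \<rho> \<noteq> {}"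
      using \<rho>(1,2) \<rho>(4)[of "\<rho> / 2"] by (auto simp: T_def intro!: exI[of _ "of_real (\<rho> / 2)"])
    show "(\<lambda>z. F (z *s y)) holomorphic_on T"
      using F by (intro holomorphic_on_line[OF _ T(1)]) (auto simp: is_npoint_function_on_def T_def)
    show "(\<lambda>z. G_exp \<tau> (z *s y)) holomorphic_on T"
      by (intro holomorphic_on_line[OF G_exp_differentiable[OF \<tau>] T(1)]) (auto simp: T_def)
    show "F (z *s y) = G_exp \<tau> (z *s y)" if "z \<in> T \<inter> ball 0 \<rho>" for z
      using F that \<rho>(3)[of z] by (auto simp: is_npoint_function_on_def T_def)
  qed (use T y in \<open>auto simp: T_def intro: convex_connected\<close>)
  then show ?thesis by simp
qed

lemma G_exp_is_npoint_function:
  assumes \<tau>: "0 < Im \<tau>"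
  shows "is_npoint_function_on \<tau> (G_domain \<tau> :: (complex ^ 'n::{finite,linorder}) set) (G_exp \<tau>)"
  unfolding is_npoint_function_on_def
proof (intro conjI)
  obtain R where R: "0 < R"
    "\<And>y :: complex ^ 'n::{finite,linorder}. y \<in> G_domain \<tau> \<Longrightarrow> (\<And>i. norm (y $ i) < R) \<Longrightarrow>
      npoint_converges \<tau> y \<and> npoint_sum \<tau> y = G_exp \<tau> y"
    by (rule npoint_sum_eq_near_0[OF \<tau>]) blast
  define b where "b = 2 * pi * Im \<tau> / CARD('n)"
  define r where "r = min R b / 2"
  have "0 < b" using \<tau> by (simp add: b_def)
  then have r: "0 < r" "r < R" "r < b" using R(1) by (auto simp: r_def min_def)
  then have "real CARD('n) * r < 2 * pi * Im \<tau>"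
    by (simp add: b_def pos_less_divide_eq mult.commute)
  note r = r this
  define U :: "(complex ^ 'n::{finite,linorder}) set"
    where "U = G_domain \<tau> \<inter> (\<Inter>i. {y. norm (y $ i) < R})"
  have "open U"
    unfolding U_def by (auto intro!: open_Int open_INT open_Collect_less continuous_intros open_G_domain)
  moreover have "(\<chi> i. of_real r) \<in> U"
    using r by (simp add: U_def G_domain_def)
  moreover have "npoint_converges \<tau> y" if "y \<in> U" for y
    using that R(2)[of y] by (simp add: U_def)
  moreover have "U \<subseteq> G_domain \<tau>" by (simp add: U_def)
  ultimately have "open U \<and> U \<noteq> {} \<and> U \<subseteq> G_domain \<tau> \<and> (\<forall>y\<in>U. npoint_converges \<tau> y)" by auto
  then show "\<exists>U :: (complex ^ 'n::{finite,linorder}) set.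
      open U \<and> U \<noteq> {} \<and> U \<subseteq> G_domain \<tau> \<and> (\<forall>y\<in>U. npoint_converges \<tau> y)" ..
  show "connected (G_domain \<tau>)" by (intro convex_connected convex_G_domain)
qed (use \<tau> in \<open>auto simp: open_G_domain G_exp_differentiable npoint_sum_eq_G_exp\<close>)

theorem proposition3p2:
  fixes \<tau> :: complex
    and T :: "(complex ^ 'n::{finite,linorder}) set"
  assumes "Im \<tau> > 0"
    and "open T" "connected T" "T \<noteq> {}"
    and "\<And>t i. t \<in> T \<Longrightarrow> t $ i \<noteq> 0"
    and "\<And>y. (\<chi> i. exp (y $ i)) \<in> T \<Longrightarrow> G_converges \<tau> y"
  shows "(\<exists>F :: complex ^ 'n::{finite,linorder} \<Rightarrow> complex.
              is_npoint_function_on \<tau> {y. G_converges \<tau> y} F) \<and>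
         (\<forall>F :: complex ^ 'n::{finite,linorder} \<Rightarrow> complex.
              is_npoint_function_on \<tau> {y. G_converges \<tau> y} F \<longrightarrow>
              (\<forall>y. G_converges \<tau> y \<longrightarrow> F y = G_exp \<tau> y))"
proof -
  have "{y :: complex ^ 'n::{finite,linorder}. G_converges \<tau> y} = G_domain \<tau>"
    using G_converges_iff[OF assms(1)] by auto
  then show ?thesis
    using G_exp_is_npoint_function[OF assms(1)] npoint_function_unique[OF assms(1)] by auto
qed

end
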